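(* Let $\tau_0$ be exponentially distributed with $P(\tau_0>t)=e^{-t}$ for $t\ge 0$, and let $T^*$ be the cumulative payment function \[T^*(t)=\frac{\theta}{\lambda}\Big(1_{t>t_0}+\int_0^{\min\{t,t_0\}} f(s)\,ds\Big),\] where $f$ is the unique function in $L_1[0,t_0]$ such that \[w_-(e^{-t_0+t})+\int_t^{t_0} w_-(e^{-s+t})f(s)\,ds=1\quad\forall t\in[0,t_0],\] the constant $t_0$ is $t_0=\min\{t\in[0,-\log p_1]\mid g_0(t)\le 0\}$, and $g_0$ is the unique function in $L_1[0,-\log p_1]$ such that \[e^{-t}-w_-(e^{-t})-\int_0^t w_-(e^{-t+s})g_0(s)\,ds=0\quad\forall t\in[0,-\log p_1].\] Then $(\tau_0,T^* )$ is an optimal dynamic pricing process. Moreover, a dynamic pricing process $(\tau,T)$ is optimal if and only if $P(\tau<\infty)=1$ and $P(T(\tau)\le y)=P(T^*(\tau_0)\le y)$ for all $y\in\mathbb{R}^+$.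
   Context: Standing assumptions: $\theta>0$ (buyer's value of the good) and $\lambda>0$ are constants. The probability weighting functions $w_+,w_-:[0,1]\to[0,1]$ are strictly increasing, thrice differentiable, with $w_\pm(0)=0$, $w_\pm(1)=1$, $w_\pm'(0)>1$, $w_\pm'(1)>1$ and $w_\pm'''(p)>0$ for all $p$. $p_1$ denotes the unique $p\in(0,1)$ with $w_-(p)=p$. A cumulative payment function is a function $T:\mathbb{R}^+\to\mathbb{R}^+$ of the form $T(t)=\int_0^t f(s)ds+\sum_{i}1_{t_i<t}T_i$, where $f\ge 0$ is integrable and $(t_i)_i,(T_i)_i$ are countable sequences of nonnegative numbers with $t_i$ increasing in $i$ (so $T$ is nondecreasing, left continuous, $T(0)=0$; $T(\infty)$ denotes $\lim_{t\to\infty}T(t)$). A stopping time is a random variable $\tau\in[0,\infty]$ whose CDF $F(t)=P(\tau\le t)$ can be written $F=F_1+F_2$ with $F_1$ absolutely continuous and $F_2$ a jump function, both nondecreasing and nonnegative. A dynamic pricing process is a pair $(\tau,T)$ ($\tau$ is the time the buyer receives the good, $T(t)$ the cumulative payment made before time $t$). It is DIR compatible if for every $s$ with $P(\tau>s)>0$, \[\theta\,w_+(P(\tau<\infty\mid\tau>s))-\lambda\int_0^\infty w_-\big(P(T(\tau)-T(s)>y\mid \tau>s)\big)dy\ge 0.\] Its revenue is $\int_0^\infty P(T(\tau)>y)dy$, and it is optimal if it is DIR compatible and maximizes revenue among all DIR compatible dynamic pricing processes. *)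

theory Defs
  imports "HOL-Probability.Probability"
begin

definition weighting :: "(real \<Rightarrow> real) \<Rightarrow> bool" where
  "weighting w \<longleftrightarrow>
     strict_mono_on {0..1} w \<and> w ` {0..1} \<subseteq> {0..1} \<and> w 0 = 0 \<and> w 1 = 1 \<and>
     (\<exists>w1 w2 w3.
        (\<forall>p\<in>{0..1}. (w has_real_derivative w1 p) (at p within {0..1}) \<and>
                      (w1 has_real_derivative w2 p) (at p within {0..1}) \<and>
                      (w2 has_real_derivative w3 p) (at p within {0..1}) \<and>
                      w3 p > 0) \<and>
        w1 0 > 1 \<and> w1 1 > 1)"

definition p_one :: "(real \<Rightarrow> real) \<Rightarrow> real" where
  "p_one w = (THE p. 0 < p \<and> p < 1 \<and> w p = p)"

definition cum_payment :: "(real \<Rightarrow> real) \<Rightarrow> bool" where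
  "cum_payment T \<longleftrightarrow>
     (\<exists>f ts Ts. (\<forall>s\<ge>0. 0 \<le> f s) \<and> f absolutely_integrable_on {0..} \<and>
        incseq ts \<and> (\<forall>i. 0 \<le> ts i \<and> 0 \<le> Ts i) \<and>
        (\<forall>t\<ge>0. summable (\<lambda>i. if ts i < t then Ts i else 0) \<and>
                T t = integral {0..t} f + (\<Sum>i. if ts i < t then Ts i else 0)))"

text \<open>Stopping time: a random variable with values in [0,\<infinity>] whose CDF on [0,\<infinity>)
  is the sum of a nonnegative nondecreasing absolutely continuous function
  (a + int_0^t h) and a nonnegative jump function (sum_i c_i 1_{s_i <= t}).\<close>
definition is_stopping_time :: "'a measure \<Rightarrow> ('a \<Rightarrow> ennreal) \<Rightarrow> bool" where
  "is_stopping_time M \<tau> \<longleftrightarrow> \<tau> \<in> borel_measurable M \<and>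
     (\<exists>a h ss c. 0 \<le> a \<and> (\<forall>s\<ge>0. 0 \<le> h s) \<and> h absolutely_integrable_on {0..} \<and>
        (\<forall>i. 0 \<le> ss i \<and> 0 \<le> (c i :: real)) \<and> summable c \<and>
        (\<forall>t\<ge>0. measure M {\<omega>\<in>space M. \<tau> \<omega> \<le> ennreal t}
                 = a + integral {0..t} h + (\<Sum>i. if ss i \<le> t then c i else 0)))"

text \<open>T evaluated at a time in [0,\<infinity>]; T(\<infinity>) = lim_{t\<rightarrow>\<infinity>} T(t) (= sup, T nondecreasing).\<close>
definition pay_at :: "(real \<Rightarrow> real) \<Rightarrow> ennreal \<Rightarrow> ereal" where
  "pay_at T x = (if x = \<infinity> then (SUP t\<in>{0..}. ereal (T t)) else ereal (T (enn2real x)))"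

definition dyn_pricing :: "'a measure \<Rightarrow> ('a \<Rightarrow> ennreal) \<Rightarrow> (real \<Rightarrow> real) \<Rightarrow> bool" where
  "dyn_pricing M \<tau> T \<longleftrightarrow> is_stopping_time M \<tau> \<and> cum_payment T"

text \<open>DIR compatibility: theta w_+(P(tau<inf | tau>s)) - lambda int_0^inf w_-(P(T(tau)-T(s)>y | tau>s)) dy >= 0,
  written in ennreal (an infinite integral violates the constraint).\<close>
definition DIR_compatible ::
  "real \<Rightarrow> real \<Rightarrow> (real \<Rightarrow> real) \<Rightarrow> (real \<Rightarrow> real) \<Rightarrow> 'a measure \<Rightarrow> ('a \<Rightarrow> ennreal) \<Rightarrow> (real \<Rightarrow> real) \<Rightarrow> bool"
  where
  "DIR_compatible \<theta> lam wp wm M \<tau> T \<longleftrightarrow>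
     (\<forall>s\<ge>0. measure M {\<omega>\<in>space M. \<tau> \<omega> > ennreal s} > 0 \<longrightarrow>
        ennreal lam * (\<integral>\<^sup>+ y\<in>{0..}. ennreal (wm
            (measure M {\<omega>\<in>space M. \<tau> \<omega> > ennreal s \<and> pay_at T (\<tau> \<omega>) - ereal (T s) > ereal y}
             / measure M {\<omega>\<in>space M. \<tau> \<omega> > ennreal s})) \<partial>lborel)
        \<le> ennreal (\<theta> * wp (measure M {\<omega>\<in>space M. \<tau> \<omega> > ennreal s \<and> \<tau> \<omega> < \<infinity>}
                           / measure M {\<omega>\<in>space M. \<tau> \<omega> > ennreal s})))"

definition revenue :: "'a measure \<Rightarrow> ('a \<Rightarrow> ennreal) \<Rightarrow> (real \<Rightarrow> real) \<Rightarrow> ennreal" where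
  "revenue M \<tau> T = (\<integral>\<^sup>+ y\<in>{0..}. ennreal (measure M {\<omega>\<in>space M. pay_at T (\<tau> \<omega>) > ereal y}) \<partial>lborel)"

definition optimal ::
  "real \<Rightarrow> real \<Rightarrow> (real \<Rightarrow> real) \<Rightarrow> (real \<Rightarrow> real) \<Rightarrow> 'a measure \<Rightarrow> ('a \<Rightarrow> ennreal) \<Rightarrow> (real \<Rightarrow> real) \<Rightarrow> bool"
  where
  "optimal \<theta> lam wp wm M \<tau> T \<longleftrightarrow>
     dyn_pricing M \<tau> T \<and> DIR_compatible \<theta> lam wp wm M \<tau> T \<and>
     (\<forall>\<tau>' T'. dyn_pricing M \<tau>' T' \<and> DIR_compatible \<theta> lam wp wm M \<tau>' T' \<longrightarrow>
               revenue M \<tau>' T' \<le> revenue M \<tau> T)"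

end

theory Submission
  imports Defs
begin

text \<open>
Linear programming duality. Write \<open>w\<close> for the weighting of payments, \<open>K = \<theta> / lam\<close> and
\<open>G y = P(T(\<tau>) > y)\<close>. The constraint at the last time at which the payment is at most \<open>y\<close> involves only
\<open>G\<close>, and choosing \<open>y\<close> as the point where \<open>G\<close> drops to \<open>exp (- t)\<close> it gives
\<open>\<integral> phi t (G y) dy \<le> K\<close> for all \<open>t \<ge> 0\<close>, where \<open>phi t p\<close> is \<open>w (p exp t)\<close> if \<open>p exp t \<le> 1\<close> and \<open>0\<close> otherwise.

The dual solution is the measure \<open>\<delta>\<^sub>0 + g0 dt\<close> on \<open>[0, t0]\<close>. Integrating the constraints against it yields
\<open>\<integral> \<Phi> (G y) dy \<le> K (1 + \<integral> g0)\<close> with \<open>\<Phi> p = w p + \<integral> g0(t) phi t p dt\<close>. The equation of \<open>g0\<close> says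
\<open>\<Phi> p = p\<close> on \<open>[exp (- t0), 1]\<close>, and \<open>\<Phi> p > p\<close> on \<open>(0, exp (- t0))\<close> because \<open>\<Phi>'\<close> is strictly convex there
while \<open>\<Phi> - id\<close> vanishes at both ends and has a nonpositive derivative at the right end. Hence the revenue
\<open>\<integral> G\<close> is at most \<open>K (1 + \<integral> g0)\<close>.

In case of equality \<open>G\<close> takes values in \<open>{0} \<union> [exp (- t0), 1]\<close> and the constraints with \<open>t \<le> t0\<close> are tight, which is a
Volterra equation for the lengths \<open>m(t)\<close> of \<open>{y. 0 < G y \<le> exp (- t)}\<close>; by Gronwall it determines \<open>G\<close>. The equation of
\<open>f\<close> says that \<open>T*\<close> solves it, and \<open>f \<ge> 0\<close> because \<open>f\<close> is a Neumann series with nonnegative terms. Finally,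
tightness of the constraint at time \<open>0\<close> forces \<open>P(\<tau> < \<infinity>) = 1\<close>.
\<close>

section \<open>A backward Gronwall inequality\<close>

text \<open>After Tonelli the inner integral of \<open>exp (c * t)\<close> over
  \<open>[0, s]\<close> is at most \<open>exp (c * s) / c\<close>. In this weighted norm a Volterra
  operator with kernel bounded by \<open>C\<close> becomes a contraction once \<open>c > C\<close>,
  which serves both for uniqueness and for convergence of the Neumann series.\<close>

lemma weighted_tail_nn_integral:
  fixes q :: "real \<Rightarrow> ennreal"
  assumes [measurable]: "q \<in> borel_measurable borel" and "c > 0"
  shows "(\<integral>\<^sup>+t\<in>{0..a}. ennreal (exp (c * t)) * (\<integral>\<^sup>+s\<in>{t..a}. q s \<partial>lborel) \<partial>lborel)
    \<le> ennreal (1 / c) * (\<integral>\<^sup>+s\<in>{0..a}. ennreal (exp (c * s)) * q s \<partial>lborel)"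
proof -
  have "(\<integral>\<^sup>+t\<in>{0..a}. ennreal (exp (c * t)) * (\<integral>\<^sup>+s\<in>{t..a}. q s \<partial>lborel) \<partial>lborel)
    = (\<integral>\<^sup>+t. \<integral>\<^sup>+s. ennreal (exp (c * t)) * q s * of_bool (0 \<le> t \<and> t \<le> s \<and> s \<le> a) \<partial>lborel \<partial>lborel)"
    by (subst nn_integral_cmult[symmetric], measurable, subst nn_integral_multc[symmetric], measurable)
       (intro nn_integral_cong, auto simp: indicator_def mult_ac)
  also have "\<dots> = (\<integral>\<^sup>+s. \<integral>\<^sup>+t. ennreal (exp (c * t)) * q s * of_bool (0 \<le> t \<and> t \<le> s \<and> s \<le> a) \<partial>lborel \<partial>lborel)"
    by (rule lborel_pair.Fubini'[symmetric]) measurable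
  also have "\<dots> = (\<integral>\<^sup>+s. (q s * indicator {0..a} s) * (\<integral>\<^sup>+t\<in>{0..s}. ennreal (exp (c * t)) \<partial>lborel) \<partial>lborel)"
    by (subst nn_integral_cmult[symmetric], measurable)
       (intro nn_integral_cong, auto simp: indicator_def mult_ac)
  also have "\<dots> \<le> (\<integral>\<^sup>+s. (q s * indicator {0..a} s) * (ennreal (1 / c) * ennreal (exp (c * s))) \<partial>lborel)"
  proof (rule nn_integral_mono)
    fix s :: real
    show "(q s * indicator {0..a} s) * (\<integral>\<^sup>+t\<in>{0..s}. ennreal (exp (c * t)) \<partial>lborel)
      \<le> (q s * indicator {0..a} s) * (ennreal (1 / c) * ennreal (exp (c * s)))"
    proof (cases "0 \<le> s")
      case True
      have "(\<integral>\<^sup>+t\<in>{0..s}. ennreal (exp (c * t)) \<partial>lborel) = ennreal (exp (c * s) / c - exp (c * 0) / c)"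
        using \<open>c > 0\<close> True by (intro nn_integral_FTC_Icc) (auto intro!: derivative_eq_intros)
      also have "\<dots> \<le> ennreal (exp (c * s) / c)"
        using \<open>c > 0\<close> by (intro ennreal_leI) auto
      also have "\<dots> = ennreal (1 / c) * ennreal (exp (c * s))"
        using \<open>c > 0\<close> by (simp flip: ennreal_mult)
      finally show ?thesis by (rule mult_left_mono) simp
    qed (simp add: indicator_def)
  qed
  also have "\<dots> = ennreal (1 / c) * (\<integral>\<^sup>+s\<in>{0..a}. ennreal (exp (c * s)) * q s \<partial>lborel)"
    by (subst nn_integral_cmult[symmetric], measurable) (intro nn_integral_cong, auto simp: mult_ac)
  finally show ?thesis .
qed

text \<open>The exponentially weighted mass of \<open>q\<close> is finite and at most half of
  itself, hence zero.\<close>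

lemma backward_gronwall:
  fixes q :: "real \<Rightarrow> ennreal"
  assumes [measurable]: "q \<in> borel_measurable borel"
    and fin: "(\<integral>\<^sup>+s\<in>{0..a}. q s \<partial>lborel) < \<infinity>" and "C > 0"
    and le: "AE t in lborel. t \<in> {0..a} \<longrightarrow> q t \<le> ennreal C * (\<integral>\<^sup>+s\<in>{t..a}. q s \<partial>lborel)"
  shows "AE t in lborel. t \<in> {0..a} \<longrightarrow> q t = 0"
proof -
  \<comment> \<open>The exponent \<open>2 * C\<close> makes the contraction factor
    \<open>C / (2 * C) = 1/2\<close>.\<close>
  define I where "I = (\<integral>\<^sup>+s\<in>{0..a}. ennreal (exp (2 * C * s)) * q s \<partial>lborel)"
  have "I \<le> (\<integral>\<^sup>+s\<in>{0..a}. ennreal (exp (2 * C * a)) * q s \<partial>lborel)"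
    unfolding I_def using \<open>C > 0\<close>
    by (intro nn_integral_mono) (auto simp: indicator_def intro!: mult_right_mono ennreal_leI)
  also have "\<dots> = ennreal (exp (2 * C * a)) * (\<integral>\<^sup>+s\<in>{0..a}. q s \<partial>lborel)"
    by (subst nn_integral_cmult[symmetric]) (auto simp: mult_ac)
  also have "\<dots> < \<infinity>" using fin by (simp add: ennreal_mult_less_top)
  finally have I_fin: "I < \<infinity>" .
  have "I \<le> (\<integral>\<^sup>+t. ennreal C * ((ennreal (exp (2 * C * t)) * (\<integral>\<^sup>+s\<in>{t..a}. q s \<partial>lborel)) * indicator {0..a} t) \<partial>lborel)"
    unfolding I_def
    apply (intro nn_integral_mono_AE)
    using le
    apply eventually_elim
    subgoal for t
      using mult_left_mono[of "q t" "ennreal C * (\<integral>\<^sup>+s\<in>{t..a}. q s \<partial>lborel)" "ennreal (exp (2 * C * t))"]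
      by (auto simp: indicator_def mult_ac)
    done
  also have "\<dots> = ennreal C * (\<integral>\<^sup>+t\<in>{0..a}. ennreal (exp (2 * C * t)) * (\<integral>\<^sup>+s\<in>{t..a}. q s \<partial>lborel) \<partial>lborel)"
    by (subst nn_integral_cmult[symmetric]) (auto simp: indicator_def intro!: borel_measurable_times_ennreal)
  also have "\<dots> \<le> ennreal C * (ennreal (1 / (2 * C)) * I)"
    unfolding I_def using \<open>C > 0\<close> by (intro mult_left_mono weighted_tail_nn_integral) auto
  also have "\<dots> = ennreal (1/2) * I"
    using \<open>C > 0\<close> by (simp add: mult.assoc[symmetric] flip: ennreal_mult)
  finally have "I \<le> ennreal (1/2) * I" .
  moreover obtain r where r: "0 \<le> r" "I = ennreal r"
    using I_fin by (cases I rule: ennreal_cases) auto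
  ultimately have "ennreal r \<le> ennreal (1/2 * r)"
    by (simp only: ennreal_mult'[symmetric])
  with r have "I = 0" by (auto simp: ennreal_le_iff)
  then have "AE s in lborel. ennreal (exp (2 * C * s)) * q s * indicator {0..a} s = 0"
    unfolding I_def by (subst (asm) nn_integral_0_iff_AE) auto
  then show ?thesis
    by eventually_elim (auto simp: indicator_def split: if_splits)
qed

section \<open>Weighting functions\<close>

text \<open>\<open>W\<close> is a continuously differentiable extension of the weighting to the whole line; values beyond \<open>1\<close>
are used when differentiating at the right end of an interval.\<close>
locale smooth_weight =
  fixes W W1 :: "real \<Rightarrow> real"
  assumes W_0: "W 0 = 0" and W_1: "W 1 = 1"
    and deriv_W: "(W has_real_derivative W1 x) (at x)"
    and cont_W1: "continuous_on UNIV W1"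
    and W1_nonneg: "0 \<le> W1 x"
    and smono_W: "strict_mono_on {0..1} W"
    and W1_0: "W1 0 > 1" and W1_1: "W1 1 > 1"
    and sconvex_W1: "\<lbrakk>0 \<le> a; a < b; b < c; c \<le> 1\<rbrakk> \<Longrightarrow> W1 b * (c - a) < W1 a * (c - b) + W1 c * (b - a)"

text \<open>The derivative is frozen outside \<open>[0, 1]\<close>, so its antiderivative continues
  \<open>w\<close> linearly on both sides. The positive third derivative enters only as strict
  convexity of \<open>W1\<close>, in a three point form without division.\<close>

lemma ex_smooth_weight:
  assumes "weighting w"
  obtains W W1 where "smooth_weight W W1" "\<And>p. 0 \<le> p \<Longrightarrow> p \<le> 1 \<Longrightarrow> w p = W p"
proof -
  from assms obtain w1 w2 w3 where w: "strict_mono_on {0..1} w" "w 0 = 0" "w 1 = 1"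
    and d1: "\<And>p. p \<in> {0..1} \<Longrightarrow> (w has_real_derivative w1 p) (at p within {0..1})"
    and d2: "\<And>p. p \<in> {0..1} \<Longrightarrow> (w1 has_real_derivative w2 p) (at p within {0..1})"
    and d3: "\<And>p. p \<in> {0..1} \<Longrightarrow> (w2 has_real_derivative w3 p) (at p within {0..1})"
    and pos: "\<And>p. p \<in> {0..1} \<Longrightarrow> w3 p > 0" and b: "w1 0 > 1" "w1 1 > 1"
    unfolding weighting_def by blast
  have mono_w: "w x \<le> w y" if "x \<in> {0..1}" "y \<in> {0..1}" "x \<le> y" for x y
    using w(1) that by (metis strict_mono_on_leD)
  have mvt: "\<exists>z. x < z \<and> z < y \<and> u y - u x = (y - x) * u' z"
    if "0 \<le> x" "x < y" "y \<le> 1"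
      and "\<And>p. p \<in> {0..1} \<Longrightarrow> (u has_real_derivative u' p) (at p within {0..1})" for u u' x y
  proof -
    have "\<exists>z\<in>{x<..<y}. u y - u x = (*) (u' z) (y - x)"
    proof (rule mvt_simple[OF \<open>x < y\<close>])
      fix z assume "x \<le> z" "z \<le> y"
      then have "(u has_real_derivative u' z) (at z within {x..y})"
        using that by (intro DERIV_subset[OF that(4)]) auto
      then show "(u has_derivative (*) (u' z)) (at z within {x..y})"
        by (simp add: has_field_derivative_def)
    qed
    then show ?thesis by (auto simp: mult.commute)
  qed
  define W1 where "W1 p = w1 (max 0 (min 1 p))" for p :: real
  have cw1: "continuous_on {0..1} w1"
    by (rule DERIV_continuous_on[OF d2])
  have cW1: "continuous_on UNIV W1"
    unfolding W1_def
    by (rule continuous_on_compose2[OF cw1]) (auto intro!: continuous_intros)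
  have "\<exists>F. \<forall>x. (-\<infinity>::ereal) < x \<longrightarrow> x < \<infinity> \<longrightarrow> (F has_vector_derivative W1 x) (at x)"
    using cW1 by (intro einterval_antiderivative) (auto simp: continuous_on_eq_continuous_at)
  then obtain F where F: "\<And>x. (F has_real_derivative W1 x) (at x)"
    by (auto simp: has_real_derivative_iff_has_vector_derivative)
  define W where "W p = F p - F 0" for p
  have dW: "(W has_real_derivative W1 x) (at x)" for x
    unfolding W_def by (auto intro!: derivative_eq_intros F)
  \<comment> \<open>The difference \<open>w - W\<close> vanishes at \<open>0\<close> and has
    derivative zero inside the interval, where clamping changes nothing.\<close>
  have W_eq: "w p = W p" if "0 \<le> p" "p \<le> 1" for p
  proof (cases "p = 0")
    case False
    have "\<exists>z. 0 < z \<and> z < p \<and> (w p - W p) - (w 0 - W 0) = (p - 0) * (w1 z - W1 z)"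
      using that False
      by (intro mvt) (auto intro!: derivative_eq_intros d1 DERIV_subset[OF dW])
    then show ?thesis
      using that w(2) by (auto simp: W1_def W_def max_def min_def split: if_splits)
  qed (simp add: W_def w)
  \<comment> \<open>A negative derivative at \<open>p < 1\<close> would make \<open>w\<close>
    decrease to the right of \<open>p\<close>; at \<open>p = 1\<close> the sign is part of
    \<open>weighting\<close>.\<close>
  have w1_nonneg: "0 \<le> w1 p" if p: "p \<in> {0..1}" for p
  proof (rule ccontr)
    assume n: "\<not> 0 \<le> w1 p"
    show False
    proof (cases "p = 1")
      case True with b n show False by auto
    next
      case False
      from has_real_derivative_neg_dec_right[OF d1[OF p]] n obtain d where "d > 0"
        and d: "\<And>h. \<lbrakk>h > 0; p + h \<in> {0..1}; h < d\<rbrakk> \<Longrightarrow> w (p + h) < w p" by auto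
      let ?h = "min (d / 2) (1 - p)"
      have "w (p + ?h) < w p"
        using \<open>d > 0\<close> p False by (intro d) auto
      moreover have "w p \<le> w (p + ?h)"
        using \<open>d > 0\<close> p False by (intro mono_w) auto
      ultimately show False by simp
    qed
  qed
  have "smooth_weight W W1"
  proof
    show "W 0 = 0" "W 1 = 1" using W_eq w by (auto simp: W_def)
    show "(W has_real_derivative W1 x) (at x)" for x by (rule dW)
    show "continuous_on UNIV W1" by (rule cW1)
    show "0 \<le> W1 x" for x by (auto simp: W1_def intro!: w1_nonneg)
    show "strict_mono_on {0..1} W"
      using w(1) by (auto simp: strict_mono_on_def W_eq)
    show "1 < W1 0" "1 < W1 1" using b by (auto simp: W1_def)
    fix x y z :: real assume xyz: "0 \<le> x" "x < y" "y < z" "z \<le> 1"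
    \<comment> \<open>The slopes of \<open>w1\<close> on the two halves are values of
      \<open>w2\<close> at \<open>u < v\<close>, and \<open>w2\<close> increases from
      \<open>u\<close> to \<open>v\<close> because \<open>w3\<close> is positive.\<close>
    obtain u where u: "x < u" "u < y" "w1 y - w1 x = (y - x) * w2 u"
      using mvt[of x y w1 w2] d2 xyz by auto
    obtain v where v: "y < v" "v < z" "w1 z - w1 y = (z - y) * w2 v"
      using mvt[of y z w1 w2] d2 xyz by auto
    obtain r where r: "u < r" "r < v" "w2 v - w2 u = (v - u) * w3 r"
      using mvt[of u v w2 w3] d3 xyz u v by auto
    have "(v - u) * w3 r > 0" using r u v xyz by (intro mult_pos_pos pos) auto
    then have "0 < (z - y) * (y - x) * (w2 v - w2 u)"
      using r xyz by (intro mult_pos_pos) auto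
    also have "\<dots> = (y - x) * (w1 z - w1 y) - (z - y) * (w1 y - w1 x)"
      unfolding u v by (simp add: algebra_simps)
    also have "\<dots> = w1 x * (z - y) + w1 z * (y - x) - w1 y * (z - x)"
      by (simp add: algebra_simps)
    finally show "W1 y * (z - x) < W1 x * (z - y) + W1 z * (y - x)"
      using xyz by (simp add: W1_def)
  qed
  then show ?thesis using that W_eq by blast
qed

section \<open>The interior fixed point and the kernel of the weighting\<close>

context smooth_weight
begin

lemma cont_W: "continuous_on A W"
  by (rule DERIV_continuous_on[OF DERIV_subset[OF deriv_W]]) simp

lemma mono_W: "x \<le> y \<Longrightarrow> W x \<le> W y"
  by (rule DERIV_nonneg_imp_nondecreasing) (auto intro!: exI deriv_W W1_nonneg)

lemma W_nonneg: "0 \<le> x \<Longrightarrow> 0 \<le> W x"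
  using mono_W[of 0 x] W_0 by simp

lemma borel_W [measurable]: "W \<in> borel_measurable borel"
  by (rule borel_measurable_continuous_onI[OF cont_W])

text \<open>Existence: slopes above 1 at both ends put \<open>W\<close> above the identity near
  \<open>0\<close> and below it near \<open>1\<close>. Uniqueness: a second interior fixed point
  would give four zeros of \<open>W p - p\<close> and, by Rolle, three points with
  \<open>W1 = 1\<close>, against strict convexity of \<open>W1\<close>.\<close>

lemma fixpoint_ex1: "\<exists>!p. 0 < p \<and> p < 1 \<and> W p = p"
proof -
  have d: "((\<lambda>p. W p - p) has_real_derivative W1 x - 1) (at x)" for x
    by (auto intro!: derivative_eq_intros deriv_W)
  have rolle: "\<exists>z. x < z \<and> z < y \<and> W1 z = 1" if "x < y" "W x = x" "W y = y" for x y
  proof -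
    have "\<exists>z. x < z \<and> z < y \<and> (W y - y) - (W x - x) = (y - x) * (W1 z - 1)"
      using that by (intro MVT2) (auto intro: d)
    then show ?thesis using that by auto
  qed
  have unique: "\<not> p < q" if pq: "0 < p \<and> p < 1 \<and> W p = p" "0 < q \<and> q < 1 \<and> W q = q" for p q
  proof
    assume "p < q"
    obtain x where x: "0 < x" "x < p" "W1 x = 1" using rolle[of 0 p] pq W_0 by auto
    obtain y where y: "p < y" "y < q" "W1 y = 1" using rolle[of p q] pq \<open>p < q\<close> by auto
    obtain z where z: "q < z" "z < 1" "W1 z = 1" using rolle[of q 1] pq W_1 by auto
    have "W1 y * (z - x) < W1 x * (z - y) + W1 z * (y - x)"
      using x y z by (intro sconvex_W1) auto
    then show False using x y z by simp
  qed
  from has_real_derivative_pos_inc_right[OF d[of 0]] W1_0 obtain d1 where "d1 > 0"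
    and d1: "\<And>h. \<lbrakk>h > 0; h < d1\<rbrakk> \<Longrightarrow> W 0 - 0 < W h - h" by auto
  from has_real_derivative_pos_inc_left[OF d[of 1]] W1_1 obtain d2 where "d2 > 0"
    and d2: "\<And>h. \<lbrakk>h > 0; h < d2\<rbrakk> \<Longrightarrow> W (1 - h) - (1 - h) < W 1 - 1" by auto
  let ?a = "min (d1 / 2) (1/4)" and ?b = "1 - min (d2 / 2) (1/4)"
  have "W ?a - ?a > 0" using d1[of ?a] \<open>d1 > 0\<close> W_0 by auto
  moreover have "W ?b - ?b < 0" using d2[of "min (d2 / 2) (1/4)"] \<open>d2 > 0\<close> W_1 by auto
  ultimately have "\<exists>x. ?a \<le> x \<and> x \<le> ?b \<and> W x - x = 0"
    by (intro IVT2') (auto intro!: continuous_intros cont_W)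
  then obtain x where x: "?a \<le> x" "x \<le> ?b" "W x = x" by auto
  have "0 < ?a" "?b < 1" using \<open>d1 > 0\<close> \<open>d2 > 0\<close> by auto
  with x have "0 < x \<and> x < 1 \<and> W x = x" by linarith
  with unique show ?thesis by (metis linorder_neqE)
qed

text \<open>The function \<open>kern\<close> is minus the derivative of \<open>x \<mapsto> W (exp (- x))\<close>.\<close>
definition kern :: "real \<Rightarrow> real" where
  "kern x = W1 (exp (- x)) * exp (- x)"

lemma kern_nonneg: "0 \<le> kern x"
  by (simp add: kern_def W1_nonneg)

lemma cont_kern: "continuous_on A kern"
  unfolding kern_def
  by (intro continuous_intros continuous_on_compose2[OF cont_W1]) auto

lemma borel_kern [measurable]: "kern \<in> borel_measurable borel"
  by (rule borel_measurable_continuous_onI[OF cont_kern])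

lemma kern_bounded: obtains C where "C > 0" "\<And>x. 0 \<le> x \<Longrightarrow> kern x \<le> C"
proof -
  have "compact (W1 ` {0..1})"
    by (intro compact_continuous_image continuous_on_subset[OF cont_W1]) auto
  then obtain B where B: "\<And>p. p \<in> {0..1} \<Longrightarrow> W1 p \<le> B"
    by (meson bounded_imp_bdd_above bdd_above_def compact_imp_bounded imageI)
  have "kern x \<le> B" if "0 \<le> x" for x
  proof -
    have "kern x \<le> W1 (exp (- x)) * 1"
      unfolding kern_def using that by (intro mult_left_mono) (auto simp: W1_nonneg)
    also have "\<dots> \<le> B" using that by (auto intro!: B)
    finally show ?thesis .
  qed
  moreover have "B > 0" using B[of 1] W1_1 by auto
  ultimately show ?thesis using that by blast
qed

text \<open>The antiderivative is \<open>- W (exp (t - r))\<close>. The reflected variant below has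
  the same value, which is why the two double integrals in \<open>resolvent_tail\<close>
  agree.\<close>

lemma nn_integral_kern:
  assumes "t \<le> x"
  shows "(\<integral>\<^sup>+r\<in>{t..x}. ennreal (kern (r - t)) \<partial>lborel) = ennreal (1 - W (exp (t - x)))"
proof -
  have "((\<lambda>r. - W (exp (t - r))) has_real_derivative kern (r - t)) (at r)" for r
    by (auto intro!: derivative_eq_intros DERIV_chain'[OF _ deriv_W] simp: kern_def)
  then have "(\<integral>\<^sup>+r\<in>{t..x}. ennreal (kern (r - t)) \<partial>lborel) = ennreal (- W (exp (t - x)) - (- W (exp (t - t))))"
    by (intro nn_integral_FTC_Icc) (auto simp: kern_nonneg assms)
  then show ?thesis by (simp add: W_1)
qed

lemma nn_integral_kern_reflect:
  assumes "t \<le> x"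
  shows "(\<integral>\<^sup>+r\<in>{t..x}. ennreal (kern (x - r)) \<partial>lborel) = ennreal (1 - W (exp (t - x)))"
proof -
  have "((\<lambda>r. W (exp (r - x))) has_real_derivative kern (x - r)) (at r)" for r
    by (auto intro!: derivative_eq_intros DERIV_chain'[OF _ deriv_W] simp: kern_def)
  then have "(\<integral>\<^sup>+r\<in>{t..x}. ennreal (kern (x - r)) \<partial>lborel) = ennreal (W (exp (x - x)) - W (exp (t - x)))"
    by (intro nn_integral_FTC_Icc) (auto simp: kern_nonneg assms)
  then show ?thesis by (simp add: W_1)
qed

end

section \<open>The resolvent equation for the payment density\<close>

lemma has_integral_set_nn_integral:
  fixes f :: "real \<Rightarrow> real"
  assumes "f \<in> borel_measurable borel" "\<And>x. x \<in> {a..b} \<Longrightarrow> 0 \<le> f x"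
    and "(\<integral>\<^sup>+x\<in>{a..b}. ennreal (f x) \<partial>lborel) = ennreal r" "0 \<le> r"
  shows "(f has_integral r) {a..b}"
proof -
  have "((\<lambda>x. if x \<in> {a..b} then f x else 0) has_integral r) UNIV"
  proof (rule nn_integral_has_integral)
    show "(\<lambda>x. if x \<in> {a..b} then f x else 0) \<in> borel_measurable borel"
      using assms(1) by measurable
    show "(\<integral>\<^sup>+x. ennreal (if x \<in> {a..b} then f x else 0) \<partial>lborel) = ennreal r"
      unfolding assms(3)[symmetric] by (intro nn_integral_cong) (auto simp: indicator_def)
  qed (use assms in auto)
  then show ?thesis unfolding has_integral_restrict_UNIV .
qed

context smooth_weight
begin

text \<open>The terms of the Neumann series of \<open>f t = kern (b - t) + \<integral>\<^sub>t\<^sup>b kern (s - t) f s ds\<close>, which is the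
derivative of the equation defining the payment density.\<close>
fun neumann :: "real \<Rightarrow> nat \<Rightarrow> real \<Rightarrow> ennreal" where
  "neumann b 0 t = ennreal (kern (b - t))"
| "neumann b (Suc n) t = (\<integral>\<^sup>+s\<in>{t..b}. ennreal (kern (s - t)) * neumann b n s \<partial>lborel)"

lemma borel_neumann [measurable]: "neumann b n \<in> borel_measurable borel"
proof (induction n)
  case (Suc n)
  note [measurable] = Suc
  \<comment> \<open>The moving interval is encoded as a jointly measurable predicate in
    \<open>t\<close> and \<open>s\<close>, so that the integral is measurable as a function of
    \<open>t\<close>.\<close>
  have "(\<lambda>t. \<integral>\<^sup>+s. ennreal (kern (s - t)) * neumann b n s * of_bool (t \<le> s \<and> s \<le> b) \<partial>lborel) \<in> borel_measurable borel"
    by measurable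
  also have "(\<lambda>t. \<integral>\<^sup>+s. ennreal (kern (s - t)) * neumann b n s * of_bool (t \<le> s \<and> s \<le> b) \<partial>lborel) = neumann b (Suc n)"
    by (intro ext) (auto simp: indicator_def intro!: nn_integral_cong)
  finally show ?case .
qed (simp; measurable)

text \<open>The kernel operator shifts the series by one term; in \<open>ennreal\<close> the sum and
  the integral may be exchanged before convergence is known.\<close>

lemma neumann_suminf:
  "(\<Sum>n. neumann b n t) = ennreal (kern (b - t)) +
     (\<integral>\<^sup>+s\<in>{t..b}. ennreal (kern (s - t)) * (\<Sum>n. neumann b n s) \<partial>lborel)"
proof -
  have "(\<integral>\<^sup>+s\<in>{t..b}. ennreal (kern (s - t)) * (\<Sum>n. neumann b n s) \<partial>lborel)
    = (\<integral>\<^sup>+s. (\<Sum>n. ennreal (kern (s - t)) * neumann b n s * indicator {t..b} s) \<partial>lborel)"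
    by (intro nn_integral_cong) simp
  also have "\<dots> = (\<Sum>n. neumann b (Suc n) t)"
    unfolding neumann.simps by (rule nn_integral_suminf) measurable
  finally show ?thesis
    using suminf_offset[OF summableI, of "\<lambda>n. neumann b n t" 1] by simp
qed

lemma neumann_integral_finite:
  assumes "0 \<le> b"
  shows "(\<integral>\<^sup>+t\<in>{0..b}. (\<Sum>n. neumann b n t) \<partial>lborel) < \<infinity>"
proof -
  obtain C where C: "C > 0" "\<And>x. 0 \<le> x \<Longrightarrow> kern x \<le> C" using kern_bounded by blast
  define J where "J n = (\<integral>\<^sup>+t\<in>{0..b}. ennreal (exp (2 * C * t)) * neumann b n t \<partial>lborel)" for n
  have step: "J (Suc n) \<le> ennreal (1/2) * J n" for n
  proof -
    have "J (Suc n) \<le> (\<integral>\<^sup>+t. ennreal C * ((ennreal (exp (2 * C * t)) * (\<integral>\<^sup>+s\<in>{t..b}. neumann b n s \<partial>lborel)) * indicator {0..b} t) \<partial>lborel)"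
      unfolding J_def
    proof (rule nn_integral_mono)
      fix t
      have "neumann b (Suc n) t \<le> (\<integral>\<^sup>+s. ennreal C * (neumann b n s * indicator {t..b} s) \<partial>lborel)"
        unfolding neumann.simps
        by (intro nn_integral_mono) (auto simp: indicator_def intro!: mult_right_mono ennreal_leI C)
      also have "\<dots> = ennreal C * (\<integral>\<^sup>+s\<in>{t..b}. neumann b n s \<partial>lborel)"
        by (rule nn_integral_cmult) measurable
      finally have "ennreal (exp (2 * C * t)) * neumann b (Suc n) t
          \<le> ennreal (exp (2 * C * t)) * (ennreal C * (\<integral>\<^sup>+s\<in>{t..b}. neumann b n s \<partial>lborel))"
        by (rule mult_left_mono) simp
      then show "ennreal (exp (2 * C * t)) * neumann b (Suc n) t * indicator {0..b} t
          \<le> ennreal C * ((ennreal (exp (2 * C * t)) * (\<integral>\<^sup>+s\<in>{t..b}. neumann b n s \<partial>lborel)) * indicator {0..b} t)"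
        by (auto simp: indicator_def mult_ac)
    qed
    also have "\<dots> = ennreal C * (\<integral>\<^sup>+t\<in>{0..b}. ennreal (exp (2 * C * t)) * (\<integral>\<^sup>+s\<in>{t..b}. neumann b n s \<partial>lborel) \<partial>lborel)"
      by (subst nn_integral_cmult[symmetric]) (auto simp: indicator_def intro!: borel_measurable_times_ennreal)
    also have "\<dots> \<le> ennreal C * (ennreal (1 / (2 * C)) * J n)"
      unfolding J_def using C(1) by (intro mult_left_mono weighted_tail_nn_integral) auto
    also have "\<dots> = ennreal (1/2) * J n"
      using C(1) by (simp add: mult.assoc[symmetric] flip: ennreal_mult)
    finally show ?thesis .
  qed
  have "J 0 \<le> (\<integral>\<^sup>+t. ennreal (exp (2 * C * b) * C) * indicator {0..b} t \<partial>lborel)"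
    unfolding J_def neumann.simps using C
    by (intro nn_integral_mono)
       (auto simp: indicator_def kern_nonneg ennreal_mult'[symmetric] intro!: ennreal_leI mult_mono)
  also have "\<dots> < \<infinity>"
    using assms C(1) by (simp add: nn_integral_cmult ennreal_mult_less_top)
  finally obtain j where j: "0 \<le> j" "J 0 = ennreal j"
    by (cases "J 0" rule: ennreal_cases) auto
  have J: "J n \<le> ennreal (j * (1/2) ^ n)" for n
  proof (induction n)
    case (Suc n)
    have "J (Suc n) \<le> ennreal (1/2) * ennreal (j * (1/2) ^ n)"
      by (rule order_trans[OF step mult_left_mono[OF Suc]]) simp
    then show ?case by (simp only: ennreal_mult'[symmetric]) (simp add: mult_ac)
  qed (use j in simp)
  have "(\<integral>\<^sup>+t\<in>{0..b}. (\<Sum>n. neumann b n t) \<partial>lborel)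
     \<le> (\<integral>\<^sup>+t. (\<Sum>n. ennreal (exp (2 * C * t)) * neumann b n t * indicator {0..b} t) \<partial>lborel)"
  proof (rule nn_integral_mono)
    fix t
    have "(\<Sum>n. neumann b n t) * indicator {0..b} t \<le> ennreal (exp (2 * C * t)) * (\<Sum>n. neumann b n t) * indicator {0..b} t"
      using mult_right_mono[of 1 "ennreal (exp (2 * C * t))" "\<Sum>n. neumann b n t"] C(1)
      by (auto simp: indicator_def)
    then show "(\<Sum>n. neumann b n t) * indicator {0..b} t \<le> (\<Sum>n. ennreal (exp (2 * C * t)) * neumann b n t * indicator {0..b} t)"
      by simp
  qed
  also have "\<dots> = (\<Sum>n. J n)"
    unfolding J_def by (rule nn_integral_suminf) measurable
  also have "\<dots> \<le> (\<Sum>n. ennreal (j * (1/2) ^ n))"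
    by (intro suminf_le J) auto
  also have "\<dots> = ennreal (\<Sum>n. j * (1/2) ^ n)"
    using j by (intro suminf_ennreal2) (auto intro!: summable_mult summable_geometric)
  finally show ?thesis by (rule order_le_less_trans) simp
qed

text \<open>The sum of the Neumann series has finite integral, and the equation itself with a
  bounded kernel then makes it finite at every point of \<open>[0, b]\<close>, not only almost
  everywhere. Thus passing to real values loses nothing there.\<close>

lemma ex_resolvent:
  assumes "0 \<le> b"
  obtains f :: "real \<Rightarrow> real" where "f \<in> borel_measurable borel" "\<And>t. 0 \<le> f t"
    "(\<integral>\<^sup>+t\<in>{0..b}. ennreal (f t) \<partial>lborel) < \<infinity>"
    "\<And>t. t \<in> {0..b} \<Longrightarrow> ennreal (f t) = ennreal (kern (b - t)) +
       (\<integral>\<^sup>+s\<in>{t..b}. ennreal (kern (s - t)) * ennreal (f s) \<partial>lborel)"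
proof -
  define F where "F t = (\<Sum>n. neumann b n t)" for t
  have [measurable]: "F \<in> borel_measurable borel" unfolding F_def by measurable
  have eq: "F t = ennreal (kern (b - t)) + (\<integral>\<^sup>+s\<in>{t..b}. ennreal (kern (s - t)) * F s \<partial>lborel)" for t
    unfolding F_def by (rule neumann_suminf)
  have fin: "(\<integral>\<^sup>+t\<in>{0..b}. F t \<partial>lborel) < \<infinity>"
    unfolding F_def by (rule neumann_integral_finite[OF assms])
  obtain C where C: "C > 0" "\<And>x. 0 \<le> x \<Longrightarrow> kern x \<le> C" using kern_bounded by blast
  have F_fin: "ennreal (enn2real (F t)) = F t" if "t \<in> {0..b}" for t
  proof -
    have "(\<integral>\<^sup>+s\<in>{t..b}. ennreal (kern (s - t)) * F s \<partial>lborel)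
      \<le> (\<integral>\<^sup>+s. ennreal C * (F s * indicator {0..b} s) \<partial>lborel)"
      using that by (intro nn_integral_mono) (auto simp: indicator_def intro!: mult_right_mono ennreal_leI C)
    also have "\<dots> = ennreal C * (\<integral>\<^sup>+t\<in>{0..b}. F t \<partial>lborel)"
      by (rule nn_integral_cmult) measurable
    also have "\<dots> < \<infinity>" using fin by (simp add: ennreal_mult_less_top)
    finally have "F t < \<infinity>" by (subst eq) simp
    then show ?thesis by simp
  qed
  show ?thesis
  proof (rule that[of "\<lambda>t. enn2real (F t)"])
    have "(\<integral>\<^sup>+t\<in>{0..b}. ennreal (enn2real (F t)) \<partial>lborel) = (\<integral>\<^sup>+t\<in>{0..b}. F t \<partial>lborel)"
      by (intro nn_integral_cong) (auto simp: indicator_def F_fin)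
    with fin show "(\<integral>\<^sup>+t\<in>{0..b}. ennreal (enn2real (F t)) \<partial>lborel) < \<infinity>" by simp
    fix t assume t: "t \<in> {0..b}"
    have "(\<integral>\<^sup>+s\<in>{t..b}. ennreal (kern (s - t)) * ennreal (enn2real (F s)) \<partial>lborel)
       = (\<integral>\<^sup>+s\<in>{t..b}. ennreal (kern (s - t)) * F s \<partial>lborel)"
      using t by (intro nn_integral_cong) (auto simp: indicator_def F_fin)
    then show "ennreal (enn2real (F t)) = ennreal (kern (b - t)) +
       (\<integral>\<^sup>+s\<in>{t..b}. ennreal (kern (s - t)) * ennreal (enn2real (F s)) \<partial>lborel)"
      using eq[of t] F_fin[OF t] by simp
  next
    show "(\<lambda>t. enn2real (F t)) \<in> borel_measurable borel" by measurable
  qed simp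
qed

text \<open>Both identities come from Tonelli on the triangle
  \<open>t \<le> r \<le> s \<le> b\<close>: the integrals over \<open>r\<close> of
  \<open>kern (s - r)\<close> and of \<open>kern (r - t)\<close> are both
  \<open>1 - W (exp (t - s))\<close>. The second identity is the Volterra equation that the level
  lengths of the optimal survival function have to satisfy.\<close>

lemma resolvent_tail:
  fixes f :: "real \<Rightarrow> real"
  assumes [measurable]: "f \<in> borel_measurable borel"
    and eq: "\<And>t. t \<in> {0..b} \<Longrightarrow> ennreal (f t) = ennreal (kern (b - t)) +
       (\<integral>\<^sup>+s\<in>{t..b}. ennreal (kern (s - t)) * ennreal (f s) \<partial>lborel)"
    and t: "t \<in> {0..b}"
  shows "(\<integral>\<^sup>+s\<in>{t..b}. ennreal (f s) \<partial>lborel) = ennreal (1 - W (exp (t - b))) +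
     (\<integral>\<^sup>+s\<in>{t..b}. ennreal (f s) * ennreal (1 - W (exp (t - s))) \<partial>lborel)" (is ?A)
    and "1 + (\<integral>\<^sup>+s\<in>{t..b}. ennreal (f s) \<partial>lborel) = 1 +
     (\<integral>\<^sup>+r\<in>{t..b}. ennreal (kern (r - t)) * (1 + (\<integral>\<^sup>+s\<in>{r..b}. ennreal (f s) \<partial>lborel)) \<partial>lborel)" (is ?B)
proof -
  let ?R = "\<lambda>s. ennreal (f s) * ennreal (1 - W (exp (t - s))) * indicator {t..b} s"
  have "(\<integral>\<^sup>+r\<in>{t..b}. ennreal (f r) \<partial>lborel) = (\<integral>\<^sup>+r. ennreal (kern (b - r)) * indicator {t..b} r +
       (\<integral>\<^sup>+s. ennreal (kern (s - r)) * ennreal (f s) * of_bool (t \<le> r \<and> r \<le> s \<and> s \<le> b) \<partial>lborel) \<partial>lborel)"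
  proof (rule nn_integral_cong)
    fix r
    show "ennreal (f r) * indicator {t..b} r = ennreal (kern (b - r)) * indicator {t..b} r +
       (\<integral>\<^sup>+s. ennreal (kern (s - r)) * ennreal (f s) * of_bool (t \<le> r \<and> r \<le> s \<and> s \<le> b) \<partial>lborel)"
    proof (cases "r \<in> {t..b}")
      case True
      with t show ?thesis by (auto simp: eq indicator_def intro!: nn_integral_cong)
    next
      case False
      then have "of_bool (t \<le> r \<and> r \<le> s \<and> s \<le> b) = (0 :: ennreal)" for s by auto
      then have "(\<integral>\<^sup>+s. ennreal (kern (s - r)) * ennreal (f s) * of_bool (t \<le> r \<and> r \<le> s \<and> s \<le> b) \<partial>lborel) = 0"
        by (simp only: mult_zero_right nn_integral_const mult_zero_left)
      with False show ?thesis by (simp only: indicator_simps not_False_eq_True mult_zero_right add_0_right)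
    qed
  qed
  also have "\<dots> = ennreal (1 - W (exp (t - b))) + (\<integral>\<^sup>+r. \<integral>\<^sup>+s. ennreal (kern (s - r)) * ennreal (f s) * of_bool (t \<le> r \<and> r \<le> s \<and> s \<le> b) \<partial>lborel \<partial>lborel)"
    using t by (subst nn_integral_add) (auto simp: nn_integral_kern_reflect)
  also have "(\<integral>\<^sup>+r. \<integral>\<^sup>+s. ennreal (kern (s - r)) * ennreal (f s) * of_bool (t \<le> r \<and> r \<le> s \<and> s \<le> b) \<partial>lborel \<partial>lborel)
     = (\<integral>\<^sup>+s. \<integral>\<^sup>+r. ennreal (kern (s - r)) * ennreal (f s) * of_bool (t \<le> r \<and> r \<le> s \<and> s \<le> b) \<partial>lborel \<partial>lborel)"
    by (rule lborel_pair.Fubini'[symmetric]) measurable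
  also have "\<dots> = (\<integral>\<^sup>+s. (ennreal (f s) * indicator {t..b} s) * (\<integral>\<^sup>+r\<in>{t..s}. ennreal (kern (s - r)) \<partial>lborel) \<partial>lborel)"
    by (subst nn_integral_cmult[symmetric], measurable)
       (intro nn_integral_cong, auto simp: indicator_def mult_ac)
  also have "\<dots> = integral\<^sup>N lborel ?R"
    by (intro nn_integral_cong) (auto simp: nn_integral_kern_reflect split: split_indicator)
  finally show ?A .
  have "(\<integral>\<^sup>+r\<in>{t..b}. ennreal (kern (r - t)) * (1 + (\<integral>\<^sup>+s\<in>{r..b}. ennreal (f s) \<partial>lborel)) \<partial>lborel)
    = (\<integral>\<^sup>+r. ennreal (kern (r - t)) * indicator {t..b} r +
       (\<integral>\<^sup>+s. ennreal (kern (r - t)) * ennreal (f s) * of_bool (t \<le> r \<and> r \<le> s \<and> s \<le> b) \<partial>lborel) \<partial>lborel)"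
  proof (rule nn_integral_cong)
    fix r
    have "(\<integral>\<^sup>+s. ennreal (kern (r - t)) * ennreal (f s) * of_bool (t \<le> r \<and> r \<le> s \<and> s \<le> b) \<partial>lborel)
      = (\<integral>\<^sup>+s. (ennreal (kern (r - t)) * indicator {t..b} r) * (ennreal (f s) * indicator {r..b} s) \<partial>lborel)"
      by (intro nn_integral_cong) (auto simp: indicator_def)
    also have "\<dots> = ennreal (kern (r - t)) * indicator {t..b} r * (\<integral>\<^sup>+s\<in>{r..b}. ennreal (f s) \<partial>lborel)"
      by (rule nn_integral_cmult) measurable
    finally show "ennreal (kern (r - t)) * (1 + (\<integral>\<^sup>+s\<in>{r..b}. ennreal (f s) \<partial>lborel)) * indicator {t..b} r =
       ennreal (kern (r - t)) * indicator {t..b} r +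
       (\<integral>\<^sup>+s. ennreal (kern (r - t)) * ennreal (f s) * of_bool (t \<le> r \<and> r \<le> s \<and> s \<le> b) \<partial>lborel)"
      by (auto simp: indicator_def distrib_left)
  qed
  also have "\<dots> = ennreal (1 - W (exp (t - b))) + (\<integral>\<^sup>+r. \<integral>\<^sup>+s. ennreal (kern (r - t)) * ennreal (f s) * of_bool (t \<le> r \<and> r \<le> s \<and> s \<le> b) \<partial>lborel \<partial>lborel)"
    using t by (subst nn_integral_add) (auto simp: nn_integral_kern)
  also have "(\<integral>\<^sup>+r. \<integral>\<^sup>+s. ennreal (kern (r - t)) * ennreal (f s) * of_bool (t \<le> r \<and> r \<le> s \<and> s \<le> b) \<partial>lborel \<partial>lborel)
     = (\<integral>\<^sup>+s. \<integral>\<^sup>+r. ennreal (kern (r - t)) * ennreal (f s) * of_bool (t \<le> r \<and> r \<le> s \<and> s \<le> b) \<partial>lborel \<partial>lborel)"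
    by (rule lborel_pair.Fubini'[symmetric]) measurable
  also have "\<dots> = (\<integral>\<^sup>+s. (ennreal (f s) * indicator {t..b} s) * (\<integral>\<^sup>+r\<in>{t..s}. ennreal (kern (r - t)) \<partial>lborel) \<partial>lborel)"
    by (subst nn_integral_cmult[symmetric], measurable)
       (intro nn_integral_cong, auto simp: indicator_def mult_ac)
  also have "\<dots> = integral\<^sup>N lborel ?R"
    by (intro nn_integral_cong) (auto simp: nn_integral_kern split: split_indicator)
  finally show ?B using \<open>?A\<close> by simp
qed

text \<open>The tail of \<open>f\<close> splits into the parts weighted by \<open>1 - W\<close> and
  by \<open>W\<close>. Comparing with \<open>resolvent_tail\<close> and cancelling the first part,
  which is finite, evaluates the second, and this is the integrated equation for the payment
  density.\<close>

lemma resolvent_equation: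
  fixes f :: "real \<Rightarrow> real"
  assumes [measurable]: "f \<in> borel_measurable borel" and nonneg: "\<And>t. 0 \<le> f t"
    and fin: "(\<integral>\<^sup>+t\<in>{0..b}. ennreal (f t) \<partial>lborel) < \<infinity>"
    and eq: "\<And>t. t \<in> {0..b} \<Longrightarrow> ennreal (f t) = ennreal (kern (b - t)) +
       (\<integral>\<^sup>+s\<in>{t..b}. ennreal (kern (s - t)) * ennreal (f s) \<partial>lborel)"
    and t: "t \<in> {0..b}"
  shows "W (exp (- b + t)) + integral {t..b} (\<lambda>s. W (exp (- s + t)) * f s) = 1"
proof -
  have "(\<integral>\<^sup>+s\<in>{t..b}. ennreal (f s) \<partial>lborel) \<le> (\<integral>\<^sup>+s\<in>{0..b}. ennreal (f s) \<partial>lborel)"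
    using t by (intro nn_integral_mono) (auto simp: indicator_def)
  with fin have fin_t: "(\<integral>\<^sup>+s\<in>{t..b}. ennreal (f s) \<partial>lborel) < \<infinity>" by (metis order_le_less_trans)
  have W_le: "W (exp (t - s)) \<le> 1" if "t \<le> s" for s
    using mono_W[of "exp (t - s)" 1] that W_1 by simp
  have W_ge: "0 \<le> W (exp x)" for x by (simp add: W_nonneg)
  let ?U = "\<integral>\<^sup>+s\<in>{t..b}. ennreal (f s) * ennreal (1 - W (exp (t - s))) \<partial>lborel"
  let ?V = "\<integral>\<^sup>+s\<in>{t..b}. ennreal (W (exp (- s + t)) * f s) \<partial>lborel"
  have "(\<integral>\<^sup>+s\<in>{t..b}. ennreal (f s) \<partial>lborel) = (\<integral>\<^sup>+s. ennreal (f s) * ennreal (1 - W (exp (t - s))) * indicator {t..b} s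
      + ennreal (W (exp (- s + t)) * f s) * indicator {t..b} s \<partial>lborel)"
  proof (rule nn_integral_cong)
    fix s
    have "ennreal (f s) = ennreal (f s * (1 - W (exp (t - s)))) + ennreal (W (exp (- s + t)) * f s)" if "t \<le> s"
      using nonneg[of s] W_le[OF that] W_ge
      by (subst ennreal_plus[symmetric]) (auto simp: algebra_simps intro: mult_left_le)
    then show "ennreal (f s) * indicator {t..b} s = ennreal (f s) * ennreal (1 - W (exp (t - s))) * indicator {t..b} s
      + ennreal (W (exp (- s + t)) * f s) * indicator {t..b} s"
      by (auto simp: indicator_def nonneg ennreal_mult')
  qed
  also have "\<dots> = ?U + ?V" by (rule nn_integral_add) measurable
  finally have UV: "(\<integral>\<^sup>+s\<in>{t..b}. ennreal (f s) \<partial>lborel) = ?U + ?V" .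
  have "?U + ?V = ?U + ennreal (1 - W (exp (t - b)))"
    unfolding UV[symmetric] by (subst resolvent_tail(1)[OF assms(1) eq t]) (simp_all add: add.commute)
  moreover have "?U \<noteq> \<infinity>" using fin_t unfolding UV by auto
  ultimately have "?V = ennreal (1 - W (exp (t - b)))"
    by (simp add: ennreal_add_left_cancel)
  then have "((\<lambda>s. W (exp (- s + t)) * f s) has_integral (1 - W (exp (t - b)))) {t..b}"
    using t by (intro has_integral_set_nn_integral) (auto simp: nonneg W_ge W_le)
  then show ?thesis by (simp add: integral_unique)
qed

end

section \<open>The dual solution\<close>

lemma set_nn_integral_eq_integral_cont:
  fixes f :: "real \<Rightarrow> real"
  assumes "continuous_on {a..b} f" "\<And>x. x \<in> {a..b} \<Longrightarrow> 0 \<le> f x"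
  shows "(\<integral>\<^sup>+x\<in>{a..b}. ennreal (f x) \<partial>lborel) = ennreal (integral {a..b} f)"
proof -
  have i: "set_integrable lborel {a..b} f"
    by (rule borel_integrable_atLeastAtMost'[OF assms(1)])
  have "(\<integral>\<^sup>+x\<in>{a..b}. ennreal (f x) \<partial>lborel) = (\<integral>\<^sup>+x. ennreal (indicator {a..b} x *\<^sub>R f x) \<partial>lborel)"
    by (intro nn_integral_cong) (auto simp: indicator_def)
  also have "\<dots> = ennreal (\<integral>x. indicator {a..b} x *\<^sub>R f x \<partial>lborel)"
    using i assms(2) unfolding set_integrable_def
    by (intro nn_integral_eq_integral) (auto simp: indicator_def)
  also have "(\<integral>x. indicator {a..b} x *\<^sub>R f x \<partial>lborel) = integral {a..b} f"
    using set_borel_integral_eq_integral(2)[OF i] by (simp add: set_lebesgue_integral_def)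
  finally show ?thesis .
qed

context smooth_weight
begin

text \<open>The cut at 1 discards the payment levels where the survival probability still exceeds
  \<open>exp (- t)\<close>; relative to the conditioning level they have already been
  passed.\<close>

definition phi :: "real \<Rightarrow> real \<Rightarrow> real" where
  "phi t p = (if p * exp t \<le> 1 then W (p * exp t) else 0)"

lemma borel_phi [measurable (raw)]:
  assumes [measurable]: "f \<in> borel_measurable M" "h \<in> borel_measurable M"
  shows "(\<lambda>x. phi (f x) (h x)) \<in> borel_measurable M"
  unfolding phi_def by measurable

lemma phi_0_right [simp]: "phi t 0 = 0"
  by (simp add: phi_def W_0)

lemma phi_0_left: "p \<le> 1 \<Longrightarrow> phi 0 p = W p"
  by (simp add: phi_def)

text \<open>The left side of the equation has derivative \<open>W1 1 - 1 > 0\<close> at time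
  \<open>0\<close>. If \<open>g 0\<close> were not positive, the right side would be bounded by the
  integral of the positive part of \<open>g\<close>, whose derivative at \<open>0\<close>
  vanishes.\<close>

lemma volterra_pos_0:
  assumes "0 < L" and cont: "continuous_on {0..L} g"
    and eq: "\<And>t. t \<in> {0..L} \<Longrightarrow> exp (- t) - W (exp (- t)) = integral {0..t} (\<lambda>s. W (exp (s - t)) * g s)"
  shows "0 < g 0"
proof (rule ccontr)
  assume neg: "\<not> 0 < g 0"
  let ?h = "\<lambda>s. max 0 (g s)"
  let ?E = "\<lambda>t. integral {0..t} ?h - (exp (- t) - W (exp (- t)))"
  have ch: "continuous_on {0..L} ?h" by (intro continuous_intros cont)
  have "((\<lambda>t. integral {0..t} ?h) has_real_derivative ?h 0) (at 0 within {0..L})"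
    using \<open>0 < L\<close> by (intro integral_has_real_derivative ch) auto
  then have "(?E has_real_derivative ?h 0 - (- 1 - W1 1 * (- 1))) (at 0 within {0..L})"
    by (auto intro!: derivative_eq_intros DERIV_chain'[OF _ deriv_W])
  moreover have "?h 0 - (- 1 - W1 1 * (- 1)) < 0" using neg W1_1 by simp
  ultimately obtain d where "d > 0" and d: "\<And>h. \<lbrakk>h > 0; 0 + h \<in> {0..L}; h < d\<rbrakk> \<Longrightarrow> ?E (0 + h) < ?E 0"
    using has_real_derivative_neg_dec_right by blast
  define t where "t = min (d / 2) L"
  have t: "0 < t" "t \<in> {0..L}" "t < d" using \<open>d > 0\<close> \<open>0 < L\<close> by (auto simp: t_def)
  have "integral {0..t} (\<lambda>s. W (exp (s - t)) * g s) \<le> integral {0..t} ?h"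
  proof (rule integral_le)
    show "(\<lambda>s. W (exp (s - t)) * g s) integrable_on {0..t}"
      using t by (intro integrable_continuous_real continuous_intros continuous_on_compose2[OF cont_W] continuous_on_subset[OF cont]) auto
    show "?h integrable_on {0..t}"
      using t by (intro integrable_continuous_real continuous_on_subset[OF ch]) auto
    fix s assume s: "s \<in> {0..t}"
    have "W (exp (s - t)) * g s \<le> W (exp (s - t)) * ?h s"
      by (intro mult_left_mono W_nonneg) auto
    also have "\<dots> \<le> ?h s"
      using s mono_W[of "exp (s - t)" 1] W_1 by (intro mult_left_le_one_le W_nonneg) auto
    finally show "W (exp (s - t)) * g s \<le> ?h s" .
  qed
  then have "?E t \<ge> 0" using eq[OF t(2)] by simp
  moreover have "?E 0 = 0" by (simp add: W_1)
  ultimately show False using d[of t] t by simp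
qed

end

section \<open>The dual price of a survival probability compared with the probability\<close>

locale volterra_dual = smooth_weight +
  fixes g :: "real \<Rightarrow> real" and b :: real
  assumes b_pos: "0 < b" and cont_g: "continuous_on {0..b} g"
    and volterra: "\<And>t. t \<in> {0..b} \<Longrightarrow> exp (- t) - W (exp (- t)) = integral {0..t} (\<lambda>s. W (exp (s - t)) * g s)"
    and g_pos: "\<And>t. 0 \<le> t \<Longrightarrow> t < b \<Longrightarrow> 0 < g t" and g_b: "g b \<le> 0"
begin

lemma g_b_eq_0: "g b = 0"
proof -
  have "(g \<longlongrightarrow> g b) (at b within {0..b})"
    using cont_g b_pos by (auto simp: continuous_on)
  then have "(g \<longlongrightarrow> g b) (at_left b)"
    using b_pos by (simp add: at_within_Icc_at_left)
  moreover have "\<forall>\<^sub>F t in at_left b. g t \<ge> 0"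
    using b_pos eventually_at_left_real[OF b_pos] by (auto elim!: eventually_mono intro: less_imp_le[OF g_pos])
  ultimately have "0 \<le> g b"
    using tendsto_lowerbound trivial_limit_at_left_real by blast
  with g_b show ?thesis by simp
qed

lemma g_nonneg: "t \<in> {0..b} \<Longrightarrow> 0 \<le> g t"
  using g_pos[of t] g_b_eq_0 by (cases "t = b") auto

text \<open>On \<open>[0, exp (- b)]\<close> this is the dual price minus the identity. Beyond that
  the cut-off of \<open>phi\<close> is ignored, which makes the function differentiable on the whole
  line.\<close>

definition gap :: "real \<Rightarrow> real" where
  "gap p = W p + integral {0..b} (\<lambda>s. W (exp s * p) * g s) - p"

definition gap' :: "real \<Rightarrow> real" where
  "gap' p = W1 p + integral {0..b} (\<lambda>s. exp s * W1 (exp s * p) * g s) - 1"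

lemma cont_gap_integrands:
  "continuous_on {0..b} (\<lambda>s. W (exp s * p) * g s)"
  "continuous_on {0..b} (\<lambda>s. exp s * W1 (exp s * p) * g s)"
  by (intro continuous_intros continuous_on_compose2[OF cont_W] continuous_on_compose2[OF cont_W1] cont_g; auto)+

text \<open>Differentiation under the integral sign; it uses continuity of \<open>W1\<close> beyond
  \<open>1\<close>, because \<open>exp s * p\<close> may exceed \<open>1\<close> when
  \<open>p\<close> is close to or above \<open>exp (- b)\<close>.\<close>

lemma deriv_gap: "(gap has_real_derivative gap' p) (at p)"
proof -
  have "((\<lambda>p. integral (cbox 0 b) (\<lambda>s. W (exp s * p) * g s)) has_real_derivative
      integral (cbox 0 b) (\<lambda>s. exp s * W1 (exp s * p) * g s)) (at p within UNIV)"
  proof (rule leibniz_rule_field_derivative)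
    show "((\<lambda>x. W (exp t * x) * g t) has_real_derivative exp t * W1 (exp t * x) * g t) (at x within UNIV)" for x t
      by (auto intro!: derivative_eq_intros DERIV_chain'[OF _ deriv_W])
    show "(\<lambda>s. W (exp s * x) * g s) integrable_on cbox 0 b" for x
      using cont_gap_integrands(1) by (auto intro: integrable_continuous_real)
    show "continuous_on (UNIV \<times> cbox 0 b) (\<lambda>(x, t). exp t * W1 (exp t * x) * g t)"
      unfolding case_prod_unfold
      by (intro continuous_intros continuous_on_compose2[OF cont_W1] continuous_on_compose2[OF cont_g]) auto
  qed auto
  then show ?thesis
    unfolding gap_def gap'_def by (auto intro!: derivative_eq_intros deriv_W)
qed

lemma gap_0: "gap 0 = 0"
  by (simp add: gap_def W_0)

text \<open>The Volterra equation cancels the integral over \<open>[0, t]\<close>. What remains is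
  the part that the cut-off in \<open>phi\<close> would have removed.\<close>

lemma gap_exp:
  assumes "t \<in> {0..b}"
  shows "gap (exp (- t)) = integral {t..b} (\<lambda>s. W (exp (s - t)) * g s)"
proof -
  have c: "continuous_on {0..b} (\<lambda>s. W (exp (s - t)) * g s)"
    using cont_gap_integrands(1)[of "exp (- t)"] by (simp add: exp_diff exp_minus divide_inverse)
  have "integral {0..b} (\<lambda>s. W (exp s * exp (- t)) * g s) = integral {0..b} (\<lambda>s. W (exp (s - t)) * g s)"
    by (simp add: exp_diff exp_minus divide_inverse)
  also have "\<dots> = integral {0..t} (\<lambda>s. W (exp (s - t)) * g s) + integral {t..b} (\<lambda>s. W (exp (s - t)) * g s)"
    using assms by (intro Henstock_Kurzweil_Integration.integral_combine[symmetric] integrable_continuous_real c) auto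
  finally show ?thesis
    unfolding gap_def using volterra[OF assms] by simp
qed

text \<open>On the right of \<open>exp (- b)\<close> the gap is an integral of \<open>g\<close> near \<open>b\<close>, where \<open>g\<close> vanishes;
  hence it grows sublinearly there.\<close>
lemma gap'_le_0: "gap' (exp (- b)) \<le> 0"
proof (rule ccontr)
  assume neg: "\<not> gap' (exp (- b)) \<le> 0"
  define C where "C = W (exp b)"
  have C: "C \<ge> 0" unfolding C_def by (simp add: W_nonneg)
  \<comment> \<open>Here \<open>C\<close> bounds \<open>W (exp (s - t))\<close>, so
    \<open>?E\<close> is nonnegative on \<open>[0, b]\<close>, and it vanishes at \<open>b\<close>.
    Since \<open>g b = 0\<close>, its derivative at \<open>b\<close> is a positive multiple of
    \<open>gap' (exp (- b))\<close>; were that positive, \<open>?E\<close> would be negative just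
    before \<open>b\<close>.\<close>
  let ?E = "\<lambda>t. C * (integral {0..b} g - integral {0..t} g) - gap (exp (- t))"
  have "((\<lambda>t. integral {0..t} g) has_real_derivative g b) (at b within {0..b})"
    using b_pos by (intro integral_has_real_derivative cont_g) auto
  moreover have "((\<lambda>t. gap (exp (- t))) has_real_derivative gap' (exp (- b)) * (- exp (- b))) (at b within {0..b})"
    by (rule DERIV_chain'[OF _ deriv_gap]) (auto intro!: derivative_eq_intros)
  ultimately have "(?E has_real_derivative gap' (exp (- b)) * exp (- b)) (at b within {0..b})"
    by (auto intro!: derivative_eq_intros simp: g_b_eq_0)
  moreover have "gap' (exp (- b)) * exp (- b) > 0" using neg by simp
  ultimately obtain d where "d > 0" and d: "\<And>h. \<lbrakk>h > 0; b - h \<in> {0..b}; h < d\<rbrakk> \<Longrightarrow> ?E (b - h) < ?E b"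
    using has_real_derivative_pos_inc_left by blast
  define t where "t = max 0 (b - d / 2)"
  have t: "t \<in> {0..b}" "t < b" "b - t < d" using \<open>d > 0\<close> b_pos by (auto simp: t_def)
  have "integral {t..b} (\<lambda>s. W (exp (s - t)) * g s) \<le> integral {t..b} (\<lambda>s. C * g s)"
  proof (rule integral_le)
    show "(\<lambda>s. W (exp (s - t)) * g s) integrable_on {t..b}"
      using t by (intro integrable_continuous_real continuous_intros continuous_on_compose2[OF cont_W] continuous_on_subset[OF cont_g]) auto
    show "(\<lambda>s. C * g s) integrable_on {t..b}"
      using t by (intro integrable_continuous_real continuous_intros continuous_on_subset[OF cont_g]) auto
    fix s assume s: "s \<in> {t..b}"
    then show "W (exp (s - t)) * g s \<le> C * g s"
      unfolding C_def using t by (intro mult_right_mono mono_W g_nonneg) auto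
  qed
  also have "\<dots> = C * integral {t..b} g" by simp
  also have "integral {0..t} g + integral {t..b} g = integral {0..b} g"
    using t by (intro Henstock_Kurzweil_Integration.integral_combine integrable_continuous_real cont_g) auto
  then have "integral {t..b} g = integral {0..b} g - integral {0..t} g" by simp
  finally have "?E t \<ge> 0" using gap_exp[OF t(1)] by simp
  moreover have "?E b = 0" using gap_exp[of b] b_pos by simp
  ultimately show False using d[of "b - t"] t by simp
qed

text \<open>Convexity of \<open>W1\<close> at the points scaled by \<open>exp s\<close> is
  integrated against \<open>g \<ge> 0\<close>, which gives only a weak inequality; strictness comes
  from the summand \<open>W1\<close>. The bound on \<open>z\<close> keeps all scaled points in
  \<open>[0, 1]\<close>.\<close>

lemma sconvex_gap':
  assumes "0 \<le> x" "x < y" "y < z" "z \<le> exp (- b)"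
  shows "gap' y * (z - x) < gap' x * (z - y) + gap' z * (y - x)"
proof -
  have sub: "exp s * z \<le> 1" if "s \<in> {0..b}" for s
  proof -
    have "exp s * z \<le> exp b * exp (- b)" using that assms by (intro mult_mono) auto
    then show ?thesis by (simp add: exp_minus)
  qed
  let ?i = "\<lambda>p s. exp s * W1 (exp s * p) * g s"
  have int: "?i p integrable_on {0..b}" for p
    by (intro integrable_continuous_real cont_gap_integrands)
  have "integral {0..b} (\<lambda>s. ?i y s * (z - x)) \<le> integral {0..b} (\<lambda>s. ?i x s * (z - y) + ?i z s * (y - x))"
  proof (rule integral_le)
    show "(\<lambda>s. ?i y s * (z - x)) integrable_on {0..b}"
      "(\<lambda>s. ?i x s * (z - y) + ?i z s * (y - x)) integrable_on {0..b}"
      by (intro integrable_continuous_real continuous_intros cont_gap_integrands)+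
    fix s assume s: "s \<in> {0..b}"
    have "W1 (exp s * y) * (exp s * z - exp s * x) < W1 (exp s * x) * (exp s * z - exp s * y) + W1 (exp s * z) * (exp s * y - exp s * x)"
      using assms sub[OF s] by (intro sconvex_W1) auto
    then have "(W1 (exp s * y) * (exp s * z - exp s * x)) * g s \<le> (W1 (exp s * x) * (exp s * z - exp s * y) + W1 (exp s * z) * (exp s * y - exp s * x)) * g s"
      by (intro mult_right_mono g_nonneg s) auto
    then show "?i y s * (z - x) \<le> ?i x s * (z - y) + ?i z s * (y - x)"
      by (simp add: algebra_simps)
  qed
  also have "\<dots> = integral {0..b} (?i x) * (z - y) + integral {0..b} (?i z) * (y - x)"
    by (subst Henstock_Kurzweil_Integration.integral_add) (auto intro!: integrable_continuous_real continuous_intros cont_gap_integrands)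
  finally have "integral {0..b} (?i y) * (z - x) \<le> integral {0..b} (?i x) * (z - y) + integral {0..b} (?i z) * (y - x)"
    by simp
  moreover have "z \<le> 1" using assms(4) b_pos by (smt (verit) exp_le_one_iff)
  then have "W1 y * (z - x) < W1 x * (z - y) + W1 z * (y - x)"
    using assms by (intro sconvex_W1) auto
  ultimately show ?thesis
    unfolding gap'_def by (simp add: algebra_simps)
qed

text \<open>If \<open>gap p\<close> were not positive, the mean value theorem on both sides of
  \<open>p\<close> would give \<open>gap' x \<le> 0 \<le> gap' y\<close> with \<open>x < y\<close>.
  Together with \<open>gap' (exp (- b)) \<le> 0\<close> this contradicts strict convexity of
  \<open>gap'\<close>.\<close>

lemma gap_pos:
  assumes "0 < p" "p < exp (- b)"
  shows "0 < gap p"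
proof (rule ccontr)
  assume neg: "\<not> 0 < gap p"
  have e: "gap (exp (- b)) = 0" using gap_exp[of b] b_pos by simp
  obtain x where x: "0 < x" "x < p" "gap p - gap 0 = (p - 0) * gap' x"
    using MVT2[OF assms(1), of gap gap'] deriv_gap by auto
  obtain y where y: "p < y" "y < exp (- b)" "gap (exp (- b)) - gap p = (exp (- b) - p) * gap' y"
    using MVT2[OF assms(2), of gap gap'] deriv_gap by auto
  have "gap' x \<le> 0" using x(3) neg gap_0 assms(1) by (simp add: zero_less_mult_iff not_less)
  moreover have "gap' y \<ge> 0"
    using y(3) neg e assms(2) by (smt (verit) mult_pos_neg)
  moreover have "gap' y * (exp (- b) - x) < gap' x * (exp (- b) - y) + gap' (exp (- b)) * (y - x)"
    using x y by (intro sconvex_gap') auto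
  moreover have "0 \<le> gap' y * (exp (- b) - x)" using x y \<open>gap' y \<ge> 0\<close> by simp
  moreover have "gap' x * (exp (- b) - y) \<le> 0" using y \<open>gap' x \<le> 0\<close> by (simp add: mult_nonpos_nonneg)
  moreover have "gap' (exp (- b)) * (y - x) \<le> 0" using x y gap'_le_0 by (simp add: mult_nonpos_nonneg)
  ultimately show False by linarith
qed

text \<open>For \<open>p = exp (- s)\<close> the cut-off of \<open>phi\<close> truncates the
  integral at \<open>s\<close>, and the Volterra equation at time \<open>s\<close> evaluates
  it.\<close>

lemma dual_eq:
  assumes "exp (- b) \<le> p" "p \<le> 1"
  shows "ennreal (W p) + (\<integral>\<^sup>+t\<in>{0..b}. ennreal (g t) * ennreal (phi t p) \<partial>lborel) = ennreal p"
proof -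
  define s where "s = - ln p"
  have "p > 0" using assms(1) exp_gt_zero[of "- b"] by linarith
  then have p: "p = exp (- s)" by (simp add: s_def)
  have s: "s \<in> {0..b}" using assms unfolding p by auto
  have "(\<integral>\<^sup>+t\<in>{0..b}. ennreal (g t) * ennreal (phi t p) \<partial>lborel)
     = (\<integral>\<^sup>+t\<in>{0..s}. ennreal (W (exp (t - s)) * g t) \<partial>lborel)"
    using s g_nonneg
    by (intro nn_integral_cong)
       (auto simp: indicator_def phi_def p ennreal_mult'' W_nonneg mult.commute simp flip: exp_add)
  also have "\<dots> = ennreal (integral {0..s} (\<lambda>t. W (exp (t - s)) * g t))"
    using s g_nonneg
    by (intro set_nn_integral_eq_integral_cont continuous_intros continuous_on_compose2[OF cont_W] continuous_on_subset[OF cont_g])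
       (auto simp: W_nonneg)
  also have "integral {0..s} (\<lambda>t. W (exp (t - s)) * g t) = exp (- s) - W (exp (- s))"
    using volterra[OF s] by simp
  finally have *: "(\<integral>\<^sup>+t\<in>{0..b}. ennreal (g t) * ennreal (phi t p) \<partial>lborel) = ennreal (p - W p)"
    by (simp add: p)
  \<comment> \<open>This gives \<open>W p \<le> p\<close>, without which
    \<open>ennreal (p - W p)\<close> would truncate to zero.\<close>
  have "0 \<le> integral {0..s} (\<lambda>t. W (exp (t - s)) * g t)"
    using s g_nonneg by (intro integral_nonneg integrable_continuous_real continuous_intros continuous_on_compose2[OF cont_W] continuous_on_subset[OF cont_g])
       (auto simp: W_nonneg)
  then have "0 \<le> p - W p" using volterra[OF s] by (simp add: p)
  then show ?thesis unfolding * using \<open>p > 0\<close> by (simp add: W_nonneg flip: ennreal_plus)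
qed

text \<open>Below \<open>exp (- b)\<close> the cut-off of \<open>phi\<close> never takes effect on
  \<open>[0, b]\<close>, so the difference of the two sides is \<open>gap p\<close>.\<close>

lemma dual_gt:
  assumes "0 < p" "p < exp (- b)"
  shows "ennreal p < ennreal (W p) + (\<integral>\<^sup>+t\<in>{0..b}. ennreal (g t) * ennreal (phi t p) \<partial>lborel)"
proof -
  have le: "p * exp t \<le> 1" if "t \<in> {0..b}" for t
  proof -
    have "p * exp t \<le> exp (- b) * exp b" using that assms by (intro mult_mono) auto
    then show ?thesis by (simp add: exp_minus)
  qed
  have nonneg: "0 \<le> W (exp t * p) * g t" if "t \<in> {0..b}" for t
    using that assms g_nonneg by (auto simp: W_nonneg)
  have "(\<integral>\<^sup>+t\<in>{0..b}. ennreal (g t) * ennreal (phi t p) \<partial>lborel)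
     = (\<integral>\<^sup>+t\<in>{0..b}. ennreal (W (exp t * p) * g t) \<partial>lborel)"
    using g_nonneg le assms
    by (intro nn_integral_cong)
       (auto simp: indicator_def phi_def ennreal_mult'' W_nonneg mult.commute)
  also have "\<dots> = ennreal (integral {0..b} (\<lambda>s. W (exp s * p) * g s))"
    by (intro set_nn_integral_eq_integral_cont cont_gap_integrands nonneg)
  finally have *: "(\<integral>\<^sup>+t\<in>{0..b}. ennreal (g t) * ennreal (phi t p) \<partial>lborel) = ennreal (integral {0..b} (\<lambda>s. W (exp s * p) * g s))" .
  have "0 \<le> integral {0..b} (\<lambda>s. W (exp s * p) * g s)"
    by (intro integral_nonneg integrable_continuous_real cont_gap_integrands nonneg)
  then show ?thesis
    unfolding * using gap_pos[OF assms] assms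
    by (auto simp: gap_def W_nonneg ennreal_less_iff simp flip: ennreal_plus)
qed

end

section \<open>Level lengths of survival functions\<close>

lemma nn_integral_eq_imp_AE_eq:
  assumes [measurable]: "f \<in> borel_measurable M" "h \<in> borel_measurable M"
    and le: "\<And>x. f x \<le> h x" and eq: "integral\<^sup>N M h \<le> integral\<^sup>N M f" and fin: "integral\<^sup>N M f < \<infinity>"
  shows "AE x in M. f x = h x"
proof -
  have "(\<integral>\<^sup>+x. h x - f x \<partial>M) = integral\<^sup>N M h - integral\<^sup>N M f"
    using fin by (intro nn_integral_diff) (auto simp: le)
  also have "\<dots> = 0" using eq fin by (simp add: diff_eq_0_ennreal)
  finally have "AE x in M. h x - f x = 0"
    by (subst (asm) nn_integral_0_iff_AE) auto
  moreover have "AE x in M. f x \<noteq> \<infinity>"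
    using fin by (intro nn_integral_noteq_infinite) auto
  ultimately show ?thesis
    by eventually_elim (metis antisym diff_eq_0_iff_ennreal infinity_ennreal_def le top.not_eq_extremum)
qed

text \<open>Used in complementary slackness: tightness of the aggregated constraint passes to its
  atom and to its density part.\<close>

lemma ennreal_add_le_imp_eq:
  fixes a b c d :: ennreal
  assumes "a \<le> c" "b \<le> d" "c + d \<le> a + b" "c + d < \<infinity>"
  shows "a = c" "b = d"
proof -
  have fin: "c \<noteq> \<top>" "d \<noteq> \<top>" using assms(4) by auto
  have "c + d \<le> a + d" using assms(3) by (rule order_trans) (simp add: assms(2))
  then have "c \<le> a" using fin by (simp add: add.commute[of _ d] ennreal_add_left_cancel_le)
  with assms(1) show "a = c" by simp
  have "c + d \<le> c + b" using assms(3) by (rule order_trans) (simp add: assms(1))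
  then have "d \<le> b" using fin by (simp add: ennreal_add_left_cancel_le)
  with assms(2) show "b = d" by simp
qed

lemma AE_lborel_obtain:
  fixes a c :: real
  assumes "AE t in lborel. P t" "a < c"
  obtains t where "a < t" "t < c" "P t"
proof -
  from assms(1) obtain N where N: "{t \<in> space lborel. \<not> P t} \<subseteq> N" "emeasure lborel N = 0" "N \<in> sets lborel"
    by (rule AE_E)
  have "\<not> {a<..<c} \<subseteq> N"
  proof
    assume "{a<..<c} \<subseteq> N"
    then have "emeasure lborel {a<..<c} \<le> emeasure lborel N"
      using N by (intro emeasure_mono) auto
    with N assms show False by simp
  qed
  then obtain t where "t \<in> {a<..<c}" "t \<notin> N" by blast
  with that[of t] N show ?thesis by auto
qed

context smooth_weight
begin

text \<open>Zeros of \<open>G\<close> are excluded because they may fill a half line. Writing the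
  length of the level set as an integral makes Tonelli directly applicable.\<close>

definition level_length :: "(real \<Rightarrow> real) \<Rightarrow> real \<Rightarrow> ennreal" where
  "level_length G t = (\<integral>\<^sup>+y. of_bool (0 \<le> y \<and> 0 < G y \<and> G y \<le> exp (- t)) \<partial>lborel)"

lemma borel_level_length [measurable]:
  assumes [measurable]: "G \<in> borel_measurable borel"
  shows "level_length G \<in> borel_measurable borel"
  unfolding level_length_def[abs_def] by measurable

lemma level_length_mono: "0 \<le> t \<Longrightarrow> level_length G t \<le> level_length G 0"
  unfolding level_length_def
  by (intro nn_integral_mono) (auto intro: order_trans)

text \<open>The Volterra equation for a single payment level. With \<open>p = exp (- x)\<close> and
  \<open>t \<le> x\<close> the integral runs up to \<open>x\<close> and equals
  \<open>1 - W (exp (t - x))\<close>, the complement of \<open>phi t p\<close>; for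
  \<open>t > x\<close> everything vanishes. The bound \<open>exp (- b) \<le> p\<close> ensures that
  \<open>b\<close> does not cut the integral short.\<close>

lemma phi_plus_kern:
  assumes "0 \<le> t" "0 < p" "p \<le> 1" "exp (- b) \<le> p"
  shows "ennreal (phi t p) + (\<integral>\<^sup>+r\<in>{t..b}. ennreal (kern (r - t)) * of_bool (p \<le> exp (- r)) \<partial>lborel)
    = of_bool (p \<le> exp (- t))"
proof -
  define x where "x = - ln p"
  have p: "p = exp (- x)" using assms by (simp add: x_def)
  have x: "x \<le> b" "0 \<le> x" using assms by (auto simp: p)
  show ?thesis
  proof (cases "t \<le> x")
    case True
    have "(\<integral>\<^sup>+r\<in>{t..b}. ennreal (kern (r - t)) * of_bool (p \<le> exp (- r)) \<partial>lborel)
       = (\<integral>\<^sup>+r\<in>{t..x}. ennreal (kern (r - t)) \<partial>lborel)"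
      using x by (intro nn_integral_cong) (auto simp: p indicator_def)
    also have "\<dots> = ennreal (1 - W (exp (t - x)))" by (rule nn_integral_kern[OF True])
    finally show ?thesis
      using True mono_W[of "exp (t - x)" 1] W_1
      by (simp add: phi_def p W_nonneg flip: exp_add ennreal_plus)
  next
    case False
    have "(\<integral>\<^sup>+r\<in>{t..b}. ennreal (kern (r - t)) * of_bool (p \<le> exp (- r)) \<partial>lborel) = (\<integral>\<^sup>+r. 0 \<partial>(lborel :: real measure))"
      using False by (intro nn_integral_cong) (auto simp: p indicator_def)
    then show ?thesis using False by (simp add: phi_def p flip: exp_add)
  qed
qed

text \<open>This is \<open>phi_plus_kern\<close> with \<open>p = G y\<close>, integrated over the
  levels with \<open>G y > 0\<close>, after exchanging the order of integration.\<close>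

lemma level_length_volterra:
  assumes [measurable]: "G \<in> borel_measurable borel"
    and G01: "\<And>y. 0 \<le> y \<Longrightarrow> 0 \<le> G y \<and> G y \<le> 1"
    and vals: "AE y in lborel. 0 \<le> y \<longrightarrow> G y = 0 \<or> exp (- b) \<le> G y"
    and t: "t \<in> {0..b}"
  shows "level_length G t = (\<integral>\<^sup>+y\<in>{0..}. ennreal (phi t (G y)) \<partial>lborel)
    + (\<integral>\<^sup>+r\<in>{t..b}. ennreal (kern (r - t)) * level_length G r \<partial>lborel)"
proof -
  let ?F = "\<lambda>r y. ennreal (kern (r - t)) * of_bool (t \<le> r \<and> r \<le> b \<and> 0 \<le> y \<and> 0 < G y \<and> G y \<le> exp (- r))"
  have "(\<integral>\<^sup>+r\<in>{t..b}. ennreal (kern (r - t)) * level_length G r \<partial>lborel) = (\<integral>\<^sup>+r. \<integral>\<^sup>+y. ?F r y \<partial>lborel \<partial>lborel)"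
  proof (rule nn_integral_cong)
    fix r
    have "(\<integral>\<^sup>+y. ?F r y \<partial>lborel) = (\<integral>\<^sup>+y. (ennreal (kern (r - t)) * indicator {t..b} r) * of_bool (0 \<le> y \<and> 0 < G y \<and> G y \<le> exp (- r)) \<partial>lborel)"
      by (intro nn_integral_cong) (auto simp: indicator_def)
    also have "\<dots> = (ennreal (kern (r - t)) * indicator {t..b} r) * level_length G r"
      unfolding level_length_def by (rule nn_integral_cmult) measurable
    finally show "ennreal (kern (r - t)) * level_length G r * indicator {t..b} r = (\<integral>\<^sup>+y. ?F r y \<partial>lborel)"
      by (simp add: mult_ac)
  qed
  also have "\<dots> = (\<integral>\<^sup>+y. \<integral>\<^sup>+r. ?F r y \<partial>lborel \<partial>lborel)"
    by (rule lborel_pair.Fubini'[symmetric]) measurable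
  finally have "(\<integral>\<^sup>+y\<in>{0..}. ennreal (phi t (G y)) \<partial>lborel)
      + (\<integral>\<^sup>+r\<in>{t..b}. ennreal (kern (r - t)) * level_length G r \<partial>lborel)
    = (\<integral>\<^sup>+y. ennreal (phi t (G y)) * indicator {0..} y + (\<integral>\<^sup>+r. ?F r y \<partial>lborel) \<partial>lborel)"
    by (subst nn_integral_add) auto
  also have "\<dots> = level_length G t"
    unfolding level_length_def
  proof (rule nn_integral_cong_AE, use vals in eventually_elim)
    fix y assume v: "0 \<le> y \<longrightarrow> G y = 0 \<or> exp (- b) \<le> G y"
    show "ennreal (phi t (G y)) * indicator {0..} y + (\<integral>\<^sup>+r. ?F r y \<partial>lborel) = of_bool (0 \<le> y \<and> 0 < G y \<and> G y \<le> exp (- t))"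
    proof (cases "0 \<le> y \<and> 0 < G y")
      case True
      have "(\<integral>\<^sup>+r. ?F r y \<partial>lborel) = (\<integral>\<^sup>+r\<in>{t..b}. ennreal (kern (r - t)) * of_bool (G y \<le> exp (- r)) \<partial>lborel)"
        using True by (intro nn_integral_cong) (auto simp: indicator_def)
      then show ?thesis using phi_plus_kern[of t "G y" b] True v t G01[of y] by simp
    next
      case False
      then have "?F r y = 0" for r by auto
      then have "(\<integral>\<^sup>+r. ?F r y \<partial>lborel) = 0" by (simp only: nn_integral_const mult_zero_left)
      moreover have "0 \<le> y \<Longrightarrow> G y = 0" using False G01[of y] by auto
      ultimately show ?thesis using False by (auto simp: indicator_def)
    qed
  qed
  finally show ?thesis by simp
qed

text \<open>A Markov type bound: where \<open>G\<close> is positive it is at least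
  \<open>exp (- b)\<close> almost everywhere.\<close>

lemma level_length_finite:
  assumes [measurable]: "G \<in> borel_measurable borel"
    and vals: "AE y in lborel. 0 \<le> y \<longrightarrow> G y = 0 \<or> exp (- b) \<le> G y"
    and fin: "(\<integral>\<^sup>+y\<in>{0..}. ennreal (G y) \<partial>lborel) < \<infinity>"
  shows "level_length G 0 < \<infinity>"
proof -
  have "level_length G 0 \<le> (\<integral>\<^sup>+y. ennreal (exp b) * (ennreal (G y) * indicator {0..} y) \<partial>lborel)"
    unfolding level_length_def
  proof (rule nn_integral_mono_AE, use vals in eventually_elim)
    fix y assume v: "0 \<le> y \<longrightarrow> G y = 0 \<or> exp (- b) \<le> G y"
    have "1 \<le> ennreal (exp b) * ennreal (G y)" if "0 \<le> y" "0 < G y"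
    proof -
      have "exp b * exp (- b) \<le> exp b * G y" using that v by (intro mult_left_mono) auto
      then have "1 \<le> exp b * G y" by (simp add: exp_minus)
      then show ?thesis using that by (simp flip: ennreal_mult)
    qed
    then show "of_bool (0 \<le> y \<and> 0 < G y \<and> G y \<le> exp (- 0)) \<le> ennreal (exp b) * (ennreal (G y) * indicator {0..} y)"
      by (auto simp: indicator_def)
  qed
  also have "\<dots> = ennreal (exp b) * (\<integral>\<^sup>+y\<in>{0..}. ennreal (G y) \<partial>lborel)"
    by (rule nn_integral_cmult) measurable
  also have "\<dots> < \<infinity>" using fin by (simp add: ennreal_mult_less_top)
  finally show ?thesis .
qed

text \<open>The common term \<open>K\<close> cancels, so the absolute difference of the two
  solutions is bounded by \<open>C\<close> times its own tail integral, and Gronwall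
  applies.\<close>

lemma level_length_eq:
  assumes [measurable]: "G1 \<in> borel_measurable borel" "G2 \<in> borel_measurable borel"
    and "0 \<le> b"
    and eq1: "AE t in lborel. t \<in> {0..b} \<longrightarrow> level_length G1 t = K +
        (\<integral>\<^sup>+r\<in>{t..b}. ennreal (kern (r - t)) * level_length G1 r \<partial>lborel)"
    and eq2: "AE t in lborel. t \<in> {0..b} \<longrightarrow> level_length G2 t = K +
        (\<integral>\<^sup>+r\<in>{t..b}. ennreal (kern (r - t)) * level_length G2 r \<partial>lborel)"
    and fin: "level_length G1 0 < \<infinity>" "level_length G2 0 < \<infinity>"
  shows "AE t in lborel. t \<in> {0..b} \<longrightarrow> level_length G1 t = level_length G2 t"
proof -
  let ?m1 = "level_length G1" and ?m2 = "level_length G2"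
  obtain C where C: "C > 0" "\<And>x. 0 \<le> x \<Longrightarrow> kern x \<le> C" using kern_bounded by blast
  \<comment> \<open>The absolute difference in \<open>ennreal\<close>: one of the two truncated
    differences is always zero.\<close>
  define q where "q t = (?m1 t - ?m2 t) + (?m2 t - ?m1 t)" for t
  have [measurable]: "q \<in> borel_measurable borel" unfolding q_def by measurable
  have le: "?m1 t \<le> ?m2 t + q t" "?m2 t \<le> ?m1 t + q t" for t
    unfolding q_def
    by (metis add.assoc add.commute ennreal_minus_le_iff le_iff_add nle_le order_refl)+
  have "q t \<le> ?m1 0 + ?m2 0" if "0 \<le> t" for t
    unfolding q_def using level_length_mono[OF that]
    by (intro add_mono) (meson diff_le_self_ennreal order_trans)+
  then have "(\<integral>\<^sup>+s\<in>{0..b}. q s \<partial>lborel) \<le> (\<integral>\<^sup>+s. (?m1 0 + ?m2 0) * indicator {0..b} s \<partial>lborel)"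
    by (intro nn_integral_mono) (auto simp: indicator_def)
  also have "\<dots> < \<infinity>" using fin \<open>0 \<le> b\<close> by (simp add: nn_integral_cmult ennreal_mult_less_top)
  finally have q_fin: "(\<integral>\<^sup>+s\<in>{0..b}. q s \<partial>lborel) < \<infinity>" .
  have step: "ma t \<le> mb t + ennreal C * (\<integral>\<^sup>+s\<in>{t..b}. q s \<partial>lborel)"
    if [measurable]: "ma \<in> borel_measurable borel" "mb \<in> borel_measurable borel"
      and "\<And>t. ma t \<le> mb t + q t"
      and a: "ma t = K + (\<integral>\<^sup>+r\<in>{t..b}. ennreal (kern (r - t)) * ma r \<partial>lborel)"
      and b: "mb t = K + (\<integral>\<^sup>+r\<in>{t..b}. ennreal (kern (r - t)) * mb r \<partial>lborel)" for ma mb t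
  proof -
    have "(\<integral>\<^sup>+r\<in>{t..b}. ennreal (kern (r - t)) * ma r \<partial>lborel)
      \<le> (\<integral>\<^sup>+r. ennreal (kern (r - t)) * mb r * indicator {t..b} r + ennreal C * (q r * indicator {t..b} r) \<partial>lborel)"
    proof (rule nn_integral_mono)
      fix r
      have "ennreal (kern (r - t)) * ma r \<le> ennreal (kern (r - t)) * mb r + ennreal C * q r" if "t \<le> r"
      proof -
        have "ennreal (kern (r - t)) * ma r \<le> ennreal (kern (r - t)) * (mb r + q r)"
          using \<open>\<And>t. ma t \<le> mb t + q t\<close> by (intro mult_left_mono) auto
        also have "\<dots> = ennreal (kern (r - t)) * mb r + ennreal (kern (r - t)) * q r"
          by (simp add: distrib_left)
        also have "\<dots> \<le> ennreal (kern (r - t)) * mb r + ennreal C * q r"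
          using that by (intro add_left_mono mult_right_mono ennreal_leI C) auto
        finally show ?thesis .
      qed
      then show "ennreal (kern (r - t)) * ma r * indicator {t..b} r \<le>
          ennreal (kern (r - t)) * mb r * indicator {t..b} r + ennreal C * (q r * indicator {t..b} r)"
        by (auto simp: indicator_def)
    qed
    also have "\<dots> = (\<integral>\<^sup>+r\<in>{t..b}. ennreal (kern (r - t)) * mb r \<partial>lborel) + ennreal C * (\<integral>\<^sup>+s\<in>{t..b}. q s \<partial>lborel)"
      by (subst nn_integral_add) (auto simp: nn_integral_cmult)
    finally show ?thesis
      unfolding a by (subst b) (simp add: add.assoc add_left_mono)
  qed
  have "AE t in lborel. t \<in> {0..b} \<longrightarrow> q t \<le> ennreal C * (\<integral>\<^sup>+s\<in>{t..b}. q s \<partial>lborel)"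
    using eq1 eq2
  proof eventually_elim
    case (elim t)
    show ?case
    proof
      assume t: "t \<in> {0..b}"
      let ?Q = "ennreal C * (\<integral>\<^sup>+s\<in>{t..b}. q s \<partial>lborel)"
      have "?m1 t \<le> ?m2 t + ?Q" "?m2 t \<le> ?m1 t + ?Q"
        using elim t by (intro step le; simp)+
      moreover have m_fin: "?m1 t < \<infinity>" "?m2 t < \<infinity>"
        using fin level_length_mono[of t] t by (auto intro: order_le_less_trans)
      ultimately have "?m1 t - ?m2 t \<le> ?Q" "?m2 t - ?m1 t \<le> ?Q"
        by (auto simp: ennreal_minus_le_iff)
      moreover have "?m1 t - ?m2 t = 0 \<or> ?m2 t - ?m1 t = 0"
        using m_fin linear[of "?m1 t" "?m2 t"] by (auto simp: diff_eq_0_ennreal)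
      ultimately show "q t \<le> ?Q" unfolding q_def by auto
    qed
  qed
  from backward_gronwall[OF _ q_fin C(1) this]
  have "AE t in lborel. t \<in> {0..b} \<longrightarrow> q t = 0" by simp
  then show ?thesis
  proof eventually_elim
    case (elim t)
    then show ?case
      using le[of t] by (auto intro: antisym)
  qed
qed

text \<open>If \<open>G1 y > G2 y\<close>, a value \<open>exp (- t)\<close> fits strictly between.
  By right continuity \<open>G1\<close> exceeds it on \<open>[0, z)\<close> for some
  \<open>z > y\<close>, whereas \<open>G2\<close> does so at most on \<open>[0, y]\<close>. But both
  sets have the same length, namely \<open>level_length\<close> at \<open>0\<close> minus that at
  \<open>t\<close>. The reverse inequality follows by exchanging the roles.\<close>

lemma survival_eq:
  assumes [measurable]: "G1 \<in> borel_measurable borel" "G2 \<in> borel_measurable borel"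
    and G1_01: "\<And>y. 0 \<le> y \<Longrightarrow> 0 \<le> G1 y \<and> G1 y \<le> 1" and G2_01: "\<And>y. 0 \<le> y \<Longrightarrow> 0 \<le> G2 y \<and> G2 y \<le> 1"
    and anti: "antimono G1" "antimono G2"
    and right: "\<And>y. continuous (at_right y) G1"
    and vals: "AE y in lborel. 0 \<le> y \<longrightarrow> G2 y = 0 \<or> exp (- b) \<le> G2 y"
    and ll0: "level_length G1 0 = level_length G2 0" and fin: "level_length G2 0 < \<infinity>"
    and ll: "AE t in lborel. t \<in> {0..b} \<longrightarrow> level_length G1 t = level_length G2 t"
    and y: "0 \<le> y"
  shows "G1 y \<le> G2 y"
proof (rule ccontr)
  assume "\<not> G1 y \<le> G2 y"
  then have lt: "G2 y < G1 y" by simp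
  have ext: "\<exists>z>y. ennreal z \<le> (\<integral>\<^sup>+x. of_bool (0 \<le> x \<and> c < G1 x) \<partial>lborel)" if "c < G1 y" for c
  proof -
    have "(G1 \<longlongrightarrow> G1 y) (at_right y)"
      using right[of y] by (simp add: continuous_within)
    from order_tendstoD(1)[OF this that] obtain z where z: "z > y" "\<And>x. y < x \<Longrightarrow> x < z \<Longrightarrow> c < G1 x"
      by (auto simp: eventually_at_right_field)
    have "c < G1 x" if "0 \<le> x" "x < z" for x
      using z(2)[of x] \<open>c < G1 y\<close> antimonoD[OF anti(1), of x y] that by (cases "x \<le> y") auto
    then have "(\<integral>\<^sup>+x. indicator {0..<z} x \<partial>lborel) \<le> (\<integral>\<^sup>+x. of_bool (0 \<le> x \<and> c < G1 x) \<partial>lborel)"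
      by (intro nn_integral_mono) (auto simp: indicator_def)
    then show ?thesis using z(1) y by (intro exI[of _ z]) simp
  qed
  have bd: "(\<integral>\<^sup>+x. of_bool (0 \<le> x \<and> c < G2 x) \<partial>lborel) \<le> ennreal y" if "AE x in lborel. y < x \<longrightarrow> G2 x \<le> c" for c
  proof -
    have "(\<integral>\<^sup>+x. of_bool (0 \<le> x \<and> c < G2 x) \<partial>lborel) \<le> (\<integral>\<^sup>+x. indicator {0..y} x \<partial>lborel)"
      by (rule nn_integral_mono_AE, use that in eventually_elim) (auto simp: indicator_def)
    then show ?thesis using y by simp
  qed
  have pos: "level_length G t = (\<integral>\<^sup>+x. of_bool (0 \<le> x \<and> 0 < G x) \<partial>lborel)"
    if "\<And>y. 0 \<le> y \<Longrightarrow> 0 \<le> G y \<and> G y \<le> 1" "t = 0" for G t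
    unfolding level_length_def using that by (intro nn_integral_cong) auto
  \<comment> \<open>This keeps the separating \<open>t\<close> in \<open>[0, b]\<close>. Otherwise
    \<open>G2\<close> would vanish almost everywhere beyond \<open>y\<close> while \<open>G1\<close>
    is still positive there, against equal level lengths at \<open>0\<close>.\<close>
  have G2_ge: "exp (- b) \<le> G2 y"
  proof (rule ccontr)
    assume "\<not> exp (- b) \<le> G2 y"
    have "AE x in lborel. y < x \<longrightarrow> G2 x \<le> 0"
      using vals
    proof eventually_elim
      case (elim x)
      show ?case
        using elim \<open>\<not> exp (- b) \<le> G2 y\<close> antimonoD[OF anti(2), of y x] y by auto
    qed
    from bd[OF this] have "level_length G2 0 \<le> ennreal y" by (simp add: pos G2_01)
    moreover obtain z where "z > y" "ennreal z \<le> level_length G1 0"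
      using ext[of 0] lt G2_01[OF y] by (auto simp: pos G1_01)
    ultimately have "ennreal z \<le> ennreal y" unfolding ll0 by (meson order_trans)
    then show False using \<open>z > y\<close> y by (simp add: ennreal_le_iff)
  qed
  have split: "level_length G 0 = level_length G t + (\<integral>\<^sup>+x. of_bool (0 \<le> x \<and> exp (- t) < G x) \<partial>lborel)"
    if [measurable]: "G \<in> borel_measurable borel" and "\<And>y. 0 \<le> y \<Longrightarrow> 0 \<le> G y \<and> G y \<le> 1" and "0 \<le> t" for G t
  proof -
    have "of_bool (0 \<le> x \<and> 0 < G x \<and> G x \<le> exp (- 0)) =
        of_bool (0 \<le> x \<and> 0 < G x \<and> G x \<le> exp (- t)) + (of_bool (0 \<le> x \<and> exp (- t) < G x) :: ennreal)" for x
      using that(2)[of x] exp_gt_zero[of "- t"] \<open>0 \<le> t\<close> by (auto simp del: exp_gt_zero)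
    then show ?thesis
      unfolding level_length_def by (subst nn_integral_add[symmetric]) auto
  qed
  have G2_pos: "0 < G2 y" using G2_ge exp_gt_zero[of "- b"] by linarith
  \<comment> \<open>The level lengths agree only for almost every \<open>t\<close>; a nonempty open
    interval of separating times cannot lie in the exceptional null set.\<close>
  have "- ln (G1 y) < - ln (G2 y)" using lt G2_pos by simp
  then obtain t where t: "- ln (G1 y) < t" "t < - ln (G2 y)" "t \<in> {0..b} \<longrightarrow> level_length G1 t = level_length G2 t"
    using AE_lborel_obtain[OF ll] by blast
  have "0 \<le> t" using t(1) lt G2_pos G1_01[OF y] by (smt (verit) ln_le_zero_iff)
  moreover have "t \<le> b"
  proof -
    have "ln (exp (- b)) \<le> ln (G2 y)" using G2_ge G2_pos by (subst ln_le_cancel_iff) auto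
    then show ?thesis using t(2) by simp
  qed
  ultimately have tb: "t \<in> {0..b}" and "0 \<le> t" by auto
  have "exp (- t) < exp (ln (G1 y))" "exp (ln (G2 y)) < exp (- t)" using t by (simp_all only: exp_less_cancel_iff)
  then have c: "exp (- t) < G1 y" "G2 y < exp (- t)" using lt G2_pos by auto
  have "AE x in lborel. y < x \<longrightarrow> G2 x \<le> exp (- t)"
    using c(2) antimonoD[OF anti(2), of y] by (intro AE_I2) (metis less_imp_le order_trans)
  from bd[OF this] have u2: "(\<integral>\<^sup>+x. of_bool (0 \<le> x \<and> exp (- t) < G2 x) \<partial>lborel) \<le> ennreal y" .
  obtain z where z: "z > y" "ennreal z \<le> (\<integral>\<^sup>+x. of_bool (0 \<le> x \<and> exp (- t) < G1 x) \<partial>lborel)"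
    using ext[OF c(1)] by blast
  have "level_length G2 0 = level_length G2 t + (\<integral>\<^sup>+x. of_bool (0 \<le> x \<and> exp (- t) < G2 x) \<partial>lborel)"
    by (rule split[OF assms(2) G2_01 \<open>0 \<le> t\<close>])
  moreover have "level_length G1 0 = level_length G1 t + (\<integral>\<^sup>+x. of_bool (0 \<le> x \<and> exp (- t) < G1 x) \<partial>lborel)"
    by (rule split[OF assms(1) G1_01 \<open>0 \<le> t\<close>])
  moreover have "level_length G1 t = level_length G2 t" using t(3) tb by blast
  ultimately have "level_length G2 t + (\<integral>\<^sup>+x. of_bool (0 \<le> x \<and> exp (- t) < G1 x) \<partial>lborel)
      = level_length G2 t + (\<integral>\<^sup>+x. of_bool (0 \<le> x \<and> exp (- t) < G2 x) \<partial>lborel)"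
    unfolding ll0 by (simp only:)
  moreover have "level_length G2 t \<noteq> \<infinity>" using fin level_length_mono[OF \<open>0 \<le> t\<close>, of G2] by auto
  ultimately have "(\<integral>\<^sup>+x. of_bool (0 \<le> x \<and> exp (- t) < G1 x) \<partial>lborel) = (\<integral>\<^sup>+x. of_bool (0 \<le> x \<and> exp (- t) < G2 x) \<partial>lborel)"
    by (simp only: ennreal_add_left_cancel)  blast
  with z(2) have "ennreal z \<le> (\<integral>\<^sup>+x. of_bool (0 \<le> x \<and> exp (- t) < G2 x) \<partial>lborel)" by (simp only:)
  then have "ennreal z \<le> ennreal y" using u2 by (rule order_trans)
  then show False using \<open>z > y\<close> y by (simp add: ennreal_le_iff)
qed

end

section \<open>Duality\<close>

context volterra_dual
begin

text \<open>Continuity of \<open>g\<close> is known only on \<open>[0, b]\<close>; cutting it off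
  there yields a Borel function on the whole line.\<close>

definition dual_weight :: "real \<Rightarrow> ennreal" where
  "dual_weight t = ennreal (g t) * indicator {0..b} t"

lemma borel_dual_weight [measurable]: "dual_weight \<in> borel_measurable borel"
proof -
  have "(\<lambda>t. indicator {0..b} t *\<^sub>R g t) \<in> borel_measurable borel"
    by (intro borel_measurable_continuous_on_indicator cont_g) auto
  then have "(\<lambda>t. ennreal (indicator {0..b} t *\<^sub>R g t)) \<in> borel_measurable borel"
    by measurable
  also have "(\<lambda>t. ennreal (indicator {0..b} t *\<^sub>R g t)) = dual_weight"
    by (auto simp: dual_weight_def indicator_def)
  finally show ?thesis .
qed

lemma dual_weight_finite: "integral\<^sup>N lborel dual_weight < \<infinity>"
  unfolding dual_weight_def using set_nn_integral_eq_integral_cont[OF cont_g g_nonneg] by simp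

lemma dual_price:
  "(\<integral>\<^sup>+t\<in>{0..b}. ennreal (g t) * ennreal (phi t p) \<partial>lborel) = (\<integral>\<^sup>+t. dual_weight t * ennreal (phi t p) \<partial>lborel)"
  unfolding dual_weight_def by (intro nn_integral_cong) (auto simp: mult_ac)

lemma dual_ge:
  assumes "0 \<le> p" "p \<le> 1"
  shows "ennreal p \<le> ennreal (W p) + (\<integral>\<^sup>+t. dual_weight t * ennreal (phi t p) \<partial>lborel)"
  using dual_eq[of p] dual_gt[of p] assms unfolding dual_price
  by (cases "p = 0"; cases "p < exp (- b)") (auto simp: less_imp_le)

text \<open>Tonelli aggregates the constraints. The summand \<open>W\<close> belongs to the atom of
  the dual measure at time \<open>0\<close>, since \<open>phi 0\<close> is \<open>W\<close> on
  \<open>[0, 1]\<close>.\<close>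

lemma dual_integral:
  fixes G :: "real \<Rightarrow> real"
  assumes [measurable]: "G \<in> borel_measurable borel" and G01: "\<And>y. 0 \<le> y \<Longrightarrow> 0 \<le> G y \<and> G y \<le> 1"
  shows "(\<integral>\<^sup>+y\<in>{0..}. (ennreal (W (G y)) + (\<integral>\<^sup>+t. dual_weight t * ennreal (phi t (G y)) \<partial>lborel)) \<partial>lborel)
    = (\<integral>\<^sup>+y\<in>{0..}. ennreal (phi 0 (G y)) \<partial>lborel)
      + (\<integral>\<^sup>+t. dual_weight t * (\<integral>\<^sup>+y\<in>{0..}. ennreal (phi t (G y)) \<partial>lborel) \<partial>lborel)"
proof -
  have "(\<integral>\<^sup>+y\<in>{0..}. (ennreal (W (G y)) + (\<integral>\<^sup>+t. dual_weight t * ennreal (phi t (G y)) \<partial>lborel)) \<partial>lborel)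
    = (\<integral>\<^sup>+y. ennreal (phi 0 (G y)) * indicator {0..} y
      + (\<integral>\<^sup>+t. dual_weight t * ennreal (phi t (G y)) * indicator {0..} y \<partial>lborel) \<partial>lborel)"
    by (intro nn_integral_cong) (auto simp: indicator_def phi_0_left G01)
  also have "\<dots> = (\<integral>\<^sup>+y\<in>{0..}. ennreal (phi 0 (G y)) \<partial>lborel)
      + (\<integral>\<^sup>+y. \<integral>\<^sup>+t. dual_weight t * ennreal (phi t (G y)) * indicator {0..} y \<partial>lborel \<partial>lborel)"
    by (rule nn_integral_add) measurable
  also have "(\<integral>\<^sup>+y. \<integral>\<^sup>+t. dual_weight t * ennreal (phi t (G y)) * indicator {0..} y \<partial>lborel \<partial>lborel)
    = (\<integral>\<^sup>+t. \<integral>\<^sup>+y. dual_weight t * ennreal (phi t (G y)) * indicator {0..} y \<partial>lborel \<partial>lborel)"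
    by (rule lborel_pair.Fubini'[symmetric]) measurable
  also have "\<dots> = (\<integral>\<^sup>+t. dual_weight t * (\<integral>\<^sup>+y\<in>{0..}. ennreal (phi t (G y)) \<partial>lborel) \<partial>lborel)"
    by (subst nn_integral_cmult[symmetric]) (auto simp: mult_ac)
  finally show ?thesis .
qed

text \<open>The objective of the dual program: \<open>K\<close> times the mass of the dual measure,
  which has an atom of mass one at time \<open>0\<close> and density \<open>g\<close>.\<close>

definition dual_value :: "real \<Rightarrow> ennreal" where
  "dual_value K = ennreal K + integral\<^sup>N lborel dual_weight * ennreal K"

lemma dual_value_finite: "dual_value K < \<infinity>"
  unfolding dual_value_def using dual_weight_finite by (simp add: ennreal_mult_less_top)

lemma feasible_dual_le:
  fixes G :: "real \<Rightarrow> real"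
  assumes feas: "\<And>t. t \<in> {0..b} \<Longrightarrow> (\<integral>\<^sup>+y\<in>{0..}. ennreal (phi t (G y)) \<partial>lborel) \<le> ennreal K"
  shows "dual_weight t * (\<integral>\<^sup>+y\<in>{0..}. ennreal (phi t (G y)) \<partial>lborel) \<le> dual_weight t * ennreal K"
  by (cases "t \<in> {0..b}") (simp_all add: dual_weight_def mult_left_mono feas del: atLeastAtMost_iff)

text \<open>Each \<open>G y\<close> is at most its dual price, and integrated prices are aggregated
  constraints.\<close>

lemma weak_duality:
  fixes G :: "real \<Rightarrow> real"
  assumes [measurable]: "G \<in> borel_measurable borel" and G01: "\<And>y. 0 \<le> y \<Longrightarrow> 0 \<le> G y \<and> G y \<le> 1"
    and feas: "\<And>t. t \<in> {0..b} \<Longrightarrow> (\<integral>\<^sup>+y\<in>{0..}. ennreal (phi t (G y)) \<partial>lborel) \<le> ennreal K"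
  shows "(\<integral>\<^sup>+y\<in>{0..}. ennreal (G y) \<partial>lborel) \<le> dual_value K"
proof -
  have "(\<integral>\<^sup>+y\<in>{0..}. ennreal (G y) \<partial>lborel)
     \<le> (\<integral>\<^sup>+y\<in>{0..}. (ennreal (W (G y)) + (\<integral>\<^sup>+t. dual_weight t * ennreal (phi t (G y)) \<partial>lborel)) \<partial>lborel)"
    using G01 by (intro nn_integral_mono) (auto simp: indicator_def intro: dual_ge)
  also have "\<dots> = (\<integral>\<^sup>+y\<in>{0..}. ennreal (phi 0 (G y)) \<partial>lborel)
      + (\<integral>\<^sup>+t. dual_weight t * (\<integral>\<^sup>+y\<in>{0..}. ennreal (phi t (G y)) \<partial>lborel) \<partial>lborel)"
    by (rule dual_integral) (use G01 in auto)
  also have "\<dots> \<le> ennreal K + (\<integral>\<^sup>+t. dual_weight t * ennreal K \<partial>lborel)"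
    using b_pos by (intro add_mono feas nn_integral_mono feasible_dual_le) auto
  finally show ?thesis by (simp add: dual_value_def nn_integral_multc)
qed

text \<open>Every inequality of weak duality becomes an equality: the price equals the probability
  on the allowed values, and the constraints are tight.\<close>

lemma strong_duality:
  fixes G :: "real \<Rightarrow> real"
  assumes [measurable]: "G \<in> borel_measurable borel" and G01: "\<And>y. 0 \<le> y \<Longrightarrow> 0 \<le> G y \<and> G y \<le> 1"
    and feas: "\<And>t. t \<in> {0..b} \<Longrightarrow> (\<integral>\<^sup>+y\<in>{0..}. ennreal (phi t (G y)) \<partial>lborel) = ennreal K"
    and vals: "\<And>y. 0 \<le> y \<Longrightarrow> G y = 0 \<or> exp (- b) \<le> G y"
  shows "(\<integral>\<^sup>+y\<in>{0..}. ennreal (G y) \<partial>lborel) = dual_value K"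
proof -
  have "(\<integral>\<^sup>+y\<in>{0..}. ennreal (G y) \<partial>lborel)
     = (\<integral>\<^sup>+y\<in>{0..}. (ennreal (W (G y)) + (\<integral>\<^sup>+t. dual_weight t * ennreal (phi t (G y)) \<partial>lborel)) \<partial>lborel)"
    apply (intro nn_integral_cong)
    subgoal for y
      using G01[of y] vals[of y] dual_eq[of "G y"] unfolding dual_price
      by (cases "G y = 0") (auto simp: indicator_def W_0)
    done
  also have "\<dots> = (\<integral>\<^sup>+y\<in>{0..}. ennreal (phi 0 (G y)) \<partial>lborel)
      + (\<integral>\<^sup>+t. dual_weight t * (\<integral>\<^sup>+y\<in>{0..}. ennreal (phi t (G y)) \<partial>lborel) \<partial>lborel)"
    by (rule dual_integral) (use G01 in auto)
  also have "(\<integral>\<^sup>+t. dual_weight t * (\<integral>\<^sup>+y\<in>{0..}. ennreal (phi t (G y)) \<partial>lborel) \<partial>lborel) = (\<integral>\<^sup>+t. dual_weight t * ennreal K \<partial>lborel)"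
    apply (intro nn_integral_cong)
    subgoal for t by (cases "t \<in> {0..b}") (simp_all add: dual_weight_def feas del: atLeastAtMost_iff)
    done
  also have "(\<integral>\<^sup>+y\<in>{0..}. ennreal (phi 0 (G y)) \<partial>lborel) = ennreal K"
    using feas b_pos by simp
  finally show ?thesis by (simp add: dual_value_def nn_integral_multc)
qed

text \<open>Optimality forces equality at each step of weak duality. A strict price gap can then
  occur only on a null set of levels, the atom gives tightness exactly at \<open>t = 0\<close>, and
  the density gives it for almost every \<open>t\<close>.\<close>

lemma complementary_slackness:
  fixes G :: "real \<Rightarrow> real"
  assumes [measurable]: "G \<in> borel_measurable borel" and G01: "\<And>y. 0 \<le> y \<Longrightarrow> 0 \<le> G y \<and> G y \<le> 1"
    and feas: "\<And>t. t \<in> {0..b} \<Longrightarrow> (\<integral>\<^sup>+y\<in>{0..}. ennreal (phi t (G y)) \<partial>lborel) \<le> ennreal K"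
    and opt: "dual_value K \<le> (\<integral>\<^sup>+y\<in>{0..}. ennreal (G y) \<partial>lborel)"
  shows "AE y in lborel. 0 \<le> y \<longrightarrow> G y = 0 \<or> exp (- b) \<le> G y"
    and "(\<integral>\<^sup>+y\<in>{0..}. ennreal (phi 0 (G y)) \<partial>lborel) = ennreal K"
    and "AE t in lborel. t \<in> {0..b} \<longrightarrow> (\<integral>\<^sup>+y\<in>{0..}. ennreal (phi t (G y)) \<partial>lborel) = ennreal K"
proof -
  let ?price = "\<lambda>y. ennreal (W (G y)) + (\<integral>\<^sup>+t. dual_weight t * ennreal (phi t (G y)) \<partial>lborel)"
  let ?a = "\<integral>\<^sup>+y\<in>{0..}. ennreal (phi 0 (G y)) \<partial>lborel"
  let ?b = "\<integral>\<^sup>+t. dual_weight t * (\<integral>\<^sup>+y\<in>{0..}. ennreal (phi t (G y)) \<partial>lborel) \<partial>lborel"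
  have price: "(\<integral>\<^sup>+y\<in>{0..}. ?price y \<partial>lborel) = ?a + ?b"
    by (rule dual_integral) (use G01 in auto)
  have le: "ennreal (G y) * indicator {0..} y \<le> ?price y * indicator {0..} y" for y
    using G01[of y] dual_ge[of "G y"] by (auto simp: indicator_def)
  have a_le: "?a \<le> ennreal K" using feas b_pos by simp
  have b_le: "?b \<le> (\<integral>\<^sup>+t. dual_weight t * ennreal K \<partial>lborel)"
    by (intro nn_integral_mono feasible_dual_le feas)
  have val: "ennreal K + (\<integral>\<^sup>+t. dual_weight t * ennreal K \<partial>lborel) = dual_value K"
    by (simp add: dual_value_def nn_integral_multc)
  have G_le: "(\<integral>\<^sup>+y\<in>{0..}. ennreal (G y) \<partial>lborel) \<le> ?a + ?b"
    unfolding price[symmetric] by (intro nn_integral_mono le)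
  have sum_le: "?a + ?b \<le> dual_value K"
    unfolding val[symmetric] by (intro add_mono a_le b_le)
  have ge: "dual_value K \<le> ?a + ?b" using opt G_le by (rule order_trans)
  show "?a = ennreal K"
    by (rule ennreal_add_le_imp_eq(1)[OF a_le b_le]) (use val ge dual_value_finite in simp_all)
  have b_eq: "?b = (\<integral>\<^sup>+t. dual_weight t * ennreal K \<partial>lborel)"
    by (rule ennreal_add_le_imp_eq(2)[OF a_le b_le]) (use val ge dual_value_finite in simp_all)
  have "AE y in lborel. ennreal (G y) * indicator {0..} y = ?price y * indicator {0..} y"
  proof (rule nn_integral_eq_imp_AE_eq)
    show "(\<integral>\<^sup>+y\<in>{0..}. ?price y \<partial>lborel) \<le> (\<integral>\<^sup>+y\<in>{0..}. ennreal (G y) \<partial>lborel)"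
      unfolding price using sum_le opt by (rule order_trans)
    show "(\<integral>\<^sup>+y\<in>{0..}. ennreal (G y) \<partial>lborel) < \<infinity>"
      using G_le sum_le dual_value_finite by (meson order_le_less_trans)
    show "(\<lambda>y. ennreal (G y) * indicator {0..} y) \<in> borel_measurable lborel"
      "(\<lambda>y. ?price y * indicator {0..} y) \<in> borel_measurable lborel"
      by measurable
  qed (rule le)
  then show "AE y in lborel. 0 \<le> y \<longrightarrow> G y = 0 \<or> exp (- b) \<le> G y"
  proof eventually_elim
    case (elim y)
    show ?case
    proof (rule impI, rule ccontr)
      assume "0 \<le> y" "\<not> (G y = 0 \<or> exp (- b) \<le> G y)"
      with elim dual_gt[of "G y"] G01[of y] show False unfolding dual_price by auto
    qed
  qed
  have "AE t in lborel. dual_weight t * (\<integral>\<^sup>+y\<in>{0..}. ennreal (phi t (G y)) \<partial>lborel) = dual_weight t * ennreal K"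
  proof (rule nn_integral_eq_imp_AE_eq)
    show "(\<lambda>t. dual_weight t * (\<integral>\<^sup>+y\<in>{0..}. ennreal (phi t (G y)) \<partial>lborel)) \<in> borel_measurable lborel"
      by measurable
    show "?b < \<infinity>" unfolding b_eq using dual_weight_finite by (simp add: nn_integral_multc ennreal_mult_less_top)
  qed (use b_eq feasible_dual_le[OF feas] in auto)
  \<comment> \<open>The density vanishes at \<open>b\<close>, so tightness there cannot be read off;
    before \<open>b\<close> it is positive and can be cancelled.\<close>
  moreover have "AE t in lborel. t \<noteq> b" by (rule AE_lborel_singleton)
  ultimately show "AE t in lborel. t \<in> {0..b} \<longrightarrow> (\<integral>\<^sup>+y\<in>{0..}. ennreal (phi t (G y)) \<partial>lborel) = ennreal K"
  proof eventually_elim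
    case (elim t)
    show ?case
    proof
      assume t: "t \<in> {0..b}"
      with elim(2) have "0 < g t" by (intro g_pos) auto
      then have "ennreal (g t) \<noteq> 0" "ennreal (g t) \<noteq> \<top>" by auto
      with elim(1) t show "(\<integral>\<^sup>+y\<in>{0..}. ennreal (phi t (G y)) \<partial>lborel) = ennreal K"
        by (simp add: dual_weight_def ennreal_mult_cancel_left)
    qed
  qed
qed

text \<open>By complementary slackness the level lengths of both functions solve the same Volterra
  equation with finite solutions, hence they agree, and they determine a right continuous survival
  function.\<close>

lemma optimal_survival_unique:
  fixes G1 G2 :: "real \<Rightarrow> real"
  assumes meas: "G1 \<in> borel_measurable borel" "G2 \<in> borel_measurable borel"
    and G1_01: "\<And>y. 0 \<le> y \<Longrightarrow> 0 \<le> G1 y \<and> G1 y \<le> 1" and G2_01: "\<And>y. 0 \<le> y \<Longrightarrow> 0 \<le> G2 y \<and> G2 y \<le> 1"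
    and anti: "antimono G1" "antimono G2"
    and right: "\<And>y. continuous (at_right y) G1" "\<And>y. continuous (at_right y) G2"
    and feas1: "\<And>t. t \<in> {0..b} \<Longrightarrow> (\<integral>\<^sup>+y\<in>{0..}. ennreal (phi t (G1 y)) \<partial>lborel) \<le> ennreal K"
    and feas2: "\<And>t. t \<in> {0..b} \<Longrightarrow> (\<integral>\<^sup>+y\<in>{0..}. ennreal (phi t (G2 y)) \<partial>lborel) \<le> ennreal K"
    and opt1: "dual_value K \<le> (\<integral>\<^sup>+y\<in>{0..}. ennreal (G1 y) \<partial>lborel)"
    and opt2: "dual_value K \<le> (\<integral>\<^sup>+y\<in>{0..}. ennreal (G2 y) \<partial>lborel)"
    and y: "0 \<le> y"
  shows "G1 y = G2 y"
proof -
  have cs1: "AE y in lborel. 0 \<le> y \<longrightarrow> G1 y = 0 \<or> exp (- b) \<le> G1 y"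
    "(\<integral>\<^sup>+y\<in>{0..}. ennreal (phi 0 (G1 y)) \<partial>lborel) = ennreal K"
    "AE t in lborel. t \<in> {0..b} \<longrightarrow> (\<integral>\<^sup>+y\<in>{0..}. ennreal (phi t (G1 y)) \<partial>lborel) = ennreal K"
    by (rule complementary_slackness[OF meas(1) _ _ opt1]; use G1_01 feas1 in simp)+
  have cs2: "AE y in lborel. 0 \<le> y \<longrightarrow> G2 y = 0 \<or> exp (- b) \<le> G2 y"
    "(\<integral>\<^sup>+y\<in>{0..}. ennreal (phi 0 (G2 y)) \<partial>lborel) = ennreal K"
    "AE t in lborel. t \<in> {0..b} \<longrightarrow> (\<integral>\<^sup>+y\<in>{0..}. ennreal (phi t (G2 y)) \<partial>lborel) = ennreal K"
    by (rule complementary_slackness[OF meas(2) _ _ opt2]; use G2_01 feas2 in simp)+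
  have fin: "level_length G 0 < \<infinity>"
    if "G \<in> borel_measurable borel" "\<And>y. 0 \<le> y \<Longrightarrow> 0 \<le> G y \<and> G y \<le> 1"
      "\<And>t. t \<in> {0..b} \<Longrightarrow> (\<integral>\<^sup>+y\<in>{0..}. ennreal (phi t (G y)) \<partial>lborel) \<le> ennreal K"
      "AE y in lborel. 0 \<le> y \<longrightarrow> G y = 0 \<or> exp (- b) \<le> G y" for G
    using weak_duality[OF that(1-3)] dual_value_finite[of K]
    by (intro level_length_finite[OF that(1,4)]) (auto intro: order_le_less_trans)
  have fin1: "level_length G1 0 < \<infinity>"
    by (rule fin[OF meas(1) _ _ cs1(1)]) (use G1_01 feas1 in simp_all)
  have fin2: "level_length G2 0 < \<infinity>"
    by (rule fin[OF meas(2) _ _ cs2(1)]) (use G2_01 feas2 in simp_all)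
  have v1: "level_length G1 t = (\<integral>\<^sup>+y\<in>{0..}. ennreal (phi t (G1 y)) \<partial>lborel)
      + (\<integral>\<^sup>+r\<in>{t..b}. ennreal (kern (r - t)) * level_length G1 r \<partial>lborel)" if "t \<in> {0..b}" for t
    by (rule level_length_volterra[OF meas(1) _ cs1(1) that]) (use G1_01 in simp)
  have v2: "level_length G2 t = (\<integral>\<^sup>+y\<in>{0..}. ennreal (phi t (G2 y)) \<partial>lborel)
      + (\<integral>\<^sup>+r\<in>{t..b}. ennreal (kern (r - t)) * level_length G2 r \<partial>lborel)" if "t \<in> {0..b}" for t
    by (rule level_length_volterra[OF meas(2) _ cs2(1) that]) (use G2_01 in simp)
  have ll: "AE t in lborel. t \<in> {0..b} \<longrightarrow> level_length G1 t = level_length G2 t"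
  proof (rule level_length_eq[OF meas, where K = "ennreal K"])
    show "AE t in lborel. t \<in> {0..b} \<longrightarrow> level_length G1 t = ennreal K +
        (\<integral>\<^sup>+r\<in>{t..b}. ennreal (kern (r - t)) * level_length G1 r \<partial>lborel)"
      using cs1(3) by eventually_elim (use v1 in auto)
    show "AE t in lborel. t \<in> {0..b} \<longrightarrow> level_length G2 t = ennreal K +
        (\<integral>\<^sup>+r\<in>{t..b}. ennreal (kern (r - t)) * level_length G2 r \<partial>lborel)"
      using cs2(3) by eventually_elim (use v2 in auto)
  qed (use fin1 fin2 b_pos in simp_all)
  \<comment> \<open>Almost everywhere equality says nothing about \<open>t = 0\<close>. Equality
    there comes from the Volterra equation at \<open>0\<close>, whose constraint is tight because of
    the atom.\<close>
  have "(\<integral>\<^sup>+r\<in>{0..b}. ennreal (kern (r - 0)) * level_length G1 r \<partial>lborel) = (\<integral>\<^sup>+r\<in>{0..b}. ennreal (kern (r - 0)) * level_length G2 r \<partial>lborel)"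
    by (intro nn_integral_cong_AE, use ll in eventually_elim) (auto simp: indicator_def)
  then have ll0: "level_length G1 0 = level_length G2 0"
    using v1[of 0] v2[of 0] cs1(2) cs2(2) b_pos by simp
  show ?thesis
  proof (rule antisym)
    show "G1 y \<le> G2 y"
      by (rule survival_eq[OF meas G1_01 G2_01 anti right(1) cs2(1) ll0 fin2 ll y]) auto
    have ll': "AE t in lborel. t \<in> {0..b} \<longrightarrow> level_length G2 t = level_length G1 t"
      using ll by eventually_elim auto
    show "G2 y \<le> G1 y"
      by (rule survival_eq[OF meas(2,1) G2_01 G1_01 anti(2,1) right(2) cs1(1) ll0[symmetric] fin1 ll' y]) auto
  qed
qed

end

section \<open>Survival functions of payments\<close>

text \<open>Left continuity takes the order form in which it is needed: a bound valid before
  \<open>s\<close> persists at \<open>s\<close>.\<close>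

lemma cum_payment_facts:
  assumes "cum_payment T"
  shows cum_payment_0: "T 0 = 0"
    and cum_payment_mono: "\<And>s t. 0 \<le> s \<Longrightarrow> s \<le> t \<Longrightarrow> T s \<le> T t"
    and cum_payment_left_cont: "\<And>s y. 0 < s \<Longrightarrow> (\<And>t. 0 \<le> t \<Longrightarrow> t < s \<Longrightarrow> T t \<le> y) \<Longrightarrow> T s \<le> y"
proof -
  obtain f ts Ts where H: "(\<forall>s\<ge>0. 0 \<le> f s) \<and> f absolutely_integrable_on {0..} \<and>
        incseq ts \<and> (\<forall>i. 0 \<le> ts i \<and> 0 \<le> Ts i) \<and>
        (\<forall>t\<ge>0. summable (\<lambda>i. if ts i < t then Ts i else 0) \<and>
                T t = integral {0..t} f + (\<Sum>i. if ts i < t then Ts i else 0))"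
    using assms unfolding cum_payment_def by (elim exE)
  then have f: "\<And>s. 0 \<le> s \<Longrightarrow> 0 \<le> f s" "f absolutely_integrable_on {0..}"
    and ts: "\<And>i. 0 \<le> ts i" "\<And>i. 0 \<le> Ts i"
    and sm: "\<And>t. 0 \<le> t \<Longrightarrow> summable (\<lambda>i. if ts i < t then Ts i else 0)"
    and T: "\<And>t. 0 \<le> t \<Longrightarrow> T t = integral {0..t} f + (\<Sum>i. if ts i < t then Ts i else 0)"
    by simp_all
  have "f integrable_on {0..}" using f(2) set_lebesgue_integral_eq_integral(1) by blast
  then have int: "f integrable_on {0..t}" for t
    by (rule integrable_on_subinterval) auto
  show "T 0 = 0" using T[of 0] ts by (simp add: not_less[symmetric])
  show "T s \<le> T t" if "0 \<le> s" "s \<le> t" for s t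
  proof -
    have "integral {0..s} f \<le> integral {0..t} f"
      using that f(1) by (intro integral_subset_le int) auto
    moreover have "(\<Sum>i. if ts i < s then Ts i else 0) \<le> (\<Sum>i. if ts i < t then Ts i else 0)"
      using that by (intro suminf_le sm) (auto simp: ts)
    ultimately show ?thesis using that T by simp
  qed
  show "T s \<le> y" if s: "0 < s" and le: "\<And>t. 0 \<le> t \<Longrightarrow> t < s \<Longrightarrow> T t \<le> y" for s y
  proof -
    \<comment> \<open>With only finitely many jumps kept, all jump times below \<open>s\<close> lie
      below \<open>t\<close> once \<open>t\<close> is close to \<open>s\<close>, so the bound passes
      to the left limit; the remaining jumps are recovered as \<open>n\<close> grows.\<close>
    have partial: "integral {0..s} f + (\<Sum>i<n. if ts i < s then Ts i else 0) \<le> y" for n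
    proof -
      let ?S = "\<Sum>i<n. if ts i < s then Ts i else 0"
      have "continuous_on {0..s} (\<lambda>t. integral {0..t} f)"
        by (rule indefinite_integral_continuous_1[OF int])
      then have "((\<lambda>t. integral {0..t} f) \<longlongrightarrow> integral {0..s} f) (at s within {0..s})"
        using s by (auto simp: continuous_on)
      then have lim: "((\<lambda>t. integral {0..t} f + ?S) \<longlongrightarrow> integral {0..s} f + ?S) (at_left s)"
        using s by (intro tendsto_intros) (simp add: at_within_Icc_at_left)
      have "\<forall>\<^sub>F t in at_left s. \<forall>i<n. ts i < s \<longrightarrow> ts i < t"
        unfolding Ball_def[symmetric] lessThan_iff[symmetric]
        by (intro eventually_ball_finite) (auto simp: eventually_at_left_real intro!: eventually_at_leftI)
      moreover have "\<forall>\<^sub>F t in at_left s. t \<in> {0<..<s}"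
        using s by (rule eventually_at_left_real)
      ultimately have "\<forall>\<^sub>F t in at_left s. integral {0..t} f + ?S \<le> y"
      proof eventually_elim
        case (elim t)
        have "?S \<le> (\<Sum>i<n. if ts i < t then Ts i else 0)"
          using elim by (intro sum_mono) (auto simp: ts)
        also have "\<dots> \<le> (\<Sum>i. if ts i < t then Ts i else 0)"
          using elim by (intro sum_le_suminf sm) (auto simp: ts)
        finally have "integral {0..t} f + ?S \<le> T t" using T[of t] elim by simp
        also have "\<dots> \<le> y" using elim by (intro le) auto
        finally show ?case .
      qed
      with lim show ?thesis
        by (rule tendsto_upperbound) simp
    qed
    have "(\<lambda>n. integral {0..s} f + (\<Sum>i<n. if ts i < s then Ts i else 0)) \<longlonglongrightarrow> T s"
      unfolding T[OF less_imp_le[OF s]] by (intro tendsto_intros summable_LIMSEQ sm) (use s in simp)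
    then show ?thesis
      by (rule LIMSEQ_le_const2) (use partial in blast)
  qed
qed

text \<open>Take \<open>s\<close> as the supremum of the times with payment at most
  \<open>y\<close>. Left continuity shows that it is attained, so \<open>s\<close> is the last such
  time.\<close>

lemma cum_payment_level:
  assumes T: "cum_payment T" and "0 \<le> y" and ex: "0 \<le> u" "y < T u"
  obtains s where "0 \<le> s" "\<And>t. 0 \<le> t \<Longrightarrow> y < T t \<longleftrightarrow> s < t"
proof -
  define A where "A = {t. 0 \<le> t \<and> T t \<le> y}"
  have "0 \<in> A" using cum_payment_0[OF T] \<open>0 \<le> y\<close> by (simp add: A_def)
  have ub: "t \<le> u" if "t \<in> A" for t
    using that ex cum_payment_mono[OF T, of u t] by (force simp: A_def)
  then have bdd: "bdd_above A" by (rule bdd_aboveI)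
  define s where "s = Sup A"
  have "0 \<le> s" unfolding s_def by (rule cSup_upper[OF \<open>0 \<in> A\<close> bdd])
  have below: "T t \<le> y" if t: "0 \<le> t" "t < s" for t
  proof -
    obtain a where "a \<in> A" "t < a"
      using t(2) less_cSup_iff[OF _ bdd, of t] \<open>0 \<in> A\<close> unfolding s_def by (metis empty_iff)
    then show ?thesis using cum_payment_mono[OF T \<open>0 \<le> t\<close>, of a] by (auto simp: A_def)
  qed
  have "T s \<le> y"
    using cum_payment_left_cont[OF T, of s y] below \<open>0 \<le> s\<close> \<open>0 \<in> A\<close>
    by (cases "s = 0") (auto simp: A_def)
  have "y < T t \<longleftrightarrow> s < t" if "0 \<le> t" for t
  proof
    assume "y < T t"
    then show "s < t" using below[OF that] \<open>T s \<le> y\<close> by (metis linorder_neqE not_le)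
  next
    assume "s < t"
    then have "t \<notin> A" unfolding s_def using cSup_upper[OF _ bdd] by (metis not_le)
    with that show "y < T t" by (auto simp: A_def)
  qed
  with \<open>0 \<le> s\<close> that show ?thesis by blast
qed

text \<open>Identifies an event about the payment with the conditioning event
  \<open>\<tau> > s\<close>. For the value infinity the payment at time \<open>s + 1\<close>
  witnesses that the supremum exceeds \<open>y\<close>.\<close>

lemma pay_at_gt_iff:
  assumes "0 \<le> s" and lev: "\<And>t. 0 \<le> t \<Longrightarrow> y < T t \<longleftrightarrow> s < t"
  shows "ereal y < pay_at T x \<longleftrightarrow> ennreal s < x"
proof (cases x rule: ennreal_cases)
  case (real r)
  then show ?thesis using lev[of r] assms(1) by (simp add: pay_at_def ennreal_less_iff)
next
  case top
  have "ereal y < ereal (T (s + 1))" using lev[of "s + 1"] assms(1) by simp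
  also have "\<dots> \<le> (SUP t\<in>{0..}. ereal (T t))" using assms(1) by (intro SUP_upper) auto
  finally show ?thesis using top by (simp add: pay_at_def)
qed

lemma pay_at_le:
  assumes "\<And>t. 0 \<le> t \<Longrightarrow> T t \<le> y"
  shows "pay_at T x \<le> ereal y"
  using assms by (auto simp: pay_at_def intro!: SUP_least)

lemma pay_at_nonneg: "cum_payment T \<Longrightarrow> 0 \<le> pay_at T x"
proof -
  assume T: "cum_payment T"
  have "0 \<le> T t" if "0 \<le> t" for t
    using cum_payment_mono[OF T, of 0 t] cum_payment_0[OF T] that by simp
  then show ?thesis
    using SUP_upper[of 0 "{0..}" "\<lambda>t. ereal (T t)"] cum_payment_0[OF T]
    by (auto simp: pay_at_def zero_ereal_def)
qed

lemma pay_at_minus_gt_iff: "ereal y < pay_at T x - ereal c \<longleftrightarrow> ereal (c + y) < pay_at T x"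
  by (cases "pay_at T x") auto

definition survival :: "'a measure \<Rightarrow> ('a \<Rightarrow> ennreal) \<Rightarrow> (real \<Rightarrow> real) \<Rightarrow> real \<Rightarrow> real" where
  "survival M \<tau> T y = measure M {\<omega>\<in>space M. pay_at T (\<tau> \<omega>) > ereal y}"

context prob_space
begin

context
  fixes \<tau> :: "'a \<Rightarrow> ennreal" and T :: "real \<Rightarrow> real"
  assumes \<tau>_meas [measurable]: "\<tau> \<in> borel_measurable M" and T: "cum_payment T"
begin

lemma pay_event:
  assumes "0 \<le> y" "0 < survival M \<tau> T y"
  obtains s where "0 \<le> s" "\<And>t. 0 \<le> t \<Longrightarrow> y < T t \<longleftrightarrow> s < t"
proof (cases "\<forall>t\<ge>0. T t \<le> y")
  case True
  then have "{\<omega>\<in>space M. pay_at T (\<tau> \<omega>) > ereal y} = {}"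
    using pay_at_le[of T y] by (auto simp: not_less[symmetric])
  with assms show ?thesis by (simp add: survival_def)
next
  case False
  then obtain u where "0 \<le> u" "y < T u" by auto
  from cum_payment_level[OF T assms(1) this] that show ?thesis by blast
qed

text \<open>Depending on the level, the event is empty, of the form \<open>\<tau> > s\<close>, or
  the whole space.\<close>

lemma sets_pay_gt [measurable]: "{\<omega>\<in>space M. pay_at T (\<tau> \<omega>) > ereal y} \<in> sets M"
proof (cases "0 \<le> y")
  case True
  show ?thesis
  proof (cases "\<forall>t\<ge>0. T t \<le> y")
    case True
    then have "{\<omega>\<in>space M. pay_at T (\<tau> \<omega>) > ereal y} = {}"
      using pay_at_le[of T y] by (auto simp: not_less[symmetric])
    then show ?thesis by (simp only: sets.empty_sets)
  next
    case False
    then obtain u where "0 \<le> u" "y < T u" by auto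
    from cum_payment_level[OF T True this]
    obtain s where "0 \<le> s" "\<And>t. 0 \<le> t \<Longrightarrow> y < T t \<longleftrightarrow> s < t" by metis
    from pay_at_gt_iff[of s y T, OF this] have "{\<omega>\<in>space M. pay_at T (\<tau> \<omega>) > ereal y} = {\<omega>\<in>space M. ennreal s < \<tau> \<omega>}"
      by simp
    then show ?thesis by simp
  qed
next
  case False
  then have "ereal y < pay_at T x" for x
    using pay_at_nonneg[OF T, of x] by (auto intro: less_le_trans[of _ 0])
  then have "{\<omega>\<in>space M. pay_at T (\<tau> \<omega>) > ereal y} = space M" by auto
  then show ?thesis by simp
qed

lemma survival_nonneg: "0 \<le> survival M \<tau> T y" and survival_le_1: "survival M \<tau> T y \<le> 1"
  by (simp_all add: survival_def)

lemma survival_antimono: "antimono (survival M \<tau> T)"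
proof (rule antimonoI)
  fix x y :: real assume "x \<le> y"
  then show "survival M \<tau> T y \<le> survival M \<tau> T x"
    unfolding survival_def by (intro finite_measure_mono) (auto intro: le_less_trans[of "ereal x" "ereal y"])
qed

lemma borel_survival [measurable]: "survival M \<tau> T \<in> borel_measurable borel"
proof -
  have "mono (\<lambda>y. - survival M \<tau> T y)"
    using survival_antimono by (auto simp: mono_def antimono_def)
  then have "(\<lambda>y. - (- survival M \<tau> T y)) \<in> borel_measurable borel"
    by (intro borel_measurable_uminus borel_measurable_mono)
  then show ?thesis by simp
qed

text \<open>Continuity of the measure from below along \<open>y + 1 / (n + 1)\<close>, extended from
  this sequence to all right neighbourhoods by monotonicity.\<close>

lemma survival_right_cont: "continuous (at_right y) (survival M \<tau> T)"
proof -
  let ?A = "\<lambda>n. {\<omega>\<in>space M. pay_at T (\<tau> \<omega>) > ereal (y + inverse (real (Suc n)))}"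
  have un: "(\<Union>n. ?A n) = {\<omega>\<in>space M. pay_at T (\<tau> \<omega>) > ereal y}"
  proof safe
    fix n \<omega> assume "ereal (y + inverse (real (Suc n))) < pay_at T (\<tau> \<omega>)"
    then show "ereal y < pay_at T (\<tau> \<omega>)"
      by (rule le_less_trans[rotated]) simp
  next
    fix \<omega> assume "\<omega> \<in> space M" "ereal y < pay_at T (\<tau> \<omega>)"
    then obtain z where z: "ereal y < ereal z" "ereal z < pay_at T (\<tau> \<omega>)"
      using ereal_dense2 by blast
    then obtain n where "inverse (real (Suc n)) < z - y"
      using reals_Archimedean[of "z - y"] by auto
    then have "ereal (y + inverse (real (Suc n))) < pay_at T (\<tau> \<omega>)"
      using z(2) by (intro less_trans[OF _ z(2)]) simp
    with \<open>\<omega> \<in> space M\<close> show "\<omega> \<in> (\<Union>n. ?A n)" by blast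
  qed
  have "(\<lambda>n. measure M (?A n)) \<longlonglongrightarrow> measure M (\<Union>n. ?A n)"
  proof (rule finite_Lim_measure_incseq)
    show "incseq ?A"
    proof (rule incseq_SucI, safe)
      fix n \<omega> assume "ereal (y + inverse (real (Suc n))) < pay_at T (\<tau> \<omega>)"
      moreover have "y + inverse (real (Suc (Suc n))) \<le> y + inverse (real (Suc n))"
        by (simp add: field_simps)
      ultimately show "ereal (y + inverse (real (Suc (Suc n)))) < pay_at T (\<tau> \<omega>)"
        by (meson ereal_less_eq(3) le_less_trans)
    qed
  qed auto
  then have lim: "(\<lambda>n. survival M \<tau> T (y + inverse (real (Suc n)))) \<longlonglongrightarrow> survival M \<tau> T y"
    unfolding un survival_def .
  have "(survival M \<tau> T \<longlongrightarrow> survival M \<tau> T y) (at_right y)"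
  proof (rule order_tendstoI)
    fix a assume "a < survival M \<tau> T y"
    from order_tendstoD(1)[OF lim this] obtain n where n: "a < survival M \<tau> T (y + inverse (real (Suc n)))"
      by (auto simp: eventually_sequentially)
    have "\<forall>\<^sub>F x in at_right y. x \<in> {y<..<y + inverse (real (Suc n))}"
      by (rule eventually_at_right_real) simp
    then show "\<forall>\<^sub>F x in at_right y. a < survival M \<tau> T x"
      by eventually_elim (use n antimonoD[OF survival_antimono] in \<open>auto intro: less_le_trans\<close>)
  next
    fix a assume "survival M \<tau> T y < a"
    moreover have "\<forall>\<^sub>F x in at_right y. y < x" by (simp add: eventually_at_right_less)
    ultimately show "\<forall>\<^sub>F x in at_right y. survival M \<tau> T x < a"
      using antimonoD[OF survival_antimono, of y]
      by (elim eventually_mono) (meson less_imp_le order_le_less_trans)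
  qed
  then show ?thesis by (simp add: continuous_within)
qed

end

end

section \<open>DIR compatibility in terms of the survival function of payments\<close>

lemma nn_integral_shift_atLeast:
  fixes h :: "real \<Rightarrow> ennreal"
  assumes [measurable]: "h \<in> borel_measurable borel"
  shows "(\<integral>\<^sup>+y\<in>{0..}. h (c + y) \<partial>lborel) = (\<integral>\<^sup>+y\<in>{c..}. h y \<partial>lborel)"
proof -
  have "(\<integral>\<^sup>+y\<in>{c..}. h y \<partial>lborel) = ennreal \<bar>1\<bar> * (\<integral>\<^sup>+y. h (c + 1 * y) * indicator {c..} (c + 1 * y) \<partial>lborel)"
    by (rule nn_integral_real_affine) auto
  also have "\<dots> = (\<integral>\<^sup>+y\<in>{0..}. h (c + y) \<partial>lborel)"
    by (auto intro!: nn_integral_cong simp: indicator_def)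
  finally show ?thesis by simp
qed

lemma ennreal_mult_le_imp_le_divide:
  assumes "0 < (c :: real)" "ennreal c * x \<le> ennreal a" "0 \<le> a"
  shows "x \<le> ennreal (a / c)"
proof -
  have "x = ennreal (1 / c) * (ennreal c * x)"
    using assms(1) by (simp add: mult.assoc[symmetric] flip: ennreal_mult)
  also have "\<dots> \<le> ennreal (1 / c) * ennreal a" by (intro mult_left_mono assms(2)) simp
  also have "\<dots> = ennreal (a / c)" using assms by (simp flip: ennreal_mult)
  finally show ?thesis .
qed

lemma weighting_bounds:
  assumes "weighting w" "0 \<le> p" "p \<le> 1"
  shows "0 \<le> w p" "w p \<le> 1"
  using assms unfolding weighting_def by (auto simp: image_subset_iff)

context smooth_weight
begin

lemma phi_eq_0: "exp (- t) < p \<Longrightarrow> phi t p = 0"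
  using mult_strict_right_mono[of "exp (- t)" p "exp t"] by (simp add: phi_def exp_minus)

context
  fixes M :: "'a measure" and \<tau> :: "'a \<Rightarrow> ennreal" and T wp wm :: "real \<Rightarrow> real" and \<theta> lam :: real
  assumes M: "prob_space M" and \<tau>_meas [measurable]: "\<tau> \<in> borel_measurable M" and T: "cum_payment T"
    and wp: "weighting wp" and wm: "\<And>p. 0 \<le> p \<Longrightarrow> p \<le> 1 \<Longrightarrow> wm p = W p"
    and \<theta>: "0 < \<theta>" and lam: "0 < lam"
begin

interpretation prob_space M by (rule M)

abbreviation (input) "G \<equiv> survival M \<tau> T"

lemmas G_facts = survival_nonneg[OF \<tau>_meas T] survival_le_1[OF \<tau>_meas T]
lemmas G_anti = antimonoD[OF survival_antimono[OF \<tau>_meas T]]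
lemmas G_borel [measurable] = borel_survival[OF \<tau>_meas T]
lemmas G_sets [measurable] = sets_pay_gt[OF \<tau>_meas T]

text \<open>Apply the constraint at the last time \<open>s\<close> with \<open>T s \<le> y\<close>.
  There \<open>\<tau> > s\<close> is the event of a payment above \<open>y\<close>, and the payment
  still due is at least the excess over \<open>y\<close>. The value of the good is bounded using
  \<open>wp \<le> 1\<close>.\<close>

lemma DIR_imp_survival:
  assumes DIR: "DIR_compatible \<theta> lam wp wm M \<tau> T" and "0 \<le> y" and pos: "0 < G y"
  shows "(\<integral>\<^sup>+x\<in>{0..}. ennreal (W (G (y + x) / G y)) \<partial>lborel) \<le> ennreal (\<theta> / lam)"
proof -
  obtain s where s: "0 \<le> s" "\<And>t. 0 \<le> t \<Longrightarrow> y < T t \<longleftrightarrow> s < t"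
    using pay_event[OF \<tau>_meas T assms(2,3)] by blast
  let ?q = "measure M {\<omega>\<in>space M. \<tau> \<omega> > ennreal s}"
  let ?n = "\<lambda>x. measure M {\<omega>\<in>space M. \<tau> \<omega> > ennreal s \<and> pay_at T (\<tau> \<omega>) - ereal (T s) > ereal x}"
  let ?w = "measure M {\<omega>\<in>space M. \<tau> \<omega> > ennreal s \<and> \<tau> \<omega> < \<infinity>} / ?q"
  have q: "G y = ?q" unfolding survival_def using pay_at_gt_iff[of s y T, OF s] by simp
  have Ts: "T s \<le> y" using s(2)[of s] s(1) by simp
  have meas: "{\<omega>\<in>space M. \<tau> \<omega> > ennreal s \<and> ereal (T s + x) < pay_at T (\<tau> \<omega>)} \<in> sets M" for x
    using sets.Int[OF _ G_sets[of "T s + x"], of "{\<omega>\<in>space M. \<tau> \<omega> > ennreal s}"]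
    by (auto simp: Int_def conj_ac cong: conj_cong)
  have le: "ennreal (W (G (y + x) / G y)) \<le> ennreal (wm (?n x / ?q))" if "0 \<le> x" for x
  proof -
    have "{\<omega>\<in>space M. ereal (y + x) < pay_at T (\<tau> \<omega>)}
        \<subseteq> {\<omega>\<in>space M. \<tau> \<omega> > ennreal s \<and> pay_at T (\<tau> \<omega>) - ereal (T s) > ereal x}"
    proof safe
      fix \<omega> assume a: "ereal (y + x) < pay_at T (\<tau> \<omega>)"
      then have "ereal y < pay_at T (\<tau> \<omega>)" using that by (intro le_less_trans[OF _ a]) simp
      then show "ennreal s < \<tau> \<omega>" using pay_at_gt_iff[of s y T, OF s] by simp
      show "ereal x < pay_at T (\<tau> \<omega>) - ereal (T s)"
        unfolding pay_at_minus_gt_iff using Ts by (intro le_less_trans[OF _ a]) simp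
    qed
    then have 1: "G (y + x) \<le> ?n x"
      unfolding survival_def pay_at_minus_gt_iff by (intro finite_measure_mono meas)
    have 2: "?n x \<le> ?q" by (intro finite_measure_mono) auto
    have "wm (?n x / ?q) = W (?n x / ?q)"
      using 2 pos q by (intro wm) (auto simp: divide_le_eq_1)
    moreover have "W (G (y + x) / G y) \<le> W (?n x / ?q)"
      unfolding q using 1 pos q by (intro mono_W divide_right_mono) auto
    ultimately show ?thesis by (simp add: ennreal_leI)
  qed
  have "measure M {\<omega>\<in>space M. \<tau> \<omega> > ennreal s \<and> \<tau> \<omega> < \<infinity>} \<le> ?q" by (intro finite_measure_mono) auto
  then have "0 \<le> ?w" "?w \<le> 1" using pos q by (auto simp: divide_le_eq_1)
  note wp_bounds = weighting_bounds[OF wp this]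
  have "(\<integral>\<^sup>+x\<in>{0..}. ennreal (W (G (y + x) / G y)) \<partial>lborel) \<le> (\<integral>\<^sup>+x\<in>{0..}. ennreal (wm (?n x / ?q)) \<partial>lborel)"
    by (intro nn_integral_mono) (auto simp: indicator_def le)
  also have "\<dots> \<le> ennreal (\<theta> * wp ?w / lam)"
  proof (rule ennreal_mult_le_imp_le_divide[OF lam])
    show "ennreal lam * (\<integral>\<^sup>+x\<in>{0..}. ennreal (wm (?n x / ?q)) \<partial>lborel) \<le> ennreal (\<theta> * wp ?w)"
      using DIR s(1) pos unfolding DIR_compatible_def q by blast
    show "0 \<le> \<theta> * wp ?w" using \<theta> wp_bounds by simp
  qed
  also have "\<dots> \<le> ennreal (\<theta> / lam)"
    using wp_bounds \<theta> lam by (intro ennreal_leI divide_right_mono) (auto simp: mult_left_le)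
  finally show ?thesis .
qed

text \<open>Let \<open>c\<close> be the first level where \<open>G\<close> is at most
  \<open>exp (- t)\<close>, attained by right continuity. Below \<open>c\<close> the integrand is
  zero; above it \<open>exp t \<le> 1 / G c\<close> reduces the claim to the constraint conditional
  on exceeding \<open>c\<close>.\<close>

lemma DIR_imp_feasible:
  assumes DIR: "DIR_compatible \<theta> lam wp wm M \<tau> T"
  shows "(\<integral>\<^sup>+y\<in>{0..}. ennreal (phi t (G y)) \<partial>lborel) \<le> ennreal (\<theta> / lam)"
proof (cases "\<exists>y\<ge>0. G y \<le> exp (- t)")
  case False
  then have "ennreal (phi t (G y)) * indicator {0..} y = 0" for y
    by (auto simp: indicator_def not_le phi_eq_0)
  then show ?thesis by (simp only: nn_integral_const mult_zero_left) simp
next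
  case True
  define A where "A = {y. 0 \<le> y \<and> G y \<le> exp (- t)}"
  have A: "A \<noteq> {}" "bdd_below A" using True by (auto simp: A_def intro: bdd_belowI[of _ 0])
  define c where "c = Inf A"
  have "0 \<le> c" unfolding c_def using A by (intro cInf_greatest) (auto simp: A_def)
  have above: "G y \<le> exp (- t)" if y: "c < y" for y
  proof -
    obtain a where "a \<in> A" "a < y" using y cInf_less_iff[OF A, of y] unfolding c_def by auto
    then show ?thesis using G_anti[of a y] by (auto simp: A_def)
  qed
  have G_c: "G c \<le> exp (- t)"
  proof (rule tendsto_upperbound)
    show "(G \<longlongrightarrow> G c) (at_right c)"
      using survival_right_cont[OF \<tau>_meas T, of c] by (simp add: continuous_within)
    show "\<forall>\<^sub>F y in at_right c. G y \<le> exp (- t)"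
      using eventually_at_right_less[of c] by eventually_elim (rule above)
  qed simp
  have below: "\<not> G y \<le> exp (- t)" if "0 \<le> y" "y < c" for y
    using that cInf_lower[OF _ A(2), of y] unfolding c_def A_def by force
  have phi_below: "phi t (G y) = 0" if "0 \<le> y" "y < c" for y
    using below[OF that] by (simp add: phi_eq_0)
  show ?thesis
  proof (cases "G c = 0")
    case True
    have "G y = 0" if "c \<le> y" for y using G_anti[OF that] True G_facts(1)[of y] by simp
    then have "ennreal (phi t (G y)) * indicator {0..} y = 0" for y
      using phi_below[of y] by (cases "y < c") (auto simp: indicator_def)
    then show ?thesis by (simp only: nn_integral_const mult_zero_left) simp
  next
    case False
    then have pos: "0 < G c" using G_facts(1)[of c] by simp
    have "phi t (G y) \<le> W (G y / G c)" if "c \<le> y" for y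
    proof -
      have "exp t \<le> 1 / G c" using G_c pos by (simp add: exp_minus field_simps)
      then have "G y * exp t \<le> G y * (1 / G c)" by (intro mult_left_mono G_facts)
      then have "W (G y * exp t) \<le> W (G y / G c)" by (intro mono_W) simp
      moreover have "0 \<le> W (G y / G c)" using pos by (intro W_nonneg) (simp add: G_facts)
      ultimately show ?thesis by (simp add: phi_def)
    qed
    then have "(\<integral>\<^sup>+y\<in>{0..}. ennreal (phi t (G y)) \<partial>lborel) \<le> (\<integral>\<^sup>+y\<in>{c..}. ennreal (W (G y / G c)) \<partial>lborel)"
      using phi_below by (intro nn_integral_mono) (auto simp: indicator_def intro: ennreal_leI)
    also have "\<dots> = (\<integral>\<^sup>+x\<in>{0..}. ennreal (W (G (c + x) / G c)) \<partial>lborel)"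
      by (rule nn_integral_shift_atLeast[symmetric]) measurable
    also have "\<dots> \<le> ennreal (\<theta> / lam)" by (rule DIR_imp_survival[OF DIR \<open>0 \<le> c\<close> pos])
    finally show ?thesis .
  qed
qed

text \<open>At time \<open>s\<close> the relevant level is \<open>T s\<close>. A payment above
  \<open>T s\<close> forces \<open>\<tau> > s\<close>, so the conditional probabilities are at most
  \<open>G (T s + x) / G (T s)\<close>; the denominator may only be larger, as \<open>T\<close> can
  be flat after \<open>s\<close>. Finiteness of \<open>\<tau>\<close> makes the value term equal to
  \<open>\<theta>\<close>.\<close>

lemma feasible_imp_DIR:
  assumes fin: "measure M {\<omega>\<in>space M. \<tau> \<omega> < \<infinity>} = 1"
    and feas: "\<And>t. t \<in> {0..b} \<Longrightarrow> (\<integral>\<^sup>+y\<in>{0..}. ennreal (phi t (G y)) \<partial>lborel) \<le> ennreal (\<theta> / lam)"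
    and vals: "\<And>y. 0 \<le> y \<Longrightarrow> G y = 0 \<or> exp (- b) \<le> G y"
  shows "DIR_compatible \<theta> lam wp wm M \<tau> T"
  unfolding DIR_compatible_def
proof (intro allI impI)
  fix s :: real assume "0 \<le> s"
  let ?q = "measure M {\<omega>\<in>space M. \<tau> \<omega> > ennreal s}"
  let ?n = "\<lambda>x. measure M {\<omega>\<in>space M. \<tau> \<omega> > ennreal s \<and> pay_at T (\<tau> \<omega>) - ereal (T s) > ereal x}"
  assume q: "0 < ?q"
  have "AE \<omega> in M. \<tau> \<omega> < \<infinity>"
    using fin by (subst (asm) prob_Collect_eq_1) auto
  then have "measure M {\<omega>\<in>space M. \<tau> \<omega> > ennreal s \<and> \<tau> \<omega> < \<infinity>} = ?q"
    by (intro finite_measure_eq_AE) auto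
  then have w: "wp (measure M {\<omega>\<in>space M. \<tau> \<omega> > ennreal s \<and> \<tau> \<omega> < \<infinity>} / ?q) = 1"
    using q wp by (simp add: weighting_def)
  have Ts: "0 \<le> T s" using cum_payment_mono[OF T, of 0 s] cum_payment_0[OF T] \<open>0 \<le> s\<close> by simp
  have n_le: "?n x \<le> G (T s + x)" for x
    unfolding survival_def pay_at_minus_gt_iff by (intro finite_measure_mono G_sets) auto
  have n_le_q: "?n x \<le> ?q" for x by (intro finite_measure_mono) auto
  have q_ge: "G (T s) \<le> ?q"
    unfolding survival_def
  proof (intro finite_measure_mono subsetI CollectI conjI)
    fix \<omega> assume "\<omega> \<in> {\<omega>\<in>space M. pay_at T (\<tau> \<omega>) > ereal (T s)}"
    then show "\<omega> \<in> space M" "ennreal s < \<tau> \<omega>"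
      using cum_payment_mono[OF T, of "enn2real (\<tau> \<omega>)" s]
      by (auto simp: pay_at_def not_less[symmetric] split: if_splits)
        (metis enn2real_leI enn2real_nonneg leI not_less \<open>0 \<le> s\<close>)+
  qed auto
  have le: "(\<integral>\<^sup>+x\<in>{0..}. ennreal (wm (?n x / ?q)) \<partial>lborel) \<le> ennreal (\<theta> / lam)"
  proof (cases "G (T s) = 0")
    case True
    have "?n x = 0" if "0 \<le> x" for x
      using n_le[of x] G_anti[of "T s" "T s + x"] True that measure_nonneg[of M] by (smt (verit))
    then have "ennreal (wm (?n x / ?q)) * indicator {0..} x = 0" for x
      using wm[of 0] W_0 by (auto simp: indicator_def)
    then show ?thesis by (simp only: nn_integral_const mult_zero_left) simp
  next
    case False
    then have pos: "0 < G (T s)" using G_facts(1)[of "T s"] by simp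
    \<comment> \<open>With this \<open>t\<close> the ratio is \<open>G (T s + x) * exp t\<close>,
      and the restriction on the values of \<open>G\<close> places \<open>t\<close> in
      \<open>[0, b]\<close>, where feasibility is assumed.\<close>
    define t where "t = - ln (G (T s))"
    have G_t: "G (T s) = exp (- t)" using pos by (simp add: t_def)
    have "exp (- b) \<le> exp (- t)" using vals[OF Ts] False G_t by simp
    then have t: "t \<in> {0..b}" using G_facts(2)[of "T s"] by (simp add: G_t)
    have "ennreal (wm (?n x / ?q)) \<le> ennreal (phi t (G (T s + x)))" if "0 \<le> x" for x
    proof -
      have "wm (?n x / ?q) = W (?n x / ?q)"
        using n_le_q[of x] q by (intro wm) (auto simp: divide_le_eq_1)
      also have "\<dots> \<le> W (G (T s + x) * exp t)"
      proof (rule mono_W)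
        have "?n x / ?q \<le> G (T s + x) / G (T s)"
          using n_le[of x] q_ge pos by (intro frac_le) (auto simp: G_facts)
        then show "?n x / ?q \<le> G (T s + x) * exp t"
          unfolding G_t by (simp add: exp_minus divide_inverse)
      qed
      also have "\<dots> = phi t (G (T s + x))"
      proof -
        have "G (T s + x) * exp t \<le> exp (- t) * exp t"
          using G_anti[of "T s" "T s + x"] that unfolding G_t[symmetric] by (intro mult_right_mono) auto
        then show ?thesis by (simp add: phi_def exp_minus)
      qed
      finally show ?thesis by (rule ennreal_leI)
    qed
    then have "(\<integral>\<^sup>+x\<in>{0..}. ennreal (wm (?n x / ?q)) \<partial>lborel) \<le> (\<integral>\<^sup>+x\<in>{0..}. ennreal (phi t (G (T s + x))) \<partial>lborel)"
      by (intro nn_integral_mono) (auto simp: indicator_def)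
    also have "\<dots> = (\<integral>\<^sup>+y\<in>{T s..}. ennreal (phi t (G y)) \<partial>lborel)"
      by (rule nn_integral_shift_atLeast) measurable
    also have "\<dots> \<le> (\<integral>\<^sup>+y\<in>{0..}. ennreal (phi t (G y)) \<partial>lborel)"
      using Ts by (intro nn_integral_mono) (auto simp: indicator_def)
    also have "\<dots> \<le> ennreal (\<theta> / lam)" by (rule feas[OF t])
    finally show ?thesis .
  qed
  have "ennreal lam * (\<integral>\<^sup>+x\<in>{0..}. ennreal (wm (?n x / ?q)) \<partial>lborel) \<le> ennreal lam * ennreal (\<theta> / lam)"
    by (intro mult_left_mono le) simp
  also have "\<dots> = ennreal \<theta>" using lam \<theta> by (simp flip: ennreal_mult)
  finally show "ennreal lam * (\<integral>\<^sup>+x\<in>{0..}. ennreal (wm (?n x / ?q)) \<partial>lborel)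
      \<le> ennreal (\<theta> * wp (measure M {\<omega>\<in>space M. \<tau> \<omega> > ennreal s \<and> \<tau> \<omega> < \<infinity>} / ?q))"
    unfolding w by simp
qed

text \<open>Conditioning on \<open>\<tau> > 0\<close> can only raise the probabilities of positive
  payments, so the cost in the constraint at time \<open>0\<close> is at least
  \<open>\<theta>\<close>. Hence the weighted probability of delivery is 1, and strict monotonicity
  of \<open>wp\<close> makes the conditional probability itself 1.\<close>

lemma DIR_tight_imp_finite:
  assumes DIR: "DIR_compatible \<theta> lam wp wm M \<tau> T"
    and tight: "(\<integral>\<^sup>+y\<in>{0..}. ennreal (W (G y)) \<partial>lborel) = ennreal (\<theta> / lam)"
  shows "measure M {\<omega>\<in>space M. \<tau> \<omega> < \<infinity>} = 1"
proof -
  let ?q = "measure M {\<omega>\<in>space M. \<tau> \<omega> > ennreal 0}"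
  let ?r = "measure M {\<omega>\<in>space M. \<tau> \<omega> > ennreal 0 \<and> \<tau> \<omega> < \<infinity>}"
  let ?n = "\<lambda>x. measure M {\<omega>\<in>space M. \<tau> \<omega> > ennreal 0 \<and> pay_at T (\<tau> \<omega>) - ereal (T 0) > ereal x}"
  have T0: "T 0 = 0" by (rule cum_payment_0[OF T])
  have pay_pos: "0 < \<tau> \<omega>" if "ereal x < pay_at T (\<tau> \<omega>)" "0 \<le> x" for x \<omega>
  proof (rule ccontr)
    assume "\<not> 0 < \<tau> \<omega>"
    then have "\<tau> \<omega> = 0" by simp
    with that T0 show False by (simp add: pay_at_def)
  qed
  have n: "?n x = G x" if "0 \<le> x" for x
    unfolding survival_def pay_at_minus_gt_iff T0 using pay_pos[OF _ that]
    by (intro arg_cong[where f = "measure M"]) auto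
  have G_le: "G x \<le> ?q" if "0 \<le> x" for x
    unfolding n[OF that, symmetric] by (intro finite_measure_mono) auto
  have q: "0 < ?q"
  proof (rule ccontr)
    assume "\<not> 0 < ?q"
    then have "?q = 0" by (simp add: zero_less_measure_iff)
    then have "G y = 0" if "0 \<le> y" for y using G_le[OF that] G_facts(1)[of y] by simp
    then have "ennreal (W (G y)) * indicator {0..} y = 0" for y by (auto simp: indicator_def W_0)
    then have "(\<integral>\<^sup>+y\<in>{0..}. ennreal (W (G y)) \<partial>lborel) = 0" by (simp only: nn_integral_const mult_zero_left)
    with tight \<theta> lam show False by simp
  qed
  have "W (G x) \<le> wm (?n x / ?q)" if "0 \<le> x" for x
  proof -
    have "G x \<le> G x / ?q" using q G_facts(1)[of x] by (simp add: le_divide_eq mult_left_le)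
    moreover have "wm (?n x / ?q) = W (G x / ?q)"
      unfolding n[OF that] using q G_le[OF that] G_facts(1)[of x] by (intro wm) (auto simp: divide_le_eq_1)
    ultimately show ?thesis by (simp add: mono_W)
  qed
  then have "ennreal (\<theta> / lam) \<le> (\<integral>\<^sup>+x\<in>{0..}. ennreal (wm (?n x / ?q)) \<partial>lborel)"
    unfolding tight[symmetric] by (intro nn_integral_mono) (auto simp: indicator_def intro: ennreal_leI)
  then have "ennreal lam * ennreal (\<theta> / lam) \<le> ennreal lam * (\<integral>\<^sup>+x\<in>{0..}. ennreal (wm (?n x / ?q)) \<partial>lborel)"
    by (rule mult_left_mono) simp
  also have "\<dots> \<le> ennreal (\<theta> * wp (?r / ?q))"
    by (rule DIR[unfolded DIR_compatible_def, rule_format, OF order_refl q])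
  also have "ennreal lam * ennreal (\<theta> / lam) = ennreal \<theta>" using lam \<theta> by (simp flip: ennreal_mult)
  finally have "ennreal \<theta> \<le> ennreal (\<theta> * wp (?r / ?q))" .
  then have "\<theta> \<le> \<theta> * wp (?r / ?q)" using \<theta> by (subst (asm) ennreal_le_iff2) auto
  then have "1 \<le> wp (?r / ?q)" using \<theta> by simp
  have "?r \<le> ?q" by (intro finite_measure_mono) auto
  then have ratio: "?r / ?q \<in> {0..1}" using q by (auto simp: divide_le_eq_1)
  have "?r / ?q = 1"
  proof (rule ccontr)
    assume "?r / ?q \<noteq> 1"
    with ratio have lt: "?r / ?q < 1" by (simp only: atLeastAtMost_iff order_less_le simp_thms)
    have "strict_mono_on {0..1} wp" using wp by (simp add: weighting_def)
    then have "wp (?r / ?q) < wp 1" by (rule strict_mono_onD) (use ratio lt in simp_all)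
    with \<open>1 \<le> wp (?r / ?q)\<close> wp show False by (simp add: weighting_def)
  qed
  then have "?r = ?q" using q by simp
  moreover have "{\<omega>\<in>space M. \<tau> \<omega> > ennreal 0} = {\<omega>\<in>space M. \<tau> \<omega> > ennreal 0 \<and> \<tau> \<omega> < \<infinity>} \<union> {\<omega>\<in>space M. \<tau> \<omega> = \<infinity>}"
    by (auto simp: less_top)
  then have "?q = ?r + measure M {\<omega>\<in>space M. \<tau> \<omega> = \<infinity>}"
    by (simp only:) (intro finite_measure_Union, auto)
  ultimately have "measure M {\<omega>\<in>space M. \<tau> \<omega> = \<infinity>} = 0" by simp
  moreover have "{\<omega>\<in>space M. \<tau> \<omega> < \<infinity>} = space M - {\<omega>\<in>space M. \<tau> \<omega> = \<infinity>}"
    by (auto simp: less_top)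
  ultimately show ?thesis by (simp add: prob_compl)
qed

end

end

section \<open>Optimal pricing\<close>

lemma integral_cong_AE_lborel:
  fixes f h :: "real \<Rightarrow> real"
  assumes "AE x in lborel. x \<in> A \<longrightarrow> f x = h x" "S \<subseteq> A"
  shows "integral S f = integral S h"
proof -
  from assms(1) obtain N where N: "{x \<in> space lborel. \<not> (x \<in> A \<longrightarrow> f x = h x)} \<subseteq> N" "emeasure lborel N = 0" "N \<in> sets lborel"
    by (rule AE_E)
  then have "N \<in> null_sets (completion lborel)"
    by (intro null_sets_completionI) auto
  then have "negligible N" by (simp add: negligible_iff_null_sets)
  then show ?thesis
    by (rule integral_spike) (use N(1) assms(2) in auto)
qed

lemma cum_payment_density_then_jump:
  fixes h :: "real \<Rightarrow> real"
  assumes h: "h integrable_on {0..b}" "\<And>t. 0 \<le> h t" and "0 \<le> K" "0 \<le> b"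
    and T: "\<And>t. 0 \<le> t \<Longrightarrow> T t = K * ((if b < t then 1 else 0) + integral {0..min t b} h)"
  shows "cum_payment T"
proof -
  define f where "f s = (if s \<in> {0..b} then K * h s else 0)" for s
  \<comment> \<open>The definition asks for a whole sequence of jumps: index \<open>0\<close>
    carries the jump at \<open>b\<close>, and the others are jumps of size zero at the same
    time.\<close>
  define J where "J i = (if i = 0 then K else 0)" for i :: nat
  have f_int: "f integrable_on {0..}"
    unfolding f_def using integrable_cmul[OF h(1), of K]
    by (subst integrable_restrict_Int) (simp add: Int_absorb2)
  have f_integral: "integral {0..t} f = K * integral {0..min t b} h" for t
  proof -
    have "{0..b} \<inter> {0..t} = {0..min t b}" by auto
    then show ?thesis unfolding f_def by (simp only: Henstock_Kurzweil_Integration.integral_restrict_Int) simp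
  qed
  have jump_sum: "(\<Sum>i. if b < t then J i else 0) = (if b < t then K else 0)" for t
    by (subst suminf_finite[of "{0}"]) (auto simp: J_def)
  have jump_summable: "summable (\<lambda>i. if b < t then J i else 0)" for t
    by (rule summable_finite[of "{0}"]) (auto simp: J_def)
  have f_nonneg: "0 \<le> f s" for s
    using h(2) \<open>0 \<le> K\<close> by (simp add: f_def)
  have "f absolutely_integrable_on {0..}"
    using f_int f_nonneg by (rule nonnegative_absolutely_integrable_1)
  moreover have "\<forall>t\<ge>0. summable (\<lambda>i. if b < t then J i else 0) \<and>
      T t = integral {0..t} f + (\<Sum>i. if b < t then J i else 0)"
    unfolding jump_sum f_integral by (auto simp: T jump_summable algebra_simps)
  moreover have "incseq (\<lambda>_::nat. b)" "\<forall>i. 0 \<le> b \<and> 0 \<le> J i"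
    using assms(3,4) by (auto simp: J_def)
  ultimately show ?thesis
    unfolding cum_payment_def using f_nonneg by blast
qed

lemma exponential_is_stopping_time:
  assumes "prob_space M" and [measurable]: "\<tau> \<in> borel_measurable M"
    and exp: "\<And>t. 0 \<le> t \<Longrightarrow> measure M {\<omega>\<in>space M. \<tau> \<omega> > ennreal t} = exp (- t)"
  shows "is_stopping_time M \<tau>"
proof -
  interpret prob_space M by fact
  have cdf: "measure M {\<omega>\<in>space M. \<tau> \<omega> \<le> ennreal t} = 1 - exp (- t)" if "0 \<le> t" for t
    using prob_neg[of "\<lambda>\<omega>. \<tau> \<omega> > ennreal t"] exp[OF that] by (simp add: not_less)
  have int: "integral {0..t} (\<lambda>s. exp (- s)) = 1 - exp (- t)" if "0 \<le> t" for t :: real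
  proof -
    have "((\<lambda>s. exp (- s)) has_integral (- exp (- t) - - exp (- 0))) {0..t}"
      using that
      by (intro fundamental_theorem_of_calculus)
         (auto intro!: derivative_eq_intros simp flip: has_real_derivative_iff_has_vector_derivative)
    then show ?thesis by (simp add: integral_unique)
  qed
  have "(\<lambda>s::real. exp (- s)) integrable_on {0..}"
    using integrable_on_exp_minus_to_infinity[of 1 0] by simp
  then have "(\<lambda>s::real. exp (- s)) absolutely_integrable_on {0..}"
    by (intro nonnegative_absolutely_integrable_1) auto
  then show ?thesis
    unfolding is_stopping_time_def
    by (intro conjI assms(2) exI[of _ 0] exI[of _ "\<lambda>s. exp (- s)"] exI[of _ "\<lambda>_. 0"])
       (auto simp: cdf int)
qed

lemma exponential_finite:
  assumes "prob_space M" and [measurable]: "\<tau> \<in> borel_measurable M"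
    and exp: "\<And>t. 0 \<le> t \<Longrightarrow> measure M {\<omega>\<in>space M. \<tau> \<omega> > ennreal t} = exp (- t)"
  shows "measure M {\<omega>\<in>space M. \<tau> \<omega> < \<infinity>} = 1"
proof -
  interpret prob_space M by fact
  have "measure M {\<omega>\<in>space M. \<tau> \<omega> = \<infinity>} \<le> exp (- t)" if "0 \<le> t" for t
    unfolding exp[OF that, symmetric] by (intro finite_measure_mono) auto
  then have "\<forall>\<^sub>F t in at_top. measure M {\<omega>\<in>space M. \<tau> \<omega> = \<infinity>} \<le> exp (- t)"
    unfolding eventually_at_top_linorder by blast
  moreover have "((\<lambda>t::real. exp (- t)) \<longlongrightarrow> 0) at_top"
    by (rule filterlim_compose[OF exp_at_bot filterlim_uminus_at_bot_at_top])
  ultimately have "measure M {\<omega>\<in>space M. \<tau> \<omega> = \<infinity>} \<le> 0"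
    by (intro tendsto_lowerbound[where F = at_top]) auto
  then have "measure M {\<omega>\<in>space M. \<tau> \<omega> = \<infinity>} = 0" using measure_nonneg[of M] by (metis antisym)
  then show ?thesis
    using prob_neg[of "\<lambda>\<omega>. \<tau> \<omega> = \<infinity>"] by (simp add: less_top[symmetric])
qed

text \<open>Here \<open>h\<close> is an everywhere nonnegative Borel version of the payment density,
  and \<open>T0\<close> depends on it only through integrals. Its resolvent equation makes the
  constraints on \<open>[0, b]\<close> tight, so \<open>T0\<close> attains the dual value and fixes
  the survival function of every optimal process.\<close>

lemma (in volterra_dual) optimality_characterization:
  fixes M :: "'a measure" and \<tau>0 :: "'a \<Rightarrow> ennreal" and wp wm T0 h :: "real \<Rightarrow> real" and \<theta> lam :: real
  assumes M: "prob_space M" and \<theta>: "0 < \<theta>" and lam: "0 < lam"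
    and wp: "weighting wp" and wm: "\<And>p. 0 \<le> p \<Longrightarrow> p \<le> 1 \<Longrightarrow> wm p = W p"
    and \<tau>0_meas [measurable]: "\<tau>0 \<in> borel_measurable M"
    and \<tau>0_exp: "\<And>t. 0 \<le> t \<Longrightarrow> measure M {\<omega>\<in>space M. \<tau>0 \<omega> > ennreal t} = exp (- t)"
    and h_borel [measurable]: "h \<in> borel_measurable borel" and h_nonneg: "\<And>t. 0 \<le> h t"
    and h_fin: "(\<integral>\<^sup>+t\<in>{0..b}. ennreal (h t) \<partial>lborel) < \<infinity>"
    and h_eq: "\<And>t. t \<in> {0..b} \<Longrightarrow> ennreal (h t) = ennreal (kern (b - t)) +
       (\<integral>\<^sup>+s\<in>{t..b}. ennreal (kern (s - t)) * ennreal (h s) \<partial>lborel)"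
    and T0: "\<And>t. 0 \<le> t \<Longrightarrow> T0 t = \<theta> / lam * ((if b < t then 1 else 0) + integral {0..min t b} h)"
  shows "optimal \<theta> lam wp wm M \<tau>0 T0 \<and>
         (\<forall>\<tau> T. dyn_pricing M \<tau> T \<longrightarrow>
            (optimal \<theta> lam wp wm M \<tau> T \<longleftrightarrow>
               measure M {\<omega>\<in>space M. \<tau> \<omega> < \<infinity>} = 1 \<and>
               (\<forall>y\<ge>0. measure M {\<omega>\<in>space M. pay_at T (\<tau> \<omega>) \<le> ereal y}
                      = measure M {\<omega>\<in>space M. pay_at T0 (\<tau>0 \<omega>) \<le> ereal y})))"
proof -
  interpret prob_space M by fact
  define K where "K = \<theta> / lam"
  have K: "0 < K" using \<theta> lam by (simp add: K_def)
  define H where "H t = integral {0..t} h" for t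
  have h_int: "h integrable_on {0..b}"
  proof -
    obtain r where "0 \<le> r" "(\<integral>\<^sup>+t\<in>{0..b}. ennreal (h t) \<partial>lborel) = ennreal r"
      using h_fin by (cases "\<integral>\<^sup>+t\<in>{0..b}. ennreal (h t) \<partial>lborel" rule: ennreal_cases) auto
    then have "(h has_integral r) {0..b}"
      by (intro has_integral_set_nn_integral) (auto simp: h_nonneg)
    then show ?thesis by blast
  qed
  have h_tail: "(\<integral>\<^sup>+s\<in>{t..b}. ennreal (h s) \<partial>lborel) = ennreal (H b - H t)" "H t \<le> H b" if t: "t \<in> {0..b}" for t
  proof -
    have int_t: "h integrable_on {t..b}" using t by (intro integrable_on_subinterval[OF h_int]) auto
    have split: "H t + integral {t..b} h = H b"
      unfolding H_def using t by (intro Henstock_Kurzweil_Integration.integral_combine h_int) auto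
    have "0 \<le> integral {t..b} h" by (intro integral_nonneg int_t h_nonneg)
    with split show "H t \<le> H b" by simp
    have "(\<integral>\<^sup>+s\<in>{t..b}. ennreal (h s) \<partial>lborel) \<le> (\<integral>\<^sup>+s\<in>{0..b}. ennreal (h s) \<partial>lborel)"
      using t by (intro nn_integral_mono) (auto simp: indicator_def)
    with h_fin obtain r where r: "0 \<le> r" "(\<integral>\<^sup>+s\<in>{t..b}. ennreal (h s) \<partial>lborel) = ennreal r"
      by (cases "\<integral>\<^sup>+s\<in>{t..b}. ennreal (h s) \<partial>lborel" rule: ennreal_cases) (auto simp: top_unique)
    then have "(h has_integral r) {t..b}"
      by (intro has_integral_set_nn_integral) (auto simp: h_nonneg)
    with split have "r = H b - H t" by (simp add: integral_unique)
    with r(2) show "(\<integral>\<^sup>+s\<in>{t..b}. ennreal (h s) \<partial>lborel) = ennreal (H b - H t)" by simp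
  qed
  \<comment> \<open>The total payment, reached immediately after the jump at
    \<open>b\<close>.\<close>
  define D where "D = K * (1 + H b)"
  have T0_le: "T0 t = K * H t" if "t \<in> {0..b}" for t
    using that T0[of t] by (simp add: K_def H_def min_absorb1)
  have T0_gt: "T0 t = D" if "b < t" for t
    using that T0[of t] b_pos by (simp add: K_def H_def D_def min_absorb2)
  have T0_cum: "cum_payment T0"
    by (rule cum_payment_density_then_jump[OF h_int h_nonneg, of K]) (use T0 K b_pos in \<open>auto simp: K_def\<close>)
  have T0_le_D: "T0 t \<le> D" if "0 \<le> t" for t
    using that T0_gt[of t] T0_le[of t] h_tail(2)[of t] K by (cases "b < t") (auto simp: D_def)
  have dyn0: "dyn_pricing M \<tau>0 T0"
    using exponential_is_stopping_time[OF M \<tau>0_meas \<tau>0_exp] T0_cum by (simp add: dyn_pricing_def)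
  define G0 where "G0 = survival M \<tau>0 T0"
  have G0_01: "0 \<le> G0 y \<and> G0 y \<le> 1" for y
    unfolding G0_def using survival_nonneg[OF \<tau>0_meas T0_cum] survival_le_1[OF \<tau>0_meas T0_cum] by simp
  have G0_borel [measurable]: "G0 \<in> borel_measurable borel"
    unfolding G0_def by (rule borel_survival[OF \<tau>0_meas T0_cum])
  have G0_high: "G0 y = 0" if "D \<le> y" for y
  proof -
    have "pay_at T0 (\<tau>0 \<omega>) \<le> ereal y" for \<omega>
      using that by (intro pay_at_le) (auto intro: order_trans[OF T0_le_D])
    then have "{\<omega>\<in>space M. pay_at T0 (\<tau>0 \<omega>) > ereal y} = {}" by (auto simp: not_less[symmetric])
    then show ?thesis by (simp only: G0_def survival_def measure_empty)
  qed
  have G0_low: "\<exists>s. 0 \<le> s \<and> s \<le> b \<and> G0 y = exp (- s) \<and> (\<forall>t\<ge>0. y < T0 t \<longleftrightarrow> s < t)" if y: "0 \<le> y" "y < D" for y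
  proof -
    have "y < T0 (b + 1)" using T0_gt[of "b + 1"] y by simp
    then obtain s where s: "0 \<le> s" "\<And>t. 0 \<le> t \<Longrightarrow> y < T0 t \<longleftrightarrow> s < t"
      using cum_payment_level[OF T0_cum y(1), of "b + 1"] b_pos by (metis add_nonneg_nonneg less_imp_le zero_le_one)
    have "s \<le> b"
    \<comment> \<open>The payment jumps only after time \<open>b\<close>, so the level
      \<open>y\<close> is known to be exceeded at \<open>b + e\<close> but possibly not at
      \<open>b\<close>.\<close>
    proof (rule field_le_epsilon)
      fix e :: real assume "0 < e"
      then show "s \<le> b + e" using s(2)[of "b + e"] T0_gt[of "b + e"] y b_pos by simp
    qed
    moreover have "G0 y = exp (- s)"
      unfolding G0_def survival_def using pay_at_gt_iff[of s y T0, OF s] \<tau>0_exp[OF s(1)] by simp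
    ultimately show ?thesis using s by blast
  qed
  have vals0: "G0 y = 0 \<or> exp (- b) \<le> G0 y" if "0 \<le> y" for y
    using G0_high[of y] G0_low[OF that] by (cases "y < D") auto
  \<comment> \<open>As \<open>G0 y\<close> is \<open>exp (- s)\<close> for the crossing time
    \<open>s\<close> of level \<open>y\<close>, the level set is the interval from
    \<open>T0 t\<close> to \<open>D\<close>.\<close>
  have level0: "level_length G0 t = ennreal K * (1 + (\<integral>\<^sup>+s\<in>{t..b}. ennreal (h s) \<partial>lborel))" if t: "t \<in> {0..b}" for t
  proof -
    have T0_t: "0 \<le> T0 t" "T0 t \<le> D"
      using cum_payment_mono[OF T0_cum, of 0 t] cum_payment_0[OF T0_cum] T0_le_D[of t] t by auto
    have "of_bool (0 \<le> y \<and> 0 < G0 y \<and> G0 y \<le> exp (- t)) = (indicator {T0 t..<D} y :: ennreal)" for y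
    proof (cases "0 \<le> y \<and> y < D")
      case True
      then obtain s where "G0 y = exp (- s)" "y < T0 t \<longleftrightarrow> s < t" using G0_low[of y] t by auto
      with True show ?thesis by (auto simp: indicator_def not_less)
    next
      case False
      then show ?thesis using G0_high[of y] T0_t by (auto simp: indicator_def)
    qed
    then have "level_length G0 t = ennreal (D - T0 t)"
      unfolding level_length_def using T0_t by simp
    also have "D - T0 t = K * (1 + (H b - H t))"
      unfolding T0_le[OF t] D_def by (simp add: algebra_simps)
    also have "ennreal \<dots> = ennreal K * (1 + ennreal (H b - H t))"
      using K h_tail(2)[OF t] by (simp add: ennreal_mult' ennreal_plus[symmetric] del: ennreal_plus flip: ennreal_1)
    finally show ?thesis using h_tail(1)[OF t] by simp
  qed
  \<comment> \<open>The resolvent equation and the general Volterra equation for level lengths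
    differ only in their free terms; cancelling the finite integral equates these.\<close>
  have feas0: "(\<integral>\<^sup>+y\<in>{0..}. ennreal (phi t (G0 y)) \<partial>lborel) = ennreal K" if t: "t \<in> {0..b}" for t
  proof -
    let ?k = "\<integral>\<^sup>+r\<in>{t..b}. ennreal (kern (r - t)) * level_length G0 r \<partial>lborel"
    have "?k = (\<integral>\<^sup>+r. ennreal K * (ennreal (kern (r - t)) * (1 + (\<integral>\<^sup>+s\<in>{r..b}. ennreal (h s) \<partial>lborel)) * indicator {t..b} r) \<partial>lborel)"
      apply (intro nn_integral_cong)
      subgoal for r
        using t level0[of r] by (cases "r \<in> {t..b}") (auto simp: mult_ac)
      done
    also have "\<dots> = ennreal K * (\<integral>\<^sup>+r\<in>{t..b}. ennreal (kern (r - t)) * (1 + (\<integral>\<^sup>+s\<in>{r..b}. ennreal (h s) \<partial>lborel)) \<partial>lborel)"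
    proof (rule nn_integral_cmult)
      have "(\<lambda>r. \<integral>\<^sup>+s. ennreal (h s) * of_bool (r \<le> s \<and> s \<le> b) \<partial>lborel) \<in> borel_measurable lborel" by measurable
      also have "(\<lambda>r. \<integral>\<^sup>+s. ennreal (h s) * of_bool (r \<le> s \<and> s \<le> b) \<partial>lborel) = (\<lambda>r. \<integral>\<^sup>+s\<in>{r..b}. ennreal (h s) \<partial>lborel)"
        by (auto simp: indicator_def intro!: nn_integral_cong)
      finally have [measurable]: "(\<lambda>r. \<integral>\<^sup>+s\<in>{r..b}. ennreal (h s) \<partial>lborel) \<in> borel_measurable lborel" .
      show "(\<lambda>r. ennreal (kern (r - t)) * (1 + (\<integral>\<^sup>+s\<in>{r..b}. ennreal (h s) \<partial>lborel)) * indicator {t..b} r) \<in> borel_measurable lborel"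
        by measurable
    qed
    finally have k_eq: "?k = ennreal K * (\<integral>\<^sup>+r\<in>{t..b}. ennreal (kern (r - t)) * (1 + (\<integral>\<^sup>+s\<in>{r..b}. ennreal (h s) \<partial>lborel)) \<partial>lborel)" .
    have k_level: "ennreal K + ?k = level_length G0 t"
      unfolding k_eq level0[OF t]
      by (subst resolvent_tail(2)[OF h_borel h_eq t]) (simp_all only: distrib_left mult_1_right)
    also have "\<dots> = (\<integral>\<^sup>+y\<in>{0..}. ennreal (phi t (G0 y)) \<partial>lborel) + ?k"
      by (rule level_length_volterra) (use G0_01 vals0 t in auto)
    finally have eq: "?k + ennreal K = ?k + (\<integral>\<^sup>+y\<in>{0..}. ennreal (phi t (G0 y)) \<partial>lborel)"
      by (simp only: add.commute)
    have "level_length G0 t < \<infinity>"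
      unfolding level0[OF t] h_tail(1)[OF t] by (simp add: ennreal_mult_less_top)
    with k_level have "?k \<noteq> \<infinity>" by auto
    with eq show ?thesis by (simp only: ennreal_add_left_cancel) auto
  qed
  have value0: "(\<integral>\<^sup>+y\<in>{0..}. ennreal (G0 y) \<partial>lborel) = dual_value K"
    by (rule strong_duality) (use G0_01 feas0 vals0 in auto)
  have revenue: "revenue M \<tau> T = (\<integral>\<^sup>+y\<in>{0..}. ennreal (survival M \<tau> T y) \<partial>lborel)" for \<tau> T
    by (simp add: revenue_def survival_def)
  have dyn: "\<tau> \<in> borel_measurable M" "cum_payment T" if "dyn_pricing M \<tau> T" for \<tau> T
    using that by (auto simp: dyn_pricing_def is_stopping_time_def)
  have feas: "(\<integral>\<^sup>+y\<in>{0..}. ennreal (phi t (survival M \<tau> T y)) \<partial>lborel) \<le> ennreal K"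
    if "dyn_pricing M \<tau> T" "DIR_compatible \<theta> lam wp wm M \<tau> T" for \<tau> T t
    unfolding K_def by (rule DIR_imp_feasible[OF M dyn[OF that(1)] wp wm \<theta> lam that(2)])
  have rev_le: "revenue M \<tau> T \<le> dual_value K"
    if "dyn_pricing M \<tau> T" "DIR_compatible \<theta> lam wp wm M \<tau> T" for \<tau> T
    unfolding revenue using survival_nonneg[OF dyn[OF that(1)]] survival_le_1[OF dyn[OF that(1)]]
    by (intro weak_duality borel_survival dyn[OF that(1)] feas that) auto
  \<comment> \<open>Revenue and, given finiteness of \<open>\<tau>\<close>, the feasibility
    criterion depend only on the survival function. This serves both for the given pair and for the
    sufficient direction.\<close>
  have optI: "optimal \<theta> lam wp wm M \<tau> T"
    if d: "dyn_pricing M \<tau> T" and fin: "measure M {\<omega>\<in>space M. \<tau> \<omega> < \<infinity>} = 1"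
      and eq: "\<And>y. 0 \<le> y \<Longrightarrow> survival M \<tau> T y = G0 y" for \<tau> T
  proof -
    have int_eq: "(\<integral>\<^sup>+y\<in>{0..}. ennreal (u (survival M \<tau> T y)) \<partial>lborel) = (\<integral>\<^sup>+y\<in>{0..}. ennreal (u (G0 y)) \<partial>lborel)" for u
      by (intro nn_integral_cong) (auto simp: indicator_def eq)
    have "DIR_compatible \<theta> lam wp wm M \<tau> T"
    proof (rule feasible_imp_DIR[OF M dyn[OF d] wp wm \<theta> lam fin])
      show "(\<integral>\<^sup>+y\<in>{0..}. ennreal (phi t (survival M \<tau> T y)) \<partial>lborel) \<le> ennreal (\<theta> / lam)" if "t \<in> {0..b}" for t
        unfolding int_eq feas0[OF that] K_def by simp
      show "survival M \<tau> T y = 0 \<or> exp (- b) \<le> survival M \<tau> T y" if "0 \<le> y" for y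
        unfolding eq[OF that] by (rule vals0[OF that])
    qed
    moreover have "revenue M \<tau> T = dual_value K"
      unfolding revenue value0[symmetric] by (rule int_eq)
    ultimately show ?thesis unfolding optimal_def using d rev_le by auto
  qed
  have opt0: "optimal \<theta> lam wp wm M \<tau>0 T0"
    by (rule optI[OF dyn0 exponential_finite[OF M \<tau>0_meas \<tau>0_exp]]) (auto simp: G0_def)
  have cdf: "measure M {\<omega>\<in>space M. pay_at T (\<tau> \<omega>) \<le> ereal y} = 1 - survival M \<tau> T y"
    if "dyn_pricing M \<tau> T" for \<tau> T y
    using prob_neg[OF sets_pay_gt[OF dyn[OF that]], of y] by (simp add: survival_def not_less)
  have "optimal \<theta> lam wp wm M \<tau> T \<longleftrightarrow> measure M {\<omega>\<in>space M. \<tau> \<omega> < \<infinity>} = 1 \<and>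
      (\<forall>y\<ge>0. measure M {\<omega>\<in>space M. pay_at T (\<tau> \<omega>) \<le> ereal y} = measure M {\<omega>\<in>space M. pay_at T0 (\<tau>0 \<omega>) \<le> ereal y})"
    if d: "dyn_pricing M \<tau> T" for \<tau> T
  proof
    assume opt: "optimal \<theta> lam wp wm M \<tau> T"
    then have DIR: "DIR_compatible \<theta> lam wp wm M \<tau> T" and "revenue M \<tau>0 T0 \<le> revenue M \<tau> T"
      using opt0 by (auto simp: optimal_def)
    then have ge: "dual_value K \<le> (\<integral>\<^sup>+y\<in>{0..}. ennreal (survival M \<tau> T y) \<partial>lborel)"
      using value0 by (simp add: revenue G0_def)
    have eq: "survival M \<tau> T y = G0 y" if "0 \<le> y" for y
    proof (rule optimal_survival_unique[where K = K and ?G1.0 = "survival M \<tau> T" and ?G2.0 = G0])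
      show "antimono (survival M \<tau> T)" by (rule survival_antimono[OF dyn[OF d]])
      show "antimono G0" unfolding G0_def by (rule survival_antimono[OF \<tau>0_meas T0_cum])
      show "continuous (at_right x) (survival M \<tau> T)" for x
        by (rule survival_right_cont[OF dyn[OF d]])
      show "continuous (at_right x) G0" for x
        unfolding G0_def by (rule survival_right_cont[OF \<tau>0_meas T0_cum])
      show "survival M \<tau> T \<in> borel_measurable borel" by (rule borel_survival[OF dyn[OF d]])
    qed (use that ge value0 feas0 feas[OF d DIR] G0_01 survival_nonneg[OF dyn[OF d]] survival_le_1[OF dyn[OF d]] in auto)
    have "(\<integral>\<^sup>+y\<in>{0..}. ennreal (W (survival M \<tau> T y)) \<partial>lborel) = (\<integral>\<^sup>+y\<in>{0..}. ennreal (phi 0 (G0 y)) \<partial>lborel)"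
      by (intro nn_integral_cong) (auto simp: indicator_def eq phi_0_left G0_01)
    also have "\<dots> = ennreal (\<theta> / lam)" using feas0[of 0] b_pos by (simp add: K_def)
    finally have tight: "(\<integral>\<^sup>+y\<in>{0..}. ennreal (W (survival M \<tau> T y)) \<partial>lborel) = ennreal (\<theta> / lam)" .
    have "measure M {\<omega>\<in>space M. \<tau> \<omega> < \<infinity>} = 1"
      by (rule DIR_tight_imp_finite[OF M dyn[OF d] wp wm \<theta> lam DIR tight])
    then show "measure M {\<omega>\<in>space M. \<tau> \<omega> < \<infinity>} = 1 \<and>
      (\<forall>y\<ge>0. measure M {\<omega>\<in>space M. pay_at T (\<tau> \<omega>) \<le> ereal y} = measure M {\<omega>\<in>space M. pay_at T0 (\<tau>0 \<omega>) \<le> ereal y})"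
      using eq by (simp add: cdf[OF d] cdf[OF dyn0] G0_def)
  next
    assume "measure M {\<omega>\<in>space M. \<tau> \<omega> < \<infinity>} = 1 \<and>
      (\<forall>y\<ge>0. measure M {\<omega>\<in>space M. pay_at T (\<tau> \<omega>) \<le> ereal y} = measure M {\<omega>\<in>space M. pay_at T0 (\<tau>0 \<omega>) \<le> ereal y})"
    then show "optimal \<theta> lam wp wm M \<tau> T"
      by (intro optI d) (auto simp: cdf[OF d] cdf[OF dyn0] G0_def)
  qed
  with opt0 show ?thesis by blast
qed

text \<open>Uniqueness in \<open>L_1\<close> is expressed almost everywhere. The continuous
  representative of \<open>g0\<close> gives meaning to the pointwise condition that defines
  \<open>t0\<close>.\<close>

theorem theorem1:
  fixes M :: "'a measure" and \<theta> lam :: real and wp wm :: "real \<Rightarrow> real"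
    and \<tau>0 :: "'a \<Rightarrow> ennreal" and f g0 :: "real \<Rightarrow> real" and t0 :: real
  defines "L \<equiv> - ln (p_one wm)"
  defines "Tstar \<equiv> (\<lambda>t. \<theta> / lam * ((if t > t0 then 1 else 0) + integral {0..min t t0} f))"
  assumes M: "prob_space M"
    and \<theta>: "\<theta> > 0" and lam: "lam > 0"
    and wp: "weighting wp" and wm: "weighting wm"
    and \<tau>0_meas: "\<tau>0 \<in> borel_measurable M"
    and \<tau>0_exp: "\<forall>t\<ge>0. measure M {\<omega>\<in>space M. \<tau>0 \<omega> > ennreal t} = exp (- t)"
    and g0_int: "g0 absolutely_integrable_on {0..L}"
    and g0_cont: "continuous_on {0..L} g0"
    and g0_eq: "\<forall>t\<in>{0..L}. exp (- t) - wm (exp (- t))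
                  - integral {0..t} (\<lambda>s. wm (exp (- t + s)) * g0 s) = 0"
    and g0_unique: "\<forall>g. g absolutely_integrable_on {0..L} \<and>
                  (\<forall>t\<in>{0..L}. exp (- t) - wm (exp (- t))
                      - integral {0..t} (\<lambda>s. wm (exp (- t + s)) * g s) = 0)
                  \<longrightarrow> (AE s in lborel. s \<in> {0..L} \<longrightarrow> g s = g0 s)"
    and t0_mem: "t0 \<in> {0..L}" "g0 t0 \<le> 0"
    and t0_least: "\<forall>t\<in>{0..L}. g0 t \<le> 0 \<longrightarrow> t0 \<le> t"
    and f_int: "f absolutely_integrable_on {0..t0}"
    and f_eq: "\<forall>t\<in>{0..t0}. wm (exp (- t0 + t)) + integral {t..t0} (\<lambda>s. wm (exp (- s + t)) * f s) = 1"
    and f_unique: "\<forall>h. h absolutely_integrable_on {0..t0} \<and>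
                  (\<forall>t\<in>{0..t0}. wm (exp (- t0 + t)) + integral {t..t0} (\<lambda>s. wm (exp (- s + t)) * h s) = 1)
                  \<longrightarrow> (AE s in lborel. s \<in> {0..t0} \<longrightarrow> h s = f s)"
  shows "optimal \<theta> lam wp wm M \<tau>0 Tstar \<and>
         (\<forall>\<tau> T. dyn_pricing M \<tau> T \<longrightarrow>
            (optimal \<theta> lam wp wm M \<tau> T \<longleftrightarrow>
               measure M {\<omega>\<in>space M. \<tau> \<omega> < \<infinity>} = 1 \<and>
               (\<forall>y\<ge>0. measure M {\<omega>\<in>space M. pay_at T (\<tau> \<omega>) \<le> ereal y}
                      = measure M {\<omega>\<in>space M. pay_at Tstar (\<tau>0 \<omega>) \<le> ereal y})))"
proof -
  obtain W W1 where sw: "smooth_weight W W1" and wm_W: "\<And>p. 0 \<le> p \<Longrightarrow> p \<le> 1 \<Longrightarrow> wm p = W p"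
    using ex_smooth_weight[OF wm] by blast
  interpret smooth_weight W W1 by (rule sw)
  \<comment> \<open>Unique existence makes the definite description \<open>p_one\<close> meaningful
    and yields \<open>0 < L\<close>.\<close>
  have "\<exists>!p. 0 < p \<and> p < 1 \<and> wm p = p"
    using fixpoint_ex1 wm_W by (metis less_imp_le)
  from theI'[OF this] have "0 < p_one wm" "p_one wm < 1" unfolding p_one_def by auto
  then have "0 < L" by (simp add: L_def)
  have volterra: "exp (- t) - W (exp (- t)) = integral {0..t} (\<lambda>s. W (exp (s - t)) * g0 s)" if "t \<in> {0..L}" for t
  proof -
    have "integral {0..t} (\<lambda>s. wm (exp (- t + s)) * g0 s) = integral {0..t} (\<lambda>s. W (exp (s - t)) * g0 s)"
      by (intro Henstock_Kurzweil_Integration.integral_cong) (auto simp: wm_W)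
    then show ?thesis using g0_eq[rule_format, OF that] that wm_W[of "exp (- t)"] by simp
  qed
  have "0 < g0 0" by (rule volterra_pos_0[OF \<open>0 < L\<close> g0_cont volterra])
  then have "0 < t0" using t0_mem by (cases "t0 = 0") auto
  interpret volterra_dual W W1 g0 t0
  proof
    show "0 < t0" by fact
    show "continuous_on {0..t0} g0" using t0_mem by (intro continuous_on_subset[OF g0_cont]) auto
    show "exp (- t) - W (exp (- t)) = integral {0..t} (\<lambda>s. W (exp (s - t)) * g0 s)" if "t \<in> {0..t0}" for t
      using that t0_mem by (intro volterra) auto
    show "0 < g0 t" if "0 \<le> t" "t < t0" for t
    proof -
      have "\<not> g0 t \<le> 0" using t0_least t0_mem that by auto
      then show ?thesis by simp
    qed
  qed fact
  \<comment> \<open>The Neumann series supplies a nonnegative solution of the differentiated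
    equation; uniqueness will identify it with \<open>f\<close> almost everywhere, so nonnegativity
    of \<open>f\<close> comes from here.\<close>
  obtain h where h: "h \<in> borel_measurable borel" "\<And>t. 0 \<le> h t"
    "(\<integral>\<^sup>+t\<in>{0..t0}. ennreal (h t) \<partial>lborel) < \<infinity>"
    "\<And>t. t \<in> {0..t0} \<Longrightarrow> ennreal (h t) = ennreal (kern (t0 - t)) +
       (\<integral>\<^sup>+s\<in>{t..t0}. ennreal (kern (s - t)) * ennreal (h s) \<partial>lborel)"
    by (rule ex_resolvent[OF less_imp_le[OF \<open>0 < t0\<close>]]) (rule that; assumption)
  obtain r where "0 \<le> r" "(\<integral>\<^sup>+t\<in>{0..t0}. ennreal (h t) \<partial>lborel) = ennreal r"
    using h(3) by (cases "\<integral>\<^sup>+t\<in>{0..t0}. ennreal (h t) \<partial>lborel" rule: ennreal_cases) auto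
  then have "(h has_integral r) {0..t0}"
    by (intro has_integral_set_nn_integral) (auto simp: h)
  then have "h absolutely_integrable_on {0..t0}"
    by (intro nonnegative_absolutely_integrable_1) (auto simp: h)
  moreover have "wm (exp (- t0 + t)) + integral {t..t0} (\<lambda>s. wm (exp (- s + t)) * h s) = 1" if t: "t \<in> {0..t0}" for t
  proof -
    have "integral {t..t0} (\<lambda>s. wm (exp (- s + t)) * h s) = integral {t..t0} (\<lambda>s. W (exp (- s + t)) * h s)"
      by (intro Henstock_Kurzweil_Integration.integral_cong) (auto simp: wm_W)
    moreover have "wm (exp (- t0 + t)) = W (exp (- t0 + t))" using t by (intro wm_W) auto
    ultimately show ?thesis using resolvent_equation[OF h t] by simp
  qed
  ultimately have "AE s in lborel. s \<in> {0..t0} \<longrightarrow> h s = f s"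
    using f_unique by blast
  \<comment> \<open>Changing \<open>f\<close> on a null set leaves the cumulative payment
    unchanged.\<close>
  then have "integral {0..min t t0} h = integral {0..min t t0} f" for t
    by (rule integral_cong_AE_lborel) auto
  then have "Tstar t = \<theta> / lam * ((if t0 < t then 1 else 0) + integral {0..min t t0} h)" for t
    by (simp add: Tstar_def)
  then show ?thesis
    by (intro optimality_characterization[OF M \<theta> lam wp wm_W \<tau>0_meas _ h]) (use \<tau>0_exp in auto)
qed

end
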